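(* Let $n\ge1$. For $1<p\le\infty$, one has continuous inclusions $L^p(\gamma)\subset H^1(\gamma)$ and $BMO(\gamma)\subset L^{p'}(\gamma)$ on $\mathbb{R}^n$, where $p'=p/(p-1)$ (so $p'=1$ when $p=\infty$).
   Context: $\gamma$ is the Gauss measure on $\mathbb{R}^n$, with density $\gamma_0(x)=\pi^{-n/2}e^{-|x|^2}$ with respect to Lebesgue measure. A closed Euclidean ball $B$ with radius $r_B$ and centre $c_B$ is called admissible if $r_B\le\min(1,1/|c_B|)$ (where $\min(1,1/|x|)=1$ for $x=0$); $\mathcal{B}_1$ is the family of all admissible balls. A Gaussian atom is either the constant function $1$ or a function $a\in L^\infty(\gamma)$ supported in an admissible ball $B$ with $\int a\,d\gamma=0$ and $\|a\|_\infty\le\gamma(B)^{-1}$. $H^1(\gamma)$ is the space of all $f\in L^1(\gamma)$ that admit a decomposition $f=\sum_j\lambda_j a_j$ with $a_j$ Gaussian atoms and $(\lambda_j)$ a summable sequence of complex numbers; $\|f\|_{H^1(\gamma)}$ is the infimum of $\sum_j|\lambda_j|$ over all such representations. $BMO(\gamma)$ is the space of all $f\in L^1(\gamma)$ with $\sup_{B\in\mathcal{B}_1}\frac1{\gamma(B)}\int_B|f-f_B|\,d\gamma<\infty$, where $f_B=\frac1{\gamma(B)}\int_B f\,d\gamma$, with norm $$\|f\|_{BMO(\gamma)}=\|f\|_{L^1(\gamma)}+\sup_{B\in\mathcal{B}_1}\frac1{\gamma(B)}\int_B|f-f_B|\,d\gamma.$$ *)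

theory Defs
  imports "HOL-Analysis.Analysis" "HOL-Probability.Essential_Supremum"
begin

text \<open>
  Function spaces are represented as sets of genuine functions together with a real-valued
  (semi)norm; membership in each space and its norm do not change when a function is replaced
  by a Borel function equal to it almost everywhere.
\<close>

definition Lp :: "'a measure \<Rightarrow> ennreal \<Rightarrow> ('a \<Rightarrow> complex) set" where
  "Lp M p = {f \<in> borel_measurable M.
     if p = \<infinity> then esssup M (\<lambda>x. ennreal (norm (f x))) < \<infinity>
     else integrable M (\<lambda>x. norm (f x) powr enn2real p)}"

definition Lp_norm :: "'a measure \<Rightarrow> ennreal \<Rightarrow> ('a \<Rightarrow> complex) \<Rightarrow> real" where
  "Lp_norm M p f =
     (if p = \<infinity> then enn2real (esssup M (\<lambda>x. ennreal (norm (f x))))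
      else (\<integral>x. norm (f x) powr enn2real p \<partial>M) powr (1 / enn2real p))"

definition conj_exponent :: "ennreal \<Rightarrow> ennreal" where
  "conj_exponent p = (if p = \<infinity> then 1 else p / (p - 1))"

definition gauss :: "(real ^ 'n) measure" where
  "gauss = density lborel
     (\<lambda>x. ennreal (pi powr (- real CARD('n) / 2) * exp (- (norm x)\<^sup>2)))"

text \<open>The case distinction is needed because \<open>1 / 0 = 0\<close>.  Balls have positive radius.\<close>

definition admissible_radius :: "real ^ 'n \<Rightarrow> real" where
  "admissible_radius c = (if c = 0 then 1 else min 1 (1 / norm c))"

definition admissible_balls :: "(real ^ 'n) set set" where
  "admissible_balls = {cball c r | c r. 0 < r \<and> r \<le> admissible_radius c}"

definition gaussian_atom :: "(real ^ 'n \<Rightarrow> complex) \<Rightarrow> bool" where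
  "gaussian_atom a \<longleftrightarrow>
     a = (\<lambda>_. 1) \<or>
     (a \<in> Lp gauss \<infinity> \<and>
      (\<exists>B \<in> admissible_balls.
         (AE x in gauss. x \<notin> B \<longrightarrow> a x = 0) \<and>
         (\<integral>x. a x \<partial>gauss) = 0 \<and>
         Lp_norm gauss \<infinity> a \<le> 1 / measure gauss B))"

text \<open>
  The series \<open>\<Sum>j. c j * a j\<close> is understood in \<open>L\<^sup>1\<close> of the Gauss measure, where it converges
  absolutely because atoms have \<open>L\<^sup>1\<close> norm at most \<open>1\<close>.  Finite sums are covered by taking
  almost all coefficients to be \<open>0\<close>.
\<close>

definition atomic_decomposition ::
    "(real ^ 'n \<Rightarrow> complex) \<Rightarrow> (nat \<Rightarrow> complex) \<Rightarrow> (nat \<Rightarrow> real ^ 'n \<Rightarrow> complex) \<Rightarrow> bool" where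
  "atomic_decomposition f c a \<longleftrightarrow>
     (\<forall>j. gaussian_atom (a j)) \<and>
     summable (\<lambda>j. norm (c j)) \<and>
     (\<lambda>N. Lp_norm gauss 1 (\<lambda>x. f x - (\<Sum>j<N. c j * a j x))) \<longlonglongrightarrow> 0"

definition H1 :: "(real ^ 'n \<Rightarrow> complex) set" where
  "H1 = {f \<in> Lp gauss 1. \<exists>c a. atomic_decomposition f c a}"

definition H1_norm :: "(real ^ 'n \<Rightarrow> complex) \<Rightarrow> real" where
  "H1_norm f = Inf {(\<Sum>j. norm (c j)) | c a. atomic_decomposition f c a}"

definition gauss_mean :: "(real ^ 'n) set \<Rightarrow> (real ^ 'n \<Rightarrow> complex) \<Rightarrow> complex" where
  "gauss_mean B f = (1 / measure gauss B) *\<^sub>R (LINT x:B|gauss. f x)"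

definition mean_oscillation :: "(real ^ 'n \<Rightarrow> complex) \<Rightarrow> (real ^ 'n) set \<Rightarrow> real" where
  "mean_oscillation f B =
     1 / measure gauss B * (LINT x:B|gauss. norm (f x - gauss_mean B f))"

definition BMO :: "(real ^ 'n \<Rightarrow> complex) set" where
  "BMO = {f \<in> Lp gauss 1. bdd_above (mean_oscillation f ` admissible_balls)}"

definition BMO_norm :: "(real ^ 'n \<Rightarrow> complex) \<Rightarrow> real" where
  "BMO_norm f = Lp_norm gauss 1 f + (SUP B \<in> admissible_balls. mean_oscillation f B)"

text \<open>Continuity of the (linear) inclusion map \<open>X \<subseteq> Y\<close> of normed spaces.\<close>

definition continuously_included ::
    "'f set \<Rightarrow> ('f \<Rightarrow> real) \<Rightarrow> 'f set \<Rightarrow> ('f \<Rightarrow> real) \<Rightarrow> bool" where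
  "continuously_included X normX Y normY \<longleftrightarrow>
     X \<subseteq> Y \<and> (\<exists>C. \<forall>f\<in>X. normY f \<le> C * normX f)"

end

theory Submission
  imports Defs "HOL-Probability.Distributions"
begin

text \<open>
  Everything rests on one estimate: for \<open>1 < p < \<infinity>\<close> a function \<open>f\<close> in \<open>L\<^sup>p\<close> is a series of atoms whose
  coefficients have sum at most \<open>C \<parallel>f\<parallel>\<^sub>p\<close> (\<open>Lp_atomic_bound\<close>).  The inclusion of \<open>BMO\<close> then
  follows by duality.

  \<^emph>\<open>Local part.\<close>  On an admissible ball the Gauss density is constant up to a fixed factor, so there
  the measure is as good as Lebesgue measure.  Space is cut into dyadic root cells whose diameter at
  \<open>x\<close> is comparable to \<open>1 / max 1 |x|\<close>; all their dyadic subcells have uniformly doubling mass.  If the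
  mean of \<open>|f|\<^sup>p\<close> over a cell \<open>Q\<close> is at most \<open>\<lambda>\<^sup>p\<close>, stopping-time cells produce atoms of total
  coefficient \<open>C \<lambda>\<^sup>1\<^sup>-\<^sup>p \<integral>\<^sub>Q |f|\<^sup>p\<close> and leave a function bounded by \<open>C \<lambda>\<close> with the integral of \<open>f\<close>
  (\<open>calderon_zygmund\<close>).  For a root cell the choice \<open>\<lambda>\<^sup>p = 1 +\<close> mean of \<open>|f|\<^sup>p\<close> makes both the atoms and the
  bounded remainder cost at most \<open>C \<integral>\<^sub>Q (|f|\<^sup>p + 1)\<close>, and this sums over the root cells because the measure is
  finite.

  \<^emph>\<open>Global part.\<close>  What is left of \<open>f\<close> on a root cell is its integral, carried by a normalised indicator near
  \<open>x\<close>.  Two such indicators with nearby centres differ by a bounded multiple of an atom.  Moving inwards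
  by \<open>1 / (4 max 1 |x|)\<close> lowers \<open>|x|\<^sup>2\<close> by at least \<open>1/16\<close> as long as \<open>|x| > 1/4\<close>, so that the mass reaches the origin after about
  \<open>|x|\<^sup>2\<close> moves (\<open>bump_transport\<close>).  The cost of all transports is \<open>C \<integral> |f| max(1, |x|)\<^sup>2\<close>, which Young's
  inequality controls by \<open>\<integral> |f|\<^sup>p\<close> and a moment of the Gauss measure (\<open>root_piece\<close>).  Hence \<open>f - (\<integral> f) b\<close> is
  atomic, where \<open>b\<close> is the normalised indicator at the origin.  For \<open>f = 1\<close>, itself an atom, this says
  that \<open>b\<close> is atomic, and therefore so is every \<open>f\<close>.

  The selection of stopping cells is an induction over scales, which needs functions that are constant on the cells of
  some level (\<open>step\<close>).  These are dense in \<open>L\<^sup>p\<close> (\<open>step_dense_Lp\<close>), and a rapidly converging telescoping series of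
  them gives the general case.

  \<^emph>\<open>Duality.\<close>  Let \<open>f\<close> be in \<open>BMO\<close> and \<open>h = min |f| N\<close>.  As an atom \<open>a\<close> on a ball \<open>B\<close> has integral \<open>0\<close>, a constant
  may be subtracted from \<open>h\<close> in \<open>\<integral> h a\<close>, which is therefore at most the mean oscillation of \<open>f\<close> on \<open>B\<close>
  (\<open>atom_pairing\<close>).  So \<open>|\<integral> h g| \<le> C \<parallel>g\<parallel>\<^sub>p \<parallel>f\<parallel>\<close> for \<open>g\<close> in \<open>L\<^sup>p\<close>, the last norm being that of \<open>BMO\<close>.  With
  \<open>g = h\<^sup>q\<^sup>-\<^sup>1\<close> for the conjugate exponent \<open>q\<close> this reads
  \<open>\<integral> h\<^sup>q \<le> C (\<integral> h\<^sup>q)\<^sup>1\<^sup>/\<^sup>p \<parallel>f\<parallel>\<close>; dividing and letting \<open>N\<close> tend to infinity bounds \<open>\<parallel>f\<parallel>\<^sub>q\<close> (\<open>BMO_Lq\<close>).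

  For \<open>p = \<infinity>\<close> one has \<open>L\<^sup>\<infinity> \<subseteq> L\<^sup>2\<close> since the measure is finite, and the norm of \<open>BMO\<close> contains the \<open>L\<^sup>1\<close>
  norm.
\<close>

section \<open>The Gauss measure\<close>

lemma sets_gauss [simp, measurable_cong]: "sets (gauss :: (real ^ 'n) measure) = sets borel"
  by (simp add: gauss_def)

lemma space_gauss [simp]: "space (gauss :: (real ^ 'n) measure) = UNIV"
  by (simp add: gauss_def)

definition gauss_weight :: "real ^ 'n \<Rightarrow> real" where
  "gauss_weight x = pi powr (- real CARD('n) / 2) * exp (- (norm x)\<^sup>2)"

lemma gauss_weight_pos [simp]: "0 < gauss_weight x"
  by (simp add: gauss_weight_def)

lemma gauss_weight_measurable [measurable]: "gauss_weight \<in> borel_measurable borel"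
  unfolding gauss_weight_def[abs_def] by measurable

lemma gauss_eq: "gauss = density lborel (\<lambda>x. ennreal (gauss_weight x))"
  by (simp add: gauss_def gauss_weight_def)

text \<open>
  The integrand is a product of one-dimensional normal densities, one for each coordinate.
\<close>

lemma integrable_exp_norm_sq:
  assumes "0 < s"
  shows "integrable lborel (\<lambda>x::real ^ 'n. exp (- s * (norm x)\<^sup>2))"
proof -
  define \<sigma> where "\<sigma> = sqrt (1 / (2 * s))"
  have \<sigma>: "\<sigma> > 0" "\<sigma>\<^sup>2 = 1 / (2 * s)" using assms by (auto simp: \<sigma>_def)
  have "integrable lborel (\<lambda>t. sqrt (2 * pi * \<sigma>\<^sup>2) * normal_density 0 \<sigma> t)"
    using \<sigma>(1) by (intro integrable_mult_right) auto
  also have "(\<lambda>t. sqrt (2 * pi * \<sigma>\<^sup>2) * normal_density 0 \<sigma> t) = (\<lambda>t. exp (- s * t\<^sup>2))"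
    using \<sigma> assms by (auto simp: normal_density_def field_simps fun_eq_iff)
  finally have int1: "integrable lborel (\<lambda>t. exp (- s * t\<^sup>2))" .
  have fin1: "(\<integral>\<^sup>+t. ennreal (exp (- s * t\<^sup>2)) \<partial>lborel) < \<infinity>"
    using int1 by (subst (asm) integrable_iff_bounded) simp
  have "(\<integral>\<^sup>+x. ennreal (exp (- s * (norm (x::real^'n))\<^sup>2)) \<partial>lborel)
      = (\<integral>\<^sup>+x. (\<Prod>b\<in>Basis. ennreal (exp (- s * ((x::real^'n) \<bullet> b)\<^sup>2))) \<partial>lborel)"
  proof (rule nn_integral_cong)
    fix x :: "real^'n"
    have "exp (- s * (norm x)\<^sup>2) = exp (\<Sum>b\<in>Basis. - s * (x \<bullet> b)\<^sup>2)"
      unfolding power2_norm_eq_inner by (subst euclidean_inner) (simp add: power2_eq_square sum_distrib_left)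
    also have "\<dots> = (\<Prod>b\<in>Basis. exp (- s * (x \<bullet> b)\<^sup>2))"
      by (rule exp_sum) simp
    finally show "ennreal (exp (- s * (norm x)\<^sup>2)) = (\<Prod>b\<in>Basis. ennreal (exp (- s * (x \<bullet> b)\<^sup>2)))"
      by (simp add: prod_ennreal)
  qed
  also have "\<dots> = (\<Prod>b\<in>(Basis::(real^'n) set). (\<integral>\<^sup>+t. ennreal (exp (- s * t\<^sup>2)) \<partial>lborel))"
    by (rule nn_integral_lborel_prod) auto
  also have "\<dots> < \<infinity>"
    using fin1 by (simp add: power_less_top_ennreal)
  finally show ?thesis
    by (subst integrable_iff_bounded) simp
qed

lemma integrable_gauss_iff:
  fixes f :: "real ^ 'n \<Rightarrow> 'b :: {banach, second_countable_topology}"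
  assumes [measurable]: "f \<in> borel_measurable borel"
  shows "integrable gauss f \<longleftrightarrow> integrable lborel (\<lambda>x. gauss_weight x *\<^sub>R f x)"
  unfolding gauss_eq by (rule integrable_density) (auto simp: less_imp_le)

text \<open>
  An exponential moment of any order \<open>s < 1\<close> is still Gaussian after multiplication by the density. It yields finiteness
  of the measure (\<open>s = 0\<close>) and all polynomial moments (\<open>s = 1/2\<close>).
\<close>

lemma integrable_gauss_exp_norm_sq:
  assumes "s < 1"
  shows "integrable gauss (\<lambda>x::real ^ 'n. exp (s * (norm x)\<^sup>2))"
proof -
  have "integrable lborel (\<lambda>x::real^'n. pi powr (- real CARD('n) / 2) * exp (- (1 - s) * (norm x)\<^sup>2))"
    using assms integrable_exp_norm_sq[of "1 - s"] by (intro integrable_mult_right) auto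
  then show ?thesis
    by (subst integrable_gauss_iff)
      (simp_all add: gauss_weight_def mult_exp_exp mult.assoc left_diff_distrib)
qed

interpretation gauss: finite_measure "gauss :: (real ^ 'n) measure"
proof
  have "integrable (gauss :: (real ^ 'n) measure) (\<lambda>x. 1::real)"
    using integrable_gauss_exp_norm_sq[of 0] by simp
  then show "emeasure (gauss :: (real ^ 'n) measure) (space gauss) \<noteq> \<infinity>"
    by (subst (asm) integrable_iff_bounded) simp
qed

text \<open>
  The largest admissible radius at \<open>x\<close> is \<open>1 / inv_radius x\<close>. Its inverse, unlike the radius itself, has no
  exceptional case at the origin and is Lipschitz with constant \<open>1\<close>.
\<close>

definition inv_radius :: "real ^ 'n \<Rightarrow> real" where "inv_radius x = max 1 (norm x)"

lemma inv_radius_ge1 [simp]: "1 \<le> inv_radius x" and norm_le_inv_radius: "norm x \<le> inv_radius x"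
  by (auto simp: inv_radius_def)

lemma inv_radius_pos [simp]: "0 < inv_radius x"
  by (simp add: inv_radius_def)

lemma inv_radius_nonneg [simp]: "0 \<le> inv_radius x"
  using inv_radius_pos[of x] by linarith

lemma inv_radius_measurable [measurable]: "inv_radius \<in> borel_measurable borel"
  unfolding inv_radius_def[abs_def] by measurable

lemma inv_radius_lipschitz: "inv_radius x \<le> inv_radius y + norm (x - y)"
  unfolding inv_radius_def using norm_triangle_sub[of x y] norm_ge_zero[of "x - y"] by linarith

lemma admissible_radius_eq: "admissible_radius x = 1 / inv_radius x"
  by (auto simp: admissible_radius_def inv_radius_def min_def max_def field_simps)

lemma integrable_gauss_inv_radius_powr:
  assumes "0 \<le> q"
  shows "integrable (gauss :: (real ^ 'n) measure) (\<lambda>x. inv_radius x powr q)"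
proof -
  \<comment> \<open>Any \<open>s \<le> 1\<close> gives \<open>(max 1 |x|)\<^sup>2 \<le> exp (s |x|\<^sup>2) / s\<close>; this one keeps the power \<open>q / 2\<close> of
    the right-hand side below \<open>exp (|x|\<^sup>2 / 2)\<close>.\<close>
  define s where "s = 1 / (q + 1)"
  have s: "0 < s" "s \<le> 1" "s * (q / 2) \<le> 1 / 2"
    using assms by (auto simp: s_def field_simps)
  have bound: "inv_radius x powr q \<le> (1 / s) powr (q / 2) * exp (1 / 2 * (norm x)\<^sup>2)" for x :: "real ^ 'n"
  proof -
    have "(inv_radius x)\<^sup>2 \<le> 1 + (norm x)\<^sup>2"
      by (auto simp: inv_radius_def max_def power2_eq_square mult_le_one)
    also have "\<dots> \<le> (1 + s * (norm x)\<^sup>2) / s"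
      using s by (simp add: field_simps)
    also have "\<dots> \<le> exp (s * (norm x)\<^sup>2) / s"
      using s by (intro divide_right_mono exp_ge_add_one_self) auto
    finally have "((inv_radius x)\<^sup>2) powr (q / 2) \<le> (exp (s * (norm x)\<^sup>2) / s) powr (q / 2)"
      using assms by (intro powr_mono2) auto
    also have "((inv_radius x)\<^sup>2) powr (q / 2) = inv_radius x powr q"
      by (simp add: powr_powr flip: powr_numeral)
    also have "(exp (s * (norm x)\<^sup>2) / s) powr (q / 2) = (1 / s) powr (q / 2) * exp (s * (q / 2) * (norm x)\<^sup>2)"
      using s by (simp add: powr_divide exp_powr_real mult_ac)
    also have "\<dots> \<le> (1 / s) powr (q / 2) * exp (1 / 2 * (norm x)\<^sup>2)"
      using s by (intro mult_left_mono iffD2[OF exp_le_cancel_iff] mult_right_mono) auto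
    finally show ?thesis .
  qed
  show ?thesis
  proof (rule Bochner_Integration.integrable_bound)
    show "integrable gauss (\<lambda>x::real ^ 'n. (1 / s) powr (q / 2) * exp (1 / 2 * (norm x)\<^sup>2))"
      using integrable_gauss_exp_norm_sq[of "1/2"] by (intro integrable_mult_right) simp
    show "AE x in gauss. norm (inv_radius x powr q) \<le> norm ((1 / s) powr (q / 2) * exp (1 / 2 * (norm (x::real^'n))\<^sup>2))"
      using bound by (intro AE_I2) (simp add: abs_mult)
  qed measurable
qed

section \<open>Atomic decompositions\<close>

lemma Linfty_AE_le:
  fixes f :: "real ^ 'n \<Rightarrow> complex"
  assumes "f \<in> Lp gauss \<infinity>"
  shows "AE x in gauss. norm (f x) \<le> Lp_norm gauss \<infinity> f"
  using esssup_AE[where M = gauss and f = "\<lambda>x. ennreal (norm (f x))"]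
proof eventually_elim
  case (elim x)
  then have "enn2real (ennreal (norm (f x))) \<le> Lp_norm gauss \<infinity> f"
    using assms unfolding Lp_norm_def Lp_def by (auto intro!: enn2real_mono simp del: enn2real_ennreal)
  then show ?case by simp
qed

text \<open>
  The size and support conditions say that \<open>|a|\<close> is below the density of the uniform distribution on the ball, so the
  \<open>L\<^sup>1\<close> norm of such an atom is at most \<open>1\<close>. The other summand of the bound serves the constant atom.
\<close>

lemma gaussian_atom_facts:
  assumes "gaussian_atom (a :: real ^ 'n \<Rightarrow> complex)"
  shows gaussian_atom_measurable: "a \<in> borel_measurable borel"
    and gaussian_atom_integrable: "integrable gauss a"
    and gaussian_atom_norm: "(\<integral>x. norm (a x) \<partial>gauss) \<le> 1 + measure gauss (UNIV :: (real ^ 'n) set)"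
proof -
  let ?g = "gauss :: (real ^ 'n) measure"
  have "a \<in> borel_measurable borel \<and> integrable ?g a \<and> (\<integral>x. norm (a x) \<partial>?g) \<le> 1 + measure ?g UNIV"
  proof (cases "a = (\<lambda>_. 1)")
    case True
    then show ?thesis by simp
  next
    case False
    then obtain B where a: "a \<in> Lp gauss \<infinity>" and B: "B \<in> admissible_balls"
      and supp: "AE x in gauss. x \<notin> B \<longrightarrow> a x = 0" and le: "Lp_norm gauss \<infinity> a \<le> 1 / measure gauss B"
      using assms by (auto simp: gaussian_atom_def)
    have meas [measurable]: "a \<in> borel_measurable borel"
      using a by (simp add: Lp_def cong: measurable_cong_sets)
    have B_meas [measurable]: "B \<in> sets borel"
      using B by (auto simp: admissible_balls_def)
    have bnd: "AE x in ?g. norm (a x) \<le> 1 / measure gauss B * indicator B x"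
      using Linfty_AE_le[OF a] supp
    proof eventually_elim
      case (elim x)
      then show ?case using le by (auto simp: indicator_def)
    qed
    have int: "integrable ?g (\<lambda>x. 1 / measure gauss B * indicator B x)"
      by (intro integrable_mult_right integrable_real_indicator)
         (auto simp: gauss.emeasure_eq_measure)
    have ia: "integrable ?g a"
      by (rule Bochner_Integration.integrable_bound[OF int]) (use bnd in \<open>auto elim!: eventually_mono\<close>)
    have "(\<integral>x. norm (a x) \<partial>?g) \<le> (\<integral>x. 1 / measure gauss B * indicator B x \<partial>?g)"
      by (intro integral_mono_AE integrable_norm ia int bnd)
    also have "\<dots> \<le> 1" by simp
    finally show ?thesis using ia meas by (simp add: add_increasing2)
  qed
  then show "a \<in> borel_measurable borel" "integrable gauss a"
    "(\<integral>x. norm (a x) \<partial>gauss) \<le> 1 + measure gauss (UNIV :: (real ^ 'n) set)" by auto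
qed

lemma gaussian_atom_one: "gaussian_atom (\<lambda>_. 1)"
  by (simp add: gaussian_atom_def)

lemma atomic_series_facts:
  fixes a :: "nat \<Rightarrow> real ^ 'n \<Rightarrow> complex"
  assumes a: "\<And>j. gaussian_atom (a j)" and c: "summable (\<lambda>j. norm (c j))"
  shows atomic_series_AE_summable: "AE x in gauss. summable (\<lambda>j. norm (c j * a j x))"
    and atomic_series_integral_summable: "summable (\<lambda>j. \<integral>x. norm (c j * a j x) \<partial>gauss)"
proof -
  let ?g = "gauss :: (real ^ 'n) measure"
  let ?G = "1 + measure gauss (UNIV :: (real ^ 'n) set)"
  have int: "integrable ?g (\<lambda>x. c j * a j x)" for j
    using gaussian_atom_integrable[OF a[of j]] by simp
  note meas [measurable] = gaussian_atom_measurable[OF a]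
  have le: "(\<integral>x. norm (c j * a j x) \<partial>?g) \<le> norm (c j) * ?G" for j
    using gaussian_atom_norm[OF a[of j]] by (auto simp: norm_mult intro!: mult_left_mono)
  show sI: "summable (\<lambda>j. \<integral>x. norm (c j * a j x) \<partial>?g)"
    by (rule summable_comparison_test'[OF summable_mult2[OF c, of ?G]]) (use le in auto)
  have "(\<integral>\<^sup>+x. (\<Sum>j. ennreal (norm (c j * a j x))) \<partial>?g) = (\<Sum>j. \<integral>\<^sup>+x. ennreal (norm (c j * a j x)) \<partial>?g)"
    by (rule nn_integral_suminf) (simp cong: measurable_cong_sets)
  also have "\<dots> = (\<Sum>j. ennreal (\<integral>x. norm (c j * a j x) \<partial>?g))"
    using int by (intro suminf_cong nn_integral_eq_integral) auto
  also have "\<dots> < \<infinity>"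
    using sI by (simp add: suminf_ennreal2)
  finally have fin: "(\<integral>\<^sup>+x. (\<Sum>j. ennreal (norm (c j * a j x))) \<partial>?g) \<noteq> \<infinity>" by simp
  have "AE x in ?g. (\<Sum>j. ennreal (norm (c j * a j x))) \<noteq> \<infinity>"
    by (rule nn_integral_noteq_infinite[OF _ fin]) (simp cong: measurable_cong_sets)
  then show "AE x in gauss. summable (\<lambda>j. norm (c j * a j x))"
    by eventually_elim (rule summable_suminf_not_top, auto)
qed

text \<open>
  The relation "\<open>f\<close> has atomic norm at most \<open>K\<close>, and the bound is attained by a decomposition". The series is required to
  converge almost everywhere. For atoms with summable coefficients it converges absolutely
  almost everywhere and in \<open>L\<^sup>1\<close>, so the two modes of convergence determine the same function; pointwise
  convergence is the one that rearranges easily.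
\<close>

definition atomic_bound :: "(real ^ 'n \<Rightarrow> complex) \<Rightarrow> real \<Rightarrow> bool" where
  "atomic_bound f K \<longleftrightarrow> f \<in> borel_measurable borel \<and>
     (\<exists>c a. (\<forall>j. gaussian_atom (a j)) \<and> summable (\<lambda>j. norm (c j)) \<and> (\<Sum>j. norm (c j)) \<le> K \<and>
            (AE x in gauss. (\<lambda>j. c j * a j x) sums f x))"

lemma atomic_boundE:
  assumes "atomic_bound f K"
  obtains c a where "\<And>j. gaussian_atom (a j)" "summable (\<lambda>j. norm (c j))"
    "(\<Sum>j. norm (c j)) \<le> K" "AE x in gauss. (\<lambda>j. c j * a j x) sums f x"
  using assms by (auto simp: atomic_bound_def)

lemma atomic_boundI:
  assumes "\<And>j. gaussian_atom (a j)" "summable (\<lambda>j. norm (c j))" "(\<Sum>j. norm (c j)) \<le> K"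
    "AE x in gauss. (\<lambda>j. c j * a j x) sums f x" "f \<in> borel_measurable borel"
  shows "atomic_bound f K"
  unfolding atomic_bound_def using assms by (intro conjI exI[of _ c] exI[of _ a]) auto

lemma atomic_bound_measurable: "atomic_bound f K \<Longrightarrow> f \<in> borel_measurable borel"
  by (simp add: atomic_bound_def)

lemma atomic_bound_mono: "atomic_bound f K \<Longrightarrow> K \<le> L \<Longrightarrow> atomic_bound f L"
  unfolding atomic_bound_def by (meson order_trans)

lemma atomic_bound_nonneg: "atomic_bound f K \<Longrightarrow> 0 \<le> K"
  
  by (erule atomic_boundE) (use order_trans[OF suminf_nonneg[OF _ norm_ge_zero]] in \<open>fast\<close>)

lemma atomic_bound_integrable:
  assumes "atomic_bound f K"
  shows "integrable gauss f"
proof -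
  obtain c a where *: "\<And>j. gaussian_atom (a j)" "summable (\<lambda>j. norm (c j))"
    "(\<Sum>j. norm (c j)) \<le> K" "AE x in gauss. (\<lambda>j. c j * a j x) sums f x"
    by (rule atomic_boundE[OF assms]) blast
  have 1: "integrable gauss (\<lambda>x. \<Sum>j. c j * a j x)"
    by (intro integrable_suminf atomic_series_AE_summable atomic_series_integral_summable * 
        integrable_mult_right gaussian_atom_integrable)
  then show ?thesis
    by (rule integrable_cong_AE_imp)
      (use * atomic_bound_measurable[OF assms] in \<open>auto simp: sums_iff cong: measurable_cong_sets\<close>)
qed

lemma atomic_bound_AE_cong:
  assumes "atomic_bound f K" "AE x in gauss. f x = g x" "g \<in> borel_measurable borel"
  shows "atomic_bound g K"
proof -
  obtain c a where *: "\<And>j. gaussian_atom (a j)" "summable (\<lambda>j. norm (c j))"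
    "(\<Sum>j. norm (c j)) \<le> K" "AE x in gauss. (\<lambda>j. c j * a j x) sums f x"
    by (rule atomic_boundE[OF assms(1)]) blast
  have "AE x in gauss. (\<lambda>j. c j * a j x) sums g x"
    using *(4) assms(2) by eventually_elim simp
  then show ?thesis by (rule atomic_boundI[OF *(1-3) _ assms(3)])
qed

lemma atomic_bound_scale:
  assumes "atomic_bound f K"
  shows "atomic_bound (\<lambda>x. z * f x) (norm z * K)"
proof -
  obtain c a where *: "\<And>j. gaussian_atom (a j)" "summable (\<lambda>j. norm (c j))"
    "(\<Sum>j. norm (c j)) \<le> K" "AE x in gauss. (\<lambda>j. c j * a j x) sums f x"
    by (rule atomic_boundE[OF assms(1)]) blast
  have "AE x in gauss. (\<lambda>j. (z * c j) * a j x) sums (z * f x)"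
    using *(4) by eventually_elim (simp add: mult.assoc sums_mult)
  moreover have "summable (\<lambda>j. norm (z * c j))" "(\<Sum>j. norm (z * c j)) \<le> norm z * K"
    using *(2,3) by (auto simp: norm_mult suminf_mult intro: summable_mult mult_left_mono)
  moreover have "(\<lambda>x. z * f x) \<in> borel_measurable borel"
    using atomic_bound_measurable[OF assms] by simp
  ultimately show ?thesis
    by (intro atomic_boundI[of a "\<lambda>j. z * c j"] *(1)) auto
qed

text \<open>
  Countable subadditivity. The double series of coefficients is absolutely summable, hence may be enumerated along
  a pairing function; almost everywhere the same holds for the double series of values, so that
  summing row by row recovers the limit.
\<close>

lemma atomic_bound_suminf:
  fixes f :: "nat \<Rightarrow> real ^ 'n \<Rightarrow> complex"
  assumes f: "\<And>i. atomic_bound (f i) (K i)" and K: "summable K"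
    and g: "g \<in> borel_measurable borel" "AE x in gauss. (\<lambda>i. f i x) sums g x"
  shows "atomic_bound g (\<Sum>i. K i)"
proof -
  define D where "D i c a \<longleftrightarrow> (\<forall>j. gaussian_atom (a j)) \<and> summable (\<lambda>j. norm (c j)) \<and>
      (\<Sum>j. norm (c j)) \<le> K i \<and> (AE x in gauss. (\<lambda>j. c j * a j x) sums f i x)" for i c a
  have "\<forall>i. \<exists>c a. D i c a"
    using f by (simp add: atomic_bound_def D_def)
  then obtain c a where D: "\<And>i. D i (c i) (a i)"
    by metis
  have a: "gaussian_atom (a i j)" and c: "summable (\<lambda>j. norm (c i j))"
    and cK: "(\<Sum>j. norm (c i j)) \<le> K i"
    and s: "AE x in gauss. (\<lambda>j. c i j * a i j x) sums f i x" for i j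
    using D[of i] by (auto simp: D_def)
  define c' where "c' n = (case prod_decode n of (i, j) \<Rightarrow> c i j)" for n
  define a' where "a' n = (case prod_decode n of (i, j) \<Rightarrow> a i j)" for n
  have a': "gaussian_atom (a' n)" for n
    using a by (simp add: a'_def split: prod.split)
  have bij: "bij_betw prod_decode UNIV (UNIV \<times> UNIV)"
    using bij_prod_decode by simp
  have hc: "((\<lambda>j. norm (c i j)) has_sum (\<Sum>j. norm (c i j))) UNIV" for i
    by (rule norm_summable_imp_has_sum) (use c[of i] in \<open>auto intro: summable_sums\<close>)
  have sc: "summable (\<lambda>i. \<Sum>j. norm (c i j))"
    by (rule summable_comparison_test'[OF K]) (use cK in \<open>auto simp: suminf_nonneg c\<close>)
  have s1: "(\<lambda>(i, j). norm (c i j)) summable_on (UNIV \<times> UNIV)"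
    by (rule summable_on_SigmaI[where g = "\<lambda>i. \<Sum>j. norm (c i j)"])
      (use hc sc in \<open>auto simp: summable_on_UNIV_nonneg_real_iff suminf_nonneg c\<close>)
  have hs: "((\<lambda>(i, j). norm (c i j)) has_sum (\<Sum>i. \<Sum>j. norm (c i j))) (UNIV \<times> UNIV)"
  proof (rule has_sum_SigmaI[OF _ _ s1])
    show "((\<lambda>i. \<Sum>j. norm (c i j)) has_sum (\<Sum>i. \<Sum>j. norm (c i j))) UNIV"
      by (rule sums_nonneg_imp_has_sum) (use sc in \<open>auto intro: summable_sums suminf_nonneg c\<close>)
  qed (use hc in auto)
  then have "((\<lambda>n. norm (c' n)) has_sum (\<Sum>i. \<Sum>j. norm (c i j))) UNIV"
    by (subst (asm) has_sum_reindex_bij_betw[OF bij, symmetric]) (simp add: c'_def case_prod_unfold)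
  then have sums_c': "(\<lambda>n. norm (c' n)) sums (\<Sum>i. \<Sum>j. norm (c i j))"
    by (rule has_sum_imp_sums)
  then have c': "summable (\<lambda>n. norm (c' n))" by (simp add: sums_iff)
  have le: "(\<Sum>n. norm (c' n)) \<le> (\<Sum>i. K i)"
    using sums_c' suminf_le[OF cK sc K] by (simp add: sums_iff)
  have "AE x in gauss. \<forall>i. (\<lambda>j. c i j * a i j x) sums f i x"
    using s by (simp add: AE_all_countable)
  with atomic_series_AE_summable[of a' c', OF a' c'] g(2)
  have "AE x in gauss. (\<lambda>n. c' n * a' n x) sums g x"
  proof eventually_elim
    case (elim x)
    let ?T = "\<Sum>n. c' n * a' n x"
    have T: "((\<lambda>n. c' n * a' n x) has_sum ?T) UNIV"
      using elim(1) by (intro norm_summable_imp_has_sum) (auto intro: summable_sums summable_norm_cancel)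
    then have double: "((\<lambda>(i, j). c i j * a i j x) has_sum ?T) (UNIV \<times> UNIV)"
      by (subst has_sum_reindex_bij_betw[OF bij, symmetric])
         (simp add: c'_def a'_def case_prod_unfold)
    have inner: "((\<lambda>j. c i j * a i j x) has_sum f i x) UNIV" for i
    proof -
      have "(\<lambda>n. norm (c' n * a' n x)) summable_on UNIV"
        using elim(1) by (simp add: summable_on_UNIV_nonneg_real_iff)
      then have "(\<lambda>n. norm (c' n * a' n x)) summable_on ((\<lambda>j. prod_encode (i, j)) ` UNIV)"
        by (rule summable_on_subset_banach) auto
      then have "(\<lambda>j. norm (c i j * a i j x)) summable_on UNIV"
        by (subst (asm) summable_on_reindex) (auto simp: inj_on_def o_def c'_def a'_def)
      then have "summable (\<lambda>j. norm (c i j * a i j x))"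
        by (simp add: summable_on_UNIV_nonneg_real_iff)
      then show ?thesis using elim(3) by (intro norm_summable_imp_has_sum) auto
    qed
    have "((\<lambda>i. f i x) has_sum ?T) UNIV"
      by (rule has_sum_SigmaD[OF double]) (use inner in simp)
    then have "(\<lambda>i. f i x) sums ?T" by (rule has_sum_imp_sums)
    with elim(2) have "?T = g x" by (metis sums_unique2)
    then show ?case using has_sum_imp_sums[OF T] by simp
  qed
  then show ?thesis
    by (rule atomic_boundI[of a' c', OF a' c' le _ g(1)])
qed

lemma atomic_bound_atom:
  assumes "gaussian_atom a"
  shows "atomic_bound (\<lambda>x. z * a x) (norm z)"
  unfolding atomic_bound_def
proof (intro conjI exI)
  let ?c = "\<lambda>j::nat. if j = 0 then z else 0"
  have n: "(\<lambda>j. norm (?c j)) = (\<lambda>j. if j = 0 then norm z else 0)" by auto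
  have *: "(\<lambda>j. norm (?c j)) sums norm z"
    unfolding n by (rule sums_single)
  show "\<forall>j::nat. gaussian_atom a" "summable (\<lambda>j. norm (?c j))" "(\<Sum>j. norm (?c j)) \<le> norm z"
    using assms * by (auto simp: sums_iff)
  show "(\<lambda>x. z * a x) \<in> borel_measurable borel"
    using gaussian_atom_measurable[OF assms] by simp
  have "(\<lambda>j. ?c j * a x) sums (z * a x)" for x
    using sums_single[of 0 "\<lambda>j. z * a x"] by (simp add: if_distrib if_distribR cong: if_cong)
  then show "AE x in gauss. (\<lambda>j. ?c j * a x) sums (z * a x)" by simp
qed

lemma atomic_bound_zero: "atomic_bound (\<lambda>x. 0) 0"
  using atomic_bound_atom[OF gaussian_atom_one, of 0] by simp

lemma atomic_bound_add:
  assumes "atomic_bound f K" "atomic_bound g L"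
  shows "atomic_bound (\<lambda>x. f x + g x) (K + L)"
proof -
  let ?f = "\<lambda>i::nat. if i = 0 then f else if i = 1 then g else (\<lambda>x. 0)"
  let ?K = "\<lambda>i::nat. if i = 0 then K else if i = 1 then L else 0"
  have sK: "?K sums (K + L)"
    using sums_If_finite_set'[of "\<lambda>i. 0::real" 0 "{0,1::nat}" "K + L" ?K] 
      sums_finite[of "{0,1}" ?K] by simp
  have sf: "(\<lambda>i. ?f i x) sums (f x + g x)" for x
    using sums_finite[of "{0,1}" "\<lambda>i. ?f i x"] by simp
  have "atomic_bound (\<lambda>x. f x + g x) (\<Sum>i. ?K i)"
  proof (rule atomic_bound_suminf)
    show "atomic_bound (?f i) (?K i)" for i using assms atomic_bound_zero by auto
    show "summable ?K" using sK by (simp add: sums_iff)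
    show "(\<lambda>x. f x + g x) \<in> borel_measurable borel"
      using assms[THEN atomic_bound_measurable] by simp
    show "AE x in gauss. (\<lambda>i. ?f i x) sums (f x + g x)" using sf by simp
  qed
  then show ?thesis using sK by (simp add: sums_iff)
qed

lemma atomic_bound_sum:
  assumes "finite I" "\<And>i. i \<in> I \<Longrightarrow> atomic_bound (f i) (K i)"
  shows "atomic_bound (\<lambda>x. \<Sum>i\<in>I. f i x) (\<Sum>i\<in>I. K i)"
  using assms by (induction I rule: finite_induct) (auto intro: atomic_bound_zero atomic_bound_add)

text \<open>
  All non-constant atoms enter through this criterion: up to the factor \<open>M \<gamma>(B)\<close> the function is an atom.
\<close>

lemma atomic_bound_ball:
  assumes h [measurable]: "h \<in> borel_measurable borel" and B: "B \<in> admissible_balls"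
    and supp: "\<And>x. x \<notin> B \<Longrightarrow> h x = 0" and M: "\<And>x. norm (h x) \<le> M"
    and int0: "(\<integral>x. h x \<partial>gauss) = 0"
  shows "atomic_bound (h :: real ^ 'n \<Rightarrow> complex) (M * measure gauss B)"
proof (cases "M * measure gauss B = 0")
  case True
  have [measurable]: "B \<in> sets borel"
    using B by (auto simp: admissible_balls_def)
  have "AE x in gauss. 0 = h x"
  proof (cases "M = 0")
    case False
    then have "emeasure gauss B = 0" using True by (simp add: gauss.emeasure_eq_measure)
    then have "AE x in gauss. x \<notin> B" by (intro AE_not_in null_setsI) auto
    then show ?thesis by eventually_elim (simp add: supp)
  qed (use M in auto)
  then show ?thesis unfolding True by (rule atomic_bound_AE_cong[OF atomic_bound_zero _ h])
next
  case False
  define s where "s = M * measure gauss B"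
  have "0 \<le> M" using M[of 0] norm_ge_zero order_trans by blast
  then have pos: "s > 0" "M > 0" "measure gauss B > 0" using False 
    by (auto simp: s_def less_le zero_less_mult_iff)
  define a where "a = (\<lambda>x. h x / of_real s)"
  have le: "norm (a x) \<le> 1 / measure gauss B" for x
    using M[of x] pos by (simp add: a_def norm_divide norm_mult s_def field_simps)
  have ess: "esssup gauss (\<lambda>x. ennreal (norm (a x))) \<le> ennreal (1 / measure gauss B)"
    using le by (intro esssup_I) (auto simp: a_def cong: measurable_cong_sets intro!: ennreal_leI)
  have meas: "a \<in> borel_measurable gauss" by (simp add: a_def cong: measurable_cong_sets)
  have "gaussian_atom a"
    unfolding gaussian_atom_def
  proof (intro disjI2 conjI bexI[OF _ B])
    show "a \<in> Lp gauss \<infinity>"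
      using meas ess by (auto simp: Lp_def intro: le_less_trans)
    show "Lp_norm gauss \<infinity> a \<le> 1 / measure gauss B"
      using ess pos by (auto simp: Lp_norm_def intro!: enn2real_leI)
    show "AE x in gauss. x \<notin> B \<longrightarrow> a x = 0" using supp by (auto simp: a_def)
    show "(\<integral>x. a x \<partial>gauss) = 0" using int0 by (simp add: a_def)
  qed
  then have "atomic_bound (\<lambda>x. of_real s * a x) (norm (of_real s :: complex))"
    by (rule atomic_bound_atom)
  moreover have "(\<lambda>x. of_real s * a x) = h"
    using pos(1) by (simp add: a_def)
  moreover have "norm (of_real s :: complex) = s"
    using pos(1) by (simp add: norm_of_real)
  ultimately show ?thesis
    unfolding s_def by simp
qed

text \<open>
  Almost everywhere convergence becomes convergence in \<open>L\<^sup>1\<close> by dominated convergence: the partial sums are dominated by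
  the sum of the absolute values, which is integrable.
\<close>

lemma atomic_bound_imp_decomposition:
  assumes "atomic_bound f K"
  obtains c a where "atomic_decomposition f c a" "(\<Sum>j. norm (c j)) \<le> K"
proof -
  obtain c a where *: "\<And>j. gaussian_atom (a j)" "summable (\<lambda>j. norm (c j))"
    "(\<Sum>j. norm (c j)) \<le> K" and sums: "AE x in gauss. (\<lambda>j. c j * a j x) sums f x"
    by (rule atomic_boundE[OF assms(1)]) blast
  note [measurable] = atomic_bound_measurable[OF assms] gaussian_atom_measurable[OF *(1)]
  let ?W = "\<lambda>x. \<Sum>j. norm (c j * a j x)"
  have int: "integrable gauss (\<lambda>x. c j * a j x)" for j
    using gaussian_atom_integrable[OF *(1)] by simp
  have W: "integrable gauss ?W"
    by (rule integrable_suminf)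
      (use atomic_series_AE_summable[of a c, OF *(1,2)] atomic_series_integral_summable[of a c, OF *(1,2)] int in auto)
  have conv: "(\<lambda>N. \<integral>x. norm (f x - (\<Sum>j<N. c j * a j x)) \<partial>gauss) \<longlonglongrightarrow> (\<integral>x. 0 \<partial>(gauss :: (real^'a) measure))"
  proof (rule integral_dominated_convergence)
    show "AE x in gauss. (\<lambda>N. norm (f x - (\<Sum>j<N. c j * a j x))) \<longlonglongrightarrow> 0"
      using sums
    proof eventually_elim
      case (elim x)
      have "(\<lambda>N. f x - (\<Sum>j<N. c j * a j x)) \<longlonglongrightarrow> f x - f x"
        using elim unfolding sums_def by (intro tendsto_diff) auto
      then show ?case by (simp add: tendsto_norm_zero)
    qed
    show "AE x in gauss. norm (norm (f x - (\<Sum>j<N. c j * a j x))) \<le> ?W x" for N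
      using sums atomic_series_AE_summable[of a c, OF *(1,2)]
    proof eventually_elim
      case (elim x)
      have "f x - (\<Sum>j<N. c j * a j x) = (\<Sum>j. c (j + N) * a (j + N) x)"
        using elim(1) suminf_minus_initial_segment[of "\<lambda>j. c j * a j x" N] by (simp add: sums_iff)
      also have "norm \<dots> \<le> (\<Sum>j. norm (c (j + N) * a (j + N) x))"
        by (rule summable_norm) (use elim(2) summable_iff_shift[of "\<lambda>j. norm (c j * a j x)" N] in \<open>simp\<close>)
      also have "\<dots> = ?W x - (\<Sum>j<N. norm (c j * a j x))"
        using elim(2) by (rule suminf_minus_initial_segment)
      also have "\<dots> \<le> ?W x" by (simp add: sum_nonneg)
      finally show ?case by simp
    qed
  qed (use W in \<open>auto cong: measurable_cong_sets\<close>)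
  have "atomic_decomposition f c a"
    using *(1,2) conv by (auto simp: atomic_decomposition_def Lp_norm_def powr_one')
  with *(3) show ?thesis using that by blast
qed

lemma atomic_bound_imp_H1:
  assumes "atomic_bound f K"
  shows "f \<in> H1" "H1_norm f \<le> K"
proof -
  obtain c a where ca: "atomic_decomposition f c a" "(\<Sum>j. norm (c j)) \<le> K"
    using atomic_bound_imp_decomposition[OF assms] .
  show "f \<in> H1"
    using ca(1) atomic_bound_integrable[OF assms] atomic_bound_measurable[OF assms]
    by (auto simp: H1_def Lp_def powr_one' cong: measurable_cong_sets)
  have "H1_norm f \<le> (\<Sum>j. norm (c j))"
    unfolding H1_norm_def
  proof (rule cInf_lower)
    show "bdd_below {(\<Sum>j. norm (c j)) | c a. atomic_decomposition f c a}"
      by (auto simp: bdd_below_def atomic_decomposition_def intro!: exI[of _ 0] suminf_nonneg)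
  qed (use ca(1) in blast)
  with ca(2) show "H1_norm f \<le> K" by simp
qed

section \<open>The Gauss measure on admissible balls\<close>

lemma inv_radius_comparable:
  assumes "norm (y - x) \<le> 1 / inv_radius x"
  shows "inv_radius y \<le> 2 * inv_radius x"
proof -
  have "inv_radius y \<le> inv_radius x + norm (y - x)" by (rule inv_radius_lipschitz)
  also have "norm (y - x) \<le> 1" using assms inv_radius_ge1[of x] by (simp add: order_trans[OF assms])
  also have "1 \<le> inv_radius x" by simp
  finally show ?thesis by simp
qed

text \<open>
  If \<open>|y - x| \<le> 1 / max 1 |x|\<close>, then \<open>|y|\<^sup>2\<close> and \<open>|x|\<^sup>2\<close> differ by at most \<open>|y - x| (2 |x| + |y - x|) \<le> 3\<close>.
\<close>

lemma gauss_weight_comparable: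
  assumes "y \<in> cball x (1 / inv_radius x)"
  shows "exp (- 3) * gauss_weight x \<le> gauss_weight y" "gauss_weight y \<le> exp 3 * gauss_weight x"
proof -
  have d: "norm (y - x) \<le> 1 / inv_radius x" using assms by (simp add: dist_norm norm_minus_commute)
  have "\<bar>(norm y)\<^sup>2 - (norm x)\<^sup>2\<bar> = \<bar>norm y - norm x\<bar> * (norm y + norm x)"
    by (simp add: power2_eq_square square_diff_square_factored abs_mult mult.commute)
  also have "\<dots> \<le> norm (y - x) * (2 * norm x + norm (y - x))"
    using norm_triangle_ineq3[of y x] norm_triangle_sub[of y x]
    by (intro mult_mono) auto
  also have "\<dots> \<le> 1 / inv_radius x * (2 * inv_radius x + 1)"
    using d norm_le_inv_radius[of x] order_trans[OF d, of 1] by (intro mult_mono) auto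
  also have "\<dots> = 2 + 1 / inv_radius x" 
    using inv_radius_pos[of x] by (simp add: distrib_left del: inv_radius_pos)
  also have "\<dots> \<le> 3" by simp
  finally have "\<bar>(norm y)\<^sup>2 - (norm x)\<^sup>2\<bar> \<le> 3" .
  then have 1: "- 3 + - (norm x)\<^sup>2 \<le> - (norm y)\<^sup>2" "- (norm y)\<^sup>2 \<le> 3 + - (norm x)\<^sup>2" by linarith+
  have "exp (- 3) * exp (- (norm x)\<^sup>2) \<le> exp (- (norm y)\<^sup>2)"
    "exp (- (norm y)\<^sup>2) \<le> exp 3 * exp (- (norm x)\<^sup>2)"
    unfolding exp_add[symmetric] using 1 by simp_all
  then show "exp (- 3) * gauss_weight x \<le> gauss_weight y" "gauss_weight y \<le> exp 3 * gauss_weight x"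
    unfolding gauss_weight_def by (auto simp: mult.left_commute intro!: mult_left_mono)
qed

lemma measure_gauss:
  assumes "S \<in> sets borel" "bounded S"
  shows "measure gauss S = (LINT x:S|lborel. gauss_weight x)" "set_integrable lborel S gauss_weight"
proof -
  have *: "integrable lborel (\<lambda>x. gauss_weight x *\<^sub>R indicat_real S x)"
    using assms by (subst integrable_gauss_iff[symmetric])
      (auto intro!: integrable_real_indicator simp: gauss.emeasure_eq_measure)
  then show "set_integrable lborel S gauss_weight"
    by (simp add: set_integrable_def mult.commute)
  have "measure gauss S = (\<integral>x. indicat_real S x \<partial>gauss)"
    using assms by simp
  also have "\<dots> = (\<integral>x. gauss_weight x *\<^sub>R indicat_real S x \<partial>lborel)"
    unfolding gauss_eq using assms by (intro integral_density) (auto simp: less_imp_le)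
  finally show "measure gauss S = (LINT x:S|lborel. gauss_weight x)"
    by (simp add: set_lebesgue_integral_def mult.commute)
qed

lemma gauss_measure_bounds:
  assumes S: "S \<in> sets borel" "S \<subseteq> cball x (1 / inv_radius x)"
  shows "measure gauss S \<le> exp 3 * gauss_weight x * measure lborel S"
    and "exp (- 3) * gauss_weight x * measure lborel S \<le> measure gauss S"
proof -
  have bS: "bounded S" using S bounded_cball bounded_subset by blast
  have fin: "emeasure lborel S < \<infinity>" 
    using bS emeasure_bounded_finite by auto
  have int: "set_integrable lborel S (\<lambda>y. c)" for c :: real
    using S fin by (auto simp: set_integrable_def intro!: integrable_mult_left integrable_real_indicator)
  note w = measure_gauss[OF S(1) bS]
  have "measure gauss S \<le> (LINT y:S|lborel. exp 3 * gauss_weight x)"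
    unfolding w(1) using gauss_weight_comparable(2)[OF subsetD[OF S(2)]]
    by (intro set_integral_mono w(2) int)
  then show "measure gauss S \<le> exp 3 * gauss_weight x * measure lborel S"
    using S fin by (simp add: set_integral_const mult_ac)
  have "(LINT y:S|lborel. exp (- 3) * gauss_weight x) \<le> measure gauss S"
    unfolding w(1) using gauss_weight_comparable(1)[OF subsetD[OF S(2)]]
    by (intro set_integral_mono w(2) int)
  then show "exp (- 3) * gauss_weight x * measure lborel S \<le> measure gauss S"
    using S fin by (simp add: set_integral_const mult_ac)
qed

text \<open>
  Every comparison of Gaussian volumes below reduces to one of Lebesgue volumes, at the price of \<open>exp 6\<close>.
\<close>

lemma gauss_measure_ratio:
  assumes S: "S \<in> sets borel" "S \<subseteq> cball x (1 / inv_radius x)"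
    and T: "T \<in> sets borel" "T \<subseteq> cball x (1 / inv_radius x)"
    and le: "measure lborel S \<le> \<kappa> * measure lborel T" and \<kappa>: "0 \<le> \<kappa>"
  shows "measure gauss S \<le> exp 6 * \<kappa> * measure gauss T"
proof -
  let ?w = "gauss_weight x"
  have "measure gauss S \<le> exp 3 * ?w * measure lborel S"
    by (rule gauss_measure_bounds(1)[OF S])
  also have "\<dots> \<le> exp 3 * ?w * (\<kappa> * measure lborel T)"
    using le by (intro mult_left_mono) (auto simp: less_imp_le)
  also have "\<dots> = exp 6 * \<kappa> * (exp (- 3) * ?w * measure lborel T)"
    by (simp add: mult_exp_exp algebra_simps)
  also have "\<dots> \<le> exp 6 * \<kappa> * measure gauss T"
    using \<kappa> gauss_measure_bounds(2)[OF T] by (intro mult_left_mono) auto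
  finally show ?thesis .
qed

section \<open>Dyadic cells\<close>

definition cell_index :: "nat \<Rightarrow> real ^ 'n \<Rightarrow> 'n \<Rightarrow> int" where
  "cell_index k x = (\<lambda>i. \<lfloor>2 ^ k * x $ i\<rfloor>)"

text \<open>
  The half-open dyadic cube of side \<open>2\<^sup>-\<^sup>k\<close> that contains \<open>x\<close>. Describing it through a point and not through its corner makes
  cells the classes of an equivalence relation, which becomes finer as \<open>k\<close> grows.
\<close>

definition cell :: "nat \<Rightarrow> real ^ 'n \<Rightarrow> (real ^ 'n) set" where
  "cell k x = {y. cell_index k y = cell_index k x}"

lemma in_cell_self [simp]: "x \<in> cell k x"
  by (simp add: cell_def)

lemma cell_eqI: "y \<in> cell k x \<Longrightarrow> cell k y = cell k x"
  by (auto simp: cell_def)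

lemma cell_index_coarsen:
  assumes "k \<le> l"
  shows "cell_index k x i = cell_index l x i div 2 ^ (l - k)"
proof -
  have "(2::real) ^ k = 2 ^ l / 2 ^ (l - k)"
    using assms by (simp add: power_diff)
  then have "2 ^ k * x $ i = 2 ^ l * x $ i / real_of_int (2 ^ (l - k))"
    by simp
  then show ?thesis
    unfolding cell_index_def by (simp only: floor_divide_real_eq_div[of "2 ^ (l - k)"] zero_le_power zero_le_numeral)
qed

lemma cell_mono: "k \<le> l \<Longrightarrow> cell l x \<subseteq> cell k x"
  by (auto simp: cell_def fun_eq_iff cell_index_coarsen)

lemma cell_measurable [measurable]: "cell k x \<in> sets borel"
proof -
  have "cell k x = (\<Inter>i. {y. \<lfloor>2 ^ k * y $ i\<rfloor> = cell_index k x i})"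
    by (auto simp: cell_def cell_index_def fun_eq_iff)
  also have "\<dots> \<in> sets borel" by measurable
  finally show ?thesis .
qed

lemma countable_cells: "countable (range (cell k))"
proof -
  have "range (cell k) \<subseteq> (\<lambda>z. {y. cell_index k y = z}) ` UNIV"
    by (auto simp: cell_def)
  then show ?thesis
    by (rule countable_subset) auto
qed

text \<open>
  A coordinate index at level \<open>k\<close> is the half of one at level \<open>Suc k\<close>, rounded down, so each coordinate has two
  refinements.
\<close>

lemma finite_children: "finite (cell (Suc k) ` cell k x)"
proof -
  have "cell (Suc k) ` cell k x \<subseteq>
     (\<lambda>z. {y. cell_index (Suc k) y = z}) ` (Pi\<^sub>E UNIV (\<lambda>i. {2 * cell_index k x i, 2 * cell_index k x i + 1}))"
  proof
    fix C assume "C \<in> cell (Suc k) ` cell k x"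
    then obtain y where y: "y \<in> cell k x" "C = cell (Suc k) y" by auto
    have "cell_index k x i = cell_index (Suc k) y i div 2" for i
      using y(1) cell_index_coarsen[of k "Suc k" y i] by (simp add: cell_def)
    then have "cell_index (Suc k) y i = 2 * cell_index k x i \<or> cell_index (Suc k) y i = 2 * cell_index k x i + 1" for i
      by presburger
    then have "cell_index (Suc k) y \<in> (Pi\<^sub>E UNIV (\<lambda>i. {2 * cell_index k x i, 2 * cell_index k x i + 1}))"
      by auto
    then show "C \<in> (\<lambda>z. {y. cell_index (Suc k) y = z}) ` (Pi\<^sub>E UNIV (\<lambda>i. {2 * cell_index k x i, 2 * cell_index k x i + 1}))"
      unfolding y(2) cell_def by blast
  qed
  then show ?thesis
    by (rule finite_subset) (intro finite_imageI finite_PiE, auto)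
qed

lemma cell_component_dist:
  assumes "y \<in> cell k x"
  shows "\<bar>y $ i - x $ i\<bar> \<le> 1 / 2 ^ k"
proof -
  have "\<lfloor>2 ^ k * y $ i\<rfloor> = \<lfloor>2 ^ k * x $ i\<rfloor>"
    using assms by (auto simp: cell_def cell_index_def fun_eq_iff)
  then have "\<bar>2 ^ k * y $ i - 2 ^ k * x $ i\<bar> \<le> 1" by linarith
  then have "2 ^ k * \<bar>y $ i - x $ i\<bar> \<le> 1"
    by (simp add: abs_mult flip: right_diff_distrib)
  then show ?thesis by (simp add: field_simps)
qed

lemma cell_dist:
  fixes x :: "real ^ 'n"
  assumes "y \<in> cell k x"
  shows "norm (y - x) \<le> real CARD('n) / 2 ^ k"
proof -
  have "norm (y - x) \<le> (\<Sum>i\<in>UNIV. \<bar>(y - x) $ i\<bar>)" by (rule norm_le_l1_cart)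
  also have "\<dots> \<le> (\<Sum>i\<in>(UNIV::'n set). 1 / 2 ^ k)"
    using cell_component_dist[OF assms] by (intro sum_mono) simp
  finally show ?thesis by simp
qed

lemma cell_volume:
  fixes x :: "real ^ 'n"
  shows "measure lborel (cell k x) = 1 / 2 ^ (k * CARD('n))"
proof -
  define a b :: "real ^ 'n" where "a = (\<chi> i. cell_index k x i / 2 ^ k)" and "b = (\<chi> i. (cell_index k x i + 1) / 2 ^ k)"
  \<comment> \<open>The cell lies between the open and the closed box with the same corners, which have the same volume.\<close>
  have sub1: "box a b \<subseteq> cell k x"
  proof
    fix y assume "y \<in> box a b"
    then have "cell_index k x i / 2 ^ k < y $ i" "y $ i < (cell_index k x i + 1) / 2 ^ k" for i
      by (auto simp: mem_box_cart a_def b_def)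
    then have "cell_index k x i \<le> 2 ^ k * y $ i \<and> 2 ^ k * y $ i < real_of_int (cell_index k x i) + 1" for i
      by (auto simp: field_simps less_imp_le)
    then have "\<lfloor>2 ^ k * y $ i\<rfloor> = cell_index k x i" for i
      by (simp add: floor_eq_iff)
    then show "y \<in> cell k x" by (simp add: cell_def cell_index_def fun_eq_iff)
  qed
  have sub2: "cell k x \<subseteq> cbox a b"
  proof
    fix y assume "y \<in> cell k x"
    then have "\<lfloor>2 ^ k * y $ i\<rfloor> = cell_index k x i" for i
      by (simp add: cell_def cell_index_def fun_eq_iff)
    then have "cell_index k x i \<le> 2 ^ k * y $ i \<and> 2 ^ k * y $ i \<le> real_of_int (cell_index k x i) + 1" for i
      by (simp add: floor_eq_iff less_imp_le)
    then have "cell_index k x i / 2 ^ k \<le> y $ i \<and> y $ i \<le> (cell_index k x i + 1) / 2 ^ k" for i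
      by (auto simp: field_simps)
    then show "y \<in> cbox a b" by (auto simp: mem_box_cart a_def b_def)
  qed
  note sub = sub1 sub2
  have "measure lborel (cbox a b) = (\<Prod>i\<in>(UNIV::'n set). b $ i - a $ i)"
    by (rule content_cbox_cart) (auto simp: a_def b_def interval_eq_empty_cart divide_right_mono not_less)
  also have "\<dots> = 1 / 2 ^ (k * CARD('n))"
    by (simp add: a_def b_def power_mult power_one_over flip: diff_divide_distrib)
  finally have c: "measure lborel (cbox a b) = 1 / 2 ^ (k * CARD('n))" .
  have ab: "a \<bullet> i \<le> b \<bullet> i" if "i \<in> Basis" for i
    using that by (auto simp: a_def b_def Basis_vec_def inner_axis divide_right_mono)
  have fin: "emeasure lborel (cbox a b) < \<infinity>" "emeasure lborel (cell k x) < \<infinity>"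
    using sub emeasure_bounded_finite[OF bounded_cbox] emeasure_bounded_finite[OF bounded_subset[OF bounded_cbox]] by auto
  have "measure lborel (box a b) \<le> measure lborel (cell k x)"
    using fin sub by (intro measure_mono_fmeasurable) (auto simp: fmeasurable_def)
  moreover have "measure lborel (cell k x) \<le> measure lborel (cbox a b)"
    using fin sub by (intro measure_mono_fmeasurable) (auto simp: fmeasurable_def)
  moreover have "measure lborel (box a b) = measure lborel (cbox a b)"
    using ab by (simp add: measure_def emeasure_lborel_box emeasure_lborel_cbox)
  ultimately show ?thesis using c by (simp add: measure_completion)
qed


text \<open>
  The cell is small on the admissible scale of each of its points: its diameter is at most \<open>CARD('n) / 2\<^sup>k\<close>, hence at most an eighth
  of the admissible radius there. Quantifying over all points of the cell makes the condition a property of the cell.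
\<close>

section \<open>Root cells: a partition at the admissible scale\<close>

definition root_fit :: "nat \<Rightarrow> real ^ 'n \<Rightarrow> bool" where
  "root_fit k x \<longleftrightarrow> (\<forall>y\<in>cell k x. 8 * real CARD('n) * inv_radius y \<le> 2 ^ k)"

definition root_level :: "real ^ 'n \<Rightarrow> nat" where
  "root_level x = (LEAST k. root_fit k x)"

definition root_cell :: "real ^ 'n \<Rightarrow> (real ^ 'n) set" where
  "root_cell x = cell (root_level x) x"

lemma ex_root_fit: "\<exists>k. root_fit k x"
proof -
  let ?n = "real CARD('a)"
  obtain k where k: "8 * ?n * (inv_radius x + ?n) < 2 ^ k"
    using real_arch_pow[of 2] by auto
  have "8 * ?n * inv_radius y \<le> 2 ^ k" if "y \<in> cell k x" for y
  proof -
    have "inv_radius y \<le> inv_radius x + norm (y - x)" by (rule inv_radius_lipschitz)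
    also have "norm (y - x) \<le> ?n / 2 ^ k" by (rule cell_dist[OF that])
    also have "?n / 2 ^ k \<le> ?n" by (simp add: field_simps)
    finally have "8 * ?n * inv_radius y \<le> 8 * ?n * (inv_radius x + ?n)" by (intro mult_left_mono) auto
    with k show ?thesis by linarith
  qed
  then show ?thesis by (auto simp: root_fit_def)
qed

lemma root_fit_root_level: "root_fit (root_level x) x"
  unfolding root_level_def using ex_root_fit by (rule LeastI_ex)

lemma root_fit_cong: "y \<in> cell k x \<Longrightarrow> root_fit k y \<longleftrightarrow> root_fit k x"
  by (simp add: root_fit_def cell_eqI)

text \<open>
  Up to level \<open>k\<close> the points \<open>x\<close> and \<open>y\<close> share their cells, so the minimality that defines the level of \<open>x\<close> applies
  to \<open>y\<close> as well. In particular two root cells are equal or disjoint.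
\<close>

lemma root_level_eq:
  assumes "y \<in> cell k x" "root_level x \<le> k"
  shows "root_level y = root_level x"
  unfolding root_level_def[of y]
proof (rule Least_equality)
  have y: "y \<in> cell j x" if "j \<le> k" for j
    using assms(1) cell_mono[OF that] by blast
  show "root_fit (root_level x) y"
    using root_fit_root_level root_fit_cong[OF y[OF assms(2)]] by blast
  fix j assume j: "root_fit j y"
  show "root_level x \<le> j"
  proof (rule ccontr)
    assume "\<not> ?thesis"
    then have "root_fit j x" "j < root_level x"
      using j root_fit_cong[OF y, of j] assms(2) by auto
    then show False unfolding root_level_def using not_less_Least by blast
  qed
qed

lemma root_cell_eqI: "y \<in> root_cell x \<Longrightarrow> root_cell y = root_cell x"
  unfolding root_cell_def by (metis cell_eqI order_refl root_level_eq)

lemma in_root_cell_self [simp]: "x \<in> root_cell x"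
  by (simp add: root_cell_def)

lemma root_cell_measurable [measurable]: "root_cell x \<in> sets borel"
  by (simp add: root_cell_def)

lemma countable_root_cells: "countable (range root_cell)"
proof -
  have "range root_cell \<subseteq> (\<Union>k. range (cell k))"
    by (auto simp: root_cell_def)
  then show ?thesis
    by (rule countable_subset) (auto intro: countable_cells)
qed

lemma root_level_lower:
  fixes x :: "real ^ 'n"
  shows "8 * real CARD('n) * inv_radius x \<le> 2 ^ root_level x"
  using root_fit_root_level[of x] in_cell_self unfolding root_fit_def by blast

text \<open>
  Together with \<open>root_level_lower\<close> this pins the side of the root cell to the admissible radius up to constants.
  The cell one level up has a point \<open>y\<close> with \<open>2\<^sup>k < 8 n max(1, |y|)\<close>; it is so close to \<open>x\<close> that
  \<open>max(1, |y|)\<close> exceeds \<open>max(1, |x|)\<close> by at most a quarter.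
\<close>

lemma root_level_upper:
  fixes x :: "real ^ 'n"
  shows "2 ^ root_level x \<le> 20 * real CARD('n) * inv_radius x"
proof -
  let ?n = "real CARD('n)"
  have n: "?n \<ge> 1" by (simp add: Suc_leI)
  have nm: "?n \<le> ?n * inv_radius x" using mult_left_mono[of 1 "inv_radius x" ?n] by simp
  have "8 \<le> (2::real) ^ root_level x"
    using root_level_lower[of x] nm n unfolding mult.assoc by linarith
  then have "root_level x \<noteq> 0" by (intro notI) simp
  then obtain k where k: "root_level x = Suc k" by (cases "root_level x") auto
  have "\<not> root_fit k x"
    using not_less_Least[of k "\<lambda>k. root_fit k x"] k by (simp add: root_level_def)
  then obtain y where y: "y \<in> cell k x" "2 ^ k < 8 * ?n * inv_radius y"
    by (auto simp: root_fit_def)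
  have "inv_radius y \<le> inv_radius x + norm (y - x)" by (rule inv_radius_lipschitz)
  also have "norm (y - x) \<le> ?n / 2 ^ k" by (rule cell_dist[OF y(1)])
  also have "4 * ?n \<le> 2 ^ k"
    using root_level_lower[of x] nm unfolding k mult.assoc power_Suc by linarith
  then have "?n / 2 ^ k \<le> 1 / 4"
    by (simp add: field_simps)
  also have "1 / 4 \<le> inv_radius x / 4" by simp
  finally have "8 * ?n * inv_radius y \<le> 8 * ?n * (inv_radius x + inv_radius x / 4)" by (intro mult_left_mono) auto
  with y(2) have "2 ^ k < 8 * ?n * (inv_radius x + inv_radius x / 4)" by linarith
  also have "\<dots> = 10 * ?n * inv_radius x" by simp
  finally show ?thesis unfolding k by (simp add: mult_ac)
qed

lemma cell_subset_cball:
  fixes x :: "real ^ 'n"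
  shows "cell k x \<subseteq> cball x (real CARD('n) / 2 ^ k)"
  using cell_dist[of _ k x] by (auto simp: dist_norm norm_minus_commute)

lemma cell_radius_le:
  fixes x :: "real ^ 'n"
  assumes "root_level x \<le> k"
  shows "real CARD('n) / 2 ^ k \<le> 1 / (8 * inv_radius x)"
proof -
  have "8 * real CARD('n) * inv_radius x \<le> 2 ^ root_level x" by (rule root_level_lower)
  also have "\<dots> \<le> 2 ^ k" using assms by (simp add: power_increasing)
  finally show ?thesis by (simp add: field_simps)
qed

lemma cball_admissible: "0 < r \<Longrightarrow> r \<le> 1 / inv_radius x \<Longrightarrow> cball x r \<in> admissible_balls"
  by (auto simp: admissible_balls_def admissible_radius_eq)

lemma eighth_le: "1 / (8 * inv_radius x) \<le> 1 / inv_radius x"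
  by (simp add: field_simps)

lemma unit_vol_pos: "0 < unit_ball_vol (real CARD('n :: finite))"
  by (simp add: unit_ball_vol_def)

lemma cball_volume:
  fixes x :: "real ^ 'n"
  assumes "0 \<le> r"
  shows "measure lborel (cball x r) = unit_ball_vol (real CARD('n)) * r ^ CARD('n)"
  using assms by (simp add: content_cball)

text \<open>
  The balls that carry the transported mass. Their radius is an eighth of the admissible one, which leaves
  room for both the core ball at \<open>x\<close> and the core balls at nearby points inside one admissible ball.
\<close>

definition core_ball :: "real ^ 'n \<Rightarrow> (real ^ 'n) set" where
  "core_ball x = cball x (1 / (8 * inv_radius x))"

lemma core_ball_measurable [measurable]: "core_ball x \<in> sets borel"
  by (simp add: core_ball_def)

lemma core_ball_near:
  fixes x :: "real ^ 'n"
  assumes "norm (y - x) \<le> 1 / (4 * inv_radius x)"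
  shows "core_ball y \<subseteq> cball x (1 / inv_radius x)"
    and "measure gauss (cball x (1 / inv_radius x)) \<le> exp 6 * 16 ^ CARD('n) * measure gauss (core_ball y)"
proof -
  have q: "1 / (4 * inv_radius x) \<le> 1 / inv_radius x" "1 / (4 * inv_radius x) \<le> 1"
    using inv_radius_ge1[of x] by (auto simp: field_simps simp del: inv_radius_ge1)
  have yx: "inv_radius y \<le> 2 * inv_radius x" using assms q by (intro inv_radius_comparable) auto
  have "inv_radius x \<le> inv_radius y + norm (x - y)" by (rule inv_radius_lipschitz)
  also have "norm (x - y) \<le> 1" using order_trans[OF assms q(2)] by (simp add: norm_minus_commute)
  also have "1 \<le> inv_radius y" by simp
  finally have xy: "inv_radius x \<le> 2 * inv_radius y" by simp
  show sub: "core_ball y \<subseteq> cball x (1 / inv_radius x)"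
  proof
    fix z assume "z \<in> core_ball y"
    then have "dist x z \<le> dist y x + 1 / (8 * inv_radius y)"
      using dist_triangle3[of x z y] by (simp add: core_ball_def)
    also have "\<dots> \<le> 1 / (4 * inv_radius x) + 2 / (8 * inv_radius x)"
      using assms xy by (intro add_mono) (auto simp: dist_norm field_simps)
    also have "\<dots> \<le> 1 / inv_radius x" by (simp add: field_simps)
    finally show "z \<in> cball x (1 / inv_radius x)" by simp
  qed
  show "measure gauss (cball x (1 / inv_radius x)) \<le> exp 6 * 16 ^ CARD('n) * measure gauss (core_ball y)"
  proof (rule gauss_measure_ratio[OF _ _ _ sub])
    have "(1 / inv_radius x) ^ CARD('n) \<le> (16 * (1 / (8 * inv_radius y))) ^ CARD('n)"
      using yx by (intro power_mono) (auto simp: field_simps)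
    then have "unit_ball_vol (real CARD('n)) * (1 / inv_radius x) ^ CARD('n) \<le> unit_ball_vol (real CARD('n)) * (16 ^ CARD('n) * (1 / (8 * inv_radius y)) ^ CARD('n))"
      unfolding power_mult_distrib using unit_vol_pos[where 'n = 'n] by (intro mult_left_mono) auto
    then show "measure lborel (cball x (1 / inv_radius x)) \<le> 16 ^ CARD('n) * measure lborel (core_ball y)"
      by (simp add: cball_volume core_ball_def mult_ac)
  qed auto
qed

lemma cell_subset_unit_ball:
  assumes "root_level x \<le> k"
  shows "cell k x \<subseteq> cball x (1 / inv_radius x)"
  using cell_subset_cball[of k x] cell_radius_le[OF assms] eighth_le[of x]
  by (auto intro: order_trans)

lemma cell_gauss_pos:
  assumes "root_level x \<le> k"
  shows "0 < measure gauss (cell k x)"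
  by (rule less_le_trans[OF _ gauss_measure_bounds(2)[OF cell_measurable cell_subset_unit_ball[OF assms]]])
     (simp add: cell_volume)

lemma core_ball_gauss_pos: "0 < measure gauss (core_ball x)"
proof (rule less_le_trans[OF _ gauss_measure_bounds(2)])
  show "core_ball x \<subseteq> cball x (1 / inv_radius x)" by (rule core_ball_near) simp
  show "0 < exp (- 3) * gauss_weight x * measure lborel (core_ball x)"
    using unit_vol_pos[where 'n = 'a] by (simp add: core_ball_def cball_volume)
qed simp

lemma cell_doubling:
  fixes x :: "real ^ 'n"
  assumes "root_level x \<le> k" "y \<in> cell k x"
  shows "measure gauss (cell k x) \<le> exp 6 * 2 ^ CARD('n) * measure gauss (cell (Suc k) y)"
proof (rule gauss_measure_ratio[OF _ cell_subset_unit_ball[OF assms(1)]])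
  have "cell (Suc k) y \<subseteq> cell k y" by (rule cell_mono) simp
  also have "\<dots> = cell k x" using assms(2) by (rule cell_eqI)
  also have "\<dots> \<subseteq> cball x (1 / inv_radius x)" by (rule cell_subset_unit_ball[OF assms(1)])
  finally show "cell (Suc k) y \<subseteq> cball x (1 / inv_radius x)" .
qed (auto simp: cell_volume power_add)

text \<open>
  An atom is normalised by the mass of a ball, whereas the stopping-time argument counts masses of cells.
\<close>

lemma cell_ball_ratio:
  fixes x :: "real ^ 'n"
  assumes "root_level x \<le> k"
  shows "measure gauss (cball x (real CARD('n) / 2 ^ k)) \<le>
     exp 6 * (unit_ball_vol (real CARD('n)) * real CARD('n) ^ CARD('n)) * measure gauss (cell k x)"
proof (rule gauss_measure_ratio[OF _ _ _ cell_subset_unit_ball[OF assms(1)]])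
  show "cball x (real CARD('n) / 2 ^ k) \<subseteq> cball x (1 / inv_radius x)"
    using cell_radius_le[OF assms] eighth_le[of x] by (auto intro: order_trans)
qed (auto simp: cell_volume cball_volume power_divide power_mult unit_vol_pos less_imp_le)

lemma root_ball_ratio:
  fixes x :: "real ^ 'n"
  shows "measure gauss (cball x (1 / inv_radius x)) \<le>
     exp 6 * (unit_ball_vol (real CARD('n)) * (20 * real CARD('n)) ^ CARD('n)) * measure gauss (root_cell x)"
  unfolding root_cell_def
proof (rule gauss_measure_ratio[OF _ _ _ cell_subset_unit_ball[OF order_refl]])
  let ?N = "CARD('n)"
  define t :: real where "t = 2 ^ (root_level x * ?N)"
  have t: "0 < t" by (simp add: t_def)
  have "t \<le> (20 * real ?N * inv_radius x) ^ ?N"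
    unfolding t_def power_mult using root_level_upper by (intro power_mono) auto
  also have "\<dots> = (20 * real ?N) ^ ?N * inv_radius x ^ ?N" by (rule power_mult_distrib)
  finally have "1 / inv_radius x ^ ?N \<le> (20 * real ?N) ^ ?N / t"
    using t by (simp add: divide_le_eq le_divide_eq mult.commute)
  then have "unit_ball_vol (real CARD('n)) * (1 / inv_radius x ^ ?N) \<le> unit_ball_vol (real CARD('n)) * ((20 * real ?N) ^ ?N / t)"
    using unit_vol_pos[where 'n = 'n] by (intro mult_left_mono) auto
  then show "measure lborel (cball x (1 / inv_radius x)) \<le> unit_ball_vol (real CARD('n)) * (20 * real ?N) ^ ?N * measure lborel (cell (root_level x) x)"
    by (simp add: cell_volume cball_volume power_one_over t_def)
  show "0 \<le> unit_ball_vol (real CARD('n)) * (20 * real CARD('n)) ^ CARD('n)"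
    using unit_vol_pos[where 'n = 'n] by simp
qed auto

section \<open>Calderon-Zygmund decomposition inside a root cell\<close>

text \<open>
  Chebyshev's inequality in pointwise form. Integrated over a cell it replaces Hoelder's inequality.
\<close>

lemma le_add_powr:
  fixes t l p :: real
  assumes "0 \<le> t" "0 < l" "1 < p"
  shows "t \<le> l + l powr (1 - p) * t powr p"
proof (cases "t \<le> l")
  case False
  have "t * 1 \<le> t * (t / l) powr (p - 1)"
    using False assms by (intro mult_left_mono ge_one_powr_ge_zero) auto
  also have "\<dots> = l powr (1 - p) * t powr p"
    using False assms by (simp add: powr_divide powr_diff field_simps)
  finally show ?thesis using assms by simp
qed (use assms in \<open>auto simp: add_increasing2\<close>)

text \<open>
  Young's inequality without the optimal constants.
\<close>

lemma mult_le_powr_add: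
  fixes s t p :: real
  assumes "0 \<le> s" "0 \<le> t" "1 < p"
  shows "t * s \<le> t powr p + s powr (p / (p - 1))"
proof (cases "s \<le> t powr (p - 1)")
  case True
  then have "t * s \<le> t * t powr (p - 1)" using assms by (intro mult_left_mono)
  also have "\<dots> = t powr p" using assms by (cases "t = 0") (auto simp: powr_diff)
  finally show ?thesis by (simp add: add_increasing2)
next
  case False
  then have "(t powr (p - 1)) powr (1 / (p - 1)) \<le> s powr (1 / (p - 1))"
    using assms by (intro powr_mono2) auto
  then have "t \<le> s powr (1 / (p - 1))" using assms by (simp add: powr_powr)
  then have "t * s \<le> s powr (1 / (p - 1)) * s powr 1"
    using assms by (simp add: mult_right_mono)
  also have "\<dots> = s powr (p / (p - 1))"
    using assms by (subst powr_add[symmetric]) (simp add: field_simps)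
  finally show ?thesis by (simp add: add_increasing)
qed

lemma integrable_of_powr:
  fixes f :: "real ^ 'n \<Rightarrow> complex"
  assumes [measurable]: "f \<in> borel_measurable borel" and p: "1 < p"
    and int: "integrable gauss (\<lambda>x. norm (f x) powr p)"
  shows "integrable gauss f"
proof (rule Bochner_Integration.integrable_bound)
  show "integrable gauss (\<lambda>x::real^'n. 1 + 1 powr (1 - p) * norm (f x) powr p)"
    using int by simp
  show "AE x in gauss. norm (f x) \<le> norm (1 + 1 powr (1 - p) * norm (f x) powr p)"
    using le_add_powr[OF norm_ge_zero zero_less_one p, of "f _"] by (intro AE_I2) simp
qed (simp cong: measurable_cong_sets)

lemma set_integrable_gauss:
  fixes f :: "real ^ 'n \<Rightarrow> 'b :: {banach, second_countable_topology}"
  assumes "integrable gauss f" "A \<in> sets borel"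
  shows "set_integrable gauss A f"
  using assms unfolding set_integrable_def by (intro integrable_mult_indicator) simp_all

lemma norm_set_integral_le:
  fixes f :: "real ^ 'n \<Rightarrow> complex"
  assumes [measurable]: "f \<in> borel_measurable borel" and p: "1 < p"
    and int: "integrable gauss (\<lambda>x. norm (f x) powr p)"
    and [measurable]: "A \<in> sets borel" and l: "0 < l"
  shows "norm (LINT x:A|gauss. f x) \<le> l * measure gauss A + l powr (1 - p) * (LINT x:A|gauss. norm (f x) powr p)"
proof -
  note fi = integrable_of_powr[OF assms(1-3)]
  have "norm (LINT x:A|gauss. f x) \<le> (LINT x:A|gauss. norm (f x))"
    by (rule set_integral_norm_bound) (intro set_integrable_gauss fi, simp)
  also have "\<dots> \<le> (LINT x:A|gauss. l + l powr (1 - p) * norm (f x) powr p)"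
    using fi int le_add_powr[OF norm_ge_zero l p]
    by (intro set_integral_mono set_integrable_gauss) auto
  also have "\<dots> = (LINT x:A|gauss. l) + (LINT x:A|gauss. l powr (1 - p) * norm (f x) powr p)"
    using int by (intro set_integral_add set_integrable_gauss) auto
  also have "\<dots> = l * measure gauss A + l powr (1 - p) * (LINT x:A|gauss. norm (f x) powr p)"
    by (simp add: set_integral_const gauss.emeasure_eq_measure)
  finally show ?thesis .
qed

definition step :: "nat \<Rightarrow> (real ^ 'n \<Rightarrow> complex) \<Rightarrow> bool" where
  "step N f \<longleftrightarrow> (\<forall>x. \<forall>y\<in>cell N x. f y = f x)"

lemma step_measurable:
  assumes "step N f"
  shows "f \<in> borel_measurable borel"
proof (rule measurableI)
  fix S :: "complex set"
  have "f -` S = \<Union> {C \<in> range (cell N). C \<subseteq> f -` S}"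
  proof (intro set_eqI iffI)
    fix x assume "x \<in> f -` S"
    then have "cell N x \<subseteq> f -` S" using assms by (auto simp: step_def)
    then show "x \<in> \<Union> {C \<in> range (cell N). C \<subseteq> f -` S}" using in_cell_self[of x N] by blast
  qed blast
  also have "\<dots> \<in> sets borel"
    by (rule sets.countable_Union) (auto intro: countable_subset[OF _ countable_cells])
  finally show "f -` S \<inter> space borel \<in> sets borel" by simp
qed simp

lemma step_mono: "step M f \<Longrightarrow> M \<le> N \<Longrightarrow> step N f"
  using cell_mono unfolding step_def by blast

definition doubling_const :: "'n::finite itself \<Rightarrow> real" where
  "doubling_const _ = exp 6 * 2 ^ CARD('n)"

definition ball_ratio_const :: "'n::finite itself \<Rightarrow> real" where
  "ball_ratio_const _ = exp 6 * (unit_ball_vol (real CARD('n)) * real CARD('n) ^ CARD('n))"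

lemma doubling_const_gt_1: "1 < doubling_const TYPE('n::finite)"
  unfolding doubling_const_def using mult_strict_mono[of 1 "exp 6" 1 "2 ^ CARD('n) :: real"]
  by (simp add: one_less_power)

lemma ball_ratio_const_nonneg: "0 \<le> ball_ratio_const TYPE('n::finite)"
  unfolding ball_ratio_const_def using unit_vol_pos[where 'n = 'n] by simp

text \<open>
  The solution \<open>K\<close> of \<open>K D\<^sup>1\<^sup>-\<^sup>p + 4 D\<^sup>2 E = K\<close>, where \<open>D\<close> is the doubling constant and \<open>E\<close> the ratio between balls and
  cells. It exists because \<open>D\<^sup>1\<^sup>-\<^sup>p < 1\<close>. The equation says that one passage from height \<open>\<lambda>\<close> to \<open>D \<lambda>\<close> pays for itself.
\<close>

definition cz_const :: "'n::finite itself \<Rightarrow> real \<Rightarrow> real" where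
  "cz_const _ p = 4 * (doubling_const TYPE('n))\<^sup>2 * ball_ratio_const TYPE('n) / (1 - doubling_const TYPE('n) powr (1 - p))"

lemma cz_const:
  assumes "1 < p"
  shows "0 \<le> cz_const TYPE('n::finite) p"
    and "cz_const TYPE('n) p * doubling_const TYPE('n) powr (1 - p) + 4 * (doubling_const TYPE('n))\<^sup>2 * ball_ratio_const TYPE('n)
       = cz_const TYPE('n) p"
proof -
  have "doubling_const TYPE('n) powr (1 - p) < 1"
    using doubling_const_gt_1[where 'n = 'n] assms by (simp add: powr_less_one)
  then show "0 \<le> cz_const TYPE('n::finite) p"
    "cz_const TYPE('n) p * doubling_const TYPE('n) powr (1 - p) + 4 * (doubling_const TYPE('n))\<^sup>2 * ball_ratio_const TYPE('n)
       = cz_const TYPE('n) p"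
    using ball_ratio_const_nonneg[where 'n = 'n] unfolding cz_const_def
    by (auto simp: field_simps)
qed

lemma cell_replace_by_mean:
  fixes g :: "real ^ 'n \<Rightarrow> complex" and m :: complex
  assumes k: "root_level x \<le> k" and g [measurable]: "g \<in> borel_measurable borel"
    and supp: "\<And>y. y \<notin> cell k x \<Longrightarrow> g y = 0" and le: "\<And>y. norm (g y) \<le> M"
    and m: "norm m \<le> L" "m * measure gauss (cell k x) = (\<integral>y. g y \<partial>gauss)"
  shows "atomic_bound (\<lambda>y. g y - indicat_real (cell k x) y *\<^sub>R m)
           ((M + L) * (ball_ratio_const TYPE('n) * measure gauss (cell k x)))"
proof (rule atomic_bound_mono[OF atomic_bound_ball[where B = "cball x (real CARD('n) / 2 ^ k)"]])
  have r: "real CARD('n) / 2 ^ k \<le> 1 / inv_radius x"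
    using cell_radius_le[OF k] eighth_le[of x] by linarith
  show "cball x (real CARD('n) / 2 ^ k) \<in> admissible_balls"
    by (rule cball_admissible[OF _ r]) simp
  show "g y - indicat_real (cell k x) y *\<^sub>R m = 0" if "y \<notin> cball x (real CARD('n) / 2 ^ k)" for y
    using that cell_subset_cball[of k x] supp[of y] by (auto simp: indicator_def)
  have "0 \<le> L" using m(1) norm_ge_zero order_trans by blast
  then show "norm (g y - indicat_real (cell k x) y *\<^sub>R m) \<le> M + L" for y
    using le[of y] m(1) norm_triangle_ineq4[of "g y" m] by (auto simp: indicator_def)
  have "0 \<le> M" using le norm_ge_zero order_trans by blast
  with \<open>0 \<le> L\<close> show "(M + L) * measure gauss (cball x (real CARD('n) / 2 ^ k)) \<le>
        (M + L) * (ball_ratio_const TYPE('n) * measure gauss (cell k x))"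
    using cell_ball_ratio[OF k] by (intro mult_left_mono) (auto simp: ball_ratio_const_def)
  have gi: "integrable gauss g"
    using le by (intro gauss.integrable_const_bound[where B = M]) (auto cong: measurable_cong_sets)
  have "(\<integral>y. indicat_real (cell k x) y *\<^sub>R m \<partial>gauss) = m * measure gauss (cell k x)"
    by (simp add: scaleR_conv_of_real)
  moreover have "integrable gauss (\<lambda>y. indicat_real (cell k x) y *\<^sub>R m)"
    by (intro integrable_scaleR_left integrable_real_indicator) (auto simp: gauss.emeasure_eq_measure)
  ultimately show "(\<integral>y. g y - indicat_real (cell k x) y *\<^sub>R m \<partial>gauss) = 0"
    using gi m(2) by simp
qed simp

text \<open>
  The part \<open>g\<close> of \<open>f\<close> on \<open>Q\<close> that remains at height \<open>l\<close> after the atoms of the Calderon-Zygmund decomposition have been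
  removed.
\<close>

definition good_part :: "real \<Rightarrow> real \<Rightarrow> (real ^ 'n \<Rightarrow> complex) \<Rightarrow> (real ^ 'n) set \<Rightarrow> (real ^ 'n \<Rightarrow> complex) \<Rightarrow> bool"
  where "good_part p l f Q g \<longleftrightarrow>
     g \<in> borel_measurable borel \<and> (\<forall>y. y \<notin> Q \<longrightarrow> g y = 0) \<and>
     (\<forall>y. norm (g y) \<le> 2 * doubling_const TYPE('n) * l) \<and> (\<integral>y. g y \<partial>gauss) = (LINT y:Q|gauss. f y) \<and>
     atomic_bound (\<lambda>y. indicat_real Q y *\<^sub>R f y - g y)
       (cz_const TYPE('n) p * l powr (1 - p) * (LINT y:Q|gauss. norm (f y) powr p))"

text \<open>
  Induction from the fine scale \<open>N\<close> up to the cell. In a child whose mean of \<open>|f|\<^sup>p\<close> is at most \<open>l\<^sup>p\<close>, the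
  same height works. In any other child doubling bounds the mean by \<open>(D l)\<^sup>p\<close>, and
  the induction hypothesis applies with height \<open>D l\<close>; its bounded part is then exchanged for the mean of \<open>f\<close>, which
  brings it back below \<open>2 D l\<close>, at the cost of one atom. That atom costs
  \<open>l \<gamma>(C) < l\<^sup>1\<^sup>-\<^sup>p \<integral>\<^sub>C |f|\<^sup>p\<close> up to constants. This is paid by the gain in the exponent: the
  bound for height \<open>D l\<close> carries the smaller factor \<open>(D l)\<^sup>1\<^sup>-\<^sup>p\<close>.
\<close>

lemma calderon_zygmund:
  fixes f :: "real ^ 'n \<Rightarrow> complex"
  assumes p: "1 < p" and f: "step N f" and fp: "integrable gauss (\<lambda>x. norm (f x) powr p)"
    and "root_level x \<le> k" "0 < l"
    and "(LINT y:cell k x|gauss. norm (f y) powr p) \<le> l powr p * measure gauss (cell k x)"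
  shows "\<exists>g. good_part p l f (cell k x) g"
  using assms(4-6)
proof (induction "N - k" arbitrary: k x l)
  case 0
  let ?Q = "cell k x" and ?D = "doubling_const TYPE('n)"
  define c where "c = f x"
  have const: "f y = c" if "y \<in> ?Q" for y
    using step_mono[OF f, of k] 0(1) that by (simp add: step_def c_def)
  have int_const: "(LINT y:?Q|gauss. norm (f y) powr p) = norm c powr p * measure gauss ?Q"
  proof -
    have "(LINT y:?Q|gauss. norm (f y) powr p) = (LINT y:?Q|gauss. norm c powr p)"
      by (rule set_lebesgue_integral_cong) (use const in auto)
    then show ?thesis by (simp add: set_integral_const gauss.emeasure_eq_measure)
  qed
  have "norm c powr p \<le> l powr p"
    using 0(4) cell_gauss_pos[OF 0(2)] unfolding int_const by simp
  then have fl: "norm c \<le> l"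
    using powr_less_mono2[of p l "norm c"] p 0(3) by (meson less_imp_le not_less order.strict_trans zero_less_one)
  also have "l \<le> 2 * ?D * l" using 0(3) doubling_const_gt_1[where 'n = 'n] by simp
  finally have le: "norm c \<le> 2 * ?D * l" .
  have eq: "indicat_real ?Q y *\<^sub>R f y = indicat_real ?Q y *\<^sub>R c" for y
    using const by (auto simp: indicator_def)
  show ?case
    unfolding good_part_def
  proof (intro exI[of _ "\<lambda>y. indicat_real ?Q y *\<^sub>R c"] conjI allI impI)
    show "norm (indicat_real ?Q y *\<^sub>R c) \<le> 2 * ?D * l" for y
      using le 0(3) doubling_const_gt_1[where 'n = 'n] by (auto simp: indicator_def)
    show "(\<integral>y. indicat_real ?Q y *\<^sub>R c \<partial>gauss) = (LINT y:?Q|gauss. f y)"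
      unfolding set_lebesgue_integral_def eq ..
    have "0 \<le> cz_const TYPE('n) p * l powr (1 - p) * (LINT y:?Q|gauss. norm (f y) powr p)"
      unfolding int_const using cz_const(1)[OF p, where 'n = 'n] by simp
    then show "atomic_bound (\<lambda>y. indicat_real ?Q y *\<^sub>R f y - indicat_real ?Q y *\<^sub>R c)
       (cz_const TYPE('n) p * l powr (1 - p) * (LINT y:?Q|gauss. norm (f y) powr p))"
      unfolding eq by (simp add: atomic_bound_mono[OF atomic_bound_zero])
  qed (auto simp: indicator_def)
next
  case (Suc d)
  let ?Q = "cell k x" and ?D = "doubling_const TYPE('n)" and ?K = "cz_const TYPE('n) p" and ?E = "ball_ratio_const TYPE('n)"
  let ?I = "\<lambda>C. LINT y:C|gauss. norm (f y) powr p"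
  note fm [measurable] = step_measurable[OF f]
  note fi = integrable_of_powr[OF fm p fp]
  note D1 = doubling_const_gt_1[where 'n = 'n]
  have good_child: "\<exists>g. good_part p l f C g"
    if "C \<in> cell (Suc k) ` ?Q" for C
  proof -
    from that obtain y where y: "y \<in> ?Q" and C: "C = cell (Suc k) y" by auto
    have lev: "root_level y \<le> Suc k"
      using root_level_eq[OF y Suc.prems(1)] Suc.prems(1) by simp
    have d: "d = N - Suc k" using Suc.hyps(2) by simp
    have [measurable]: "C \<in> sets borel" by (simp add: C)
    show ?thesis
    proof (cases "?I C \<le> l powr p * measure gauss C")
      case True
      then show ?thesis using Suc.hyps(1)[OF d lev Suc.prems(2)] unfolding C by blast
    next
      case False
      have CQ: "C \<subseteq> ?Q"
        using cell_mono[of k "Suc k" y] cell_eqI[OF y] unfolding C by simp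
      have "?I C \<le> ?I ?Q"
        unfolding set_lebesgue_integral_def using CQ fp
        by (intro integral_mono integrable_mult_indicator) (auto simp: indicator_def)
      also have "\<dots> \<le> l powr p * measure gauss ?Q" by (rule Suc.prems(3))
      also have "\<dots> \<le> l powr p * (?D * measure gauss C)"
        using cell_doubling[OF Suc.prems(1) y] by (intro mult_left_mono) (auto simp: C doubling_const_def)
      also have "\<dots> \<le> l powr p * (?D powr p * measure gauss C)"
        using D1 p powr_mono[of 1 p ?D] by (intro mult_left_mono mult_right_mono) auto
      also have "\<dots> = (?D * l) powr p * measure gauss C"
        using D1 Suc.prems(2) by (simp add: powr_mult mult_ac)
      finally have IC: "?I C \<le> (?D * l) powr p * measure gauss C" .
      have Dl: "0 < ?D * l" using D1 Suc.prems(2) by simp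
      obtain g where g: "g \<in> borel_measurable borel" "\<And>z. z \<notin> C \<Longrightarrow> g z = 0"
        "\<And>z. norm (g z) \<le> 2 * ?D * (?D * l)" "(\<integral>z. g z \<partial>gauss) = (LINT z:C|gauss. f z)"
        "atomic_bound (\<lambda>z. indicat_real C z *\<^sub>R f z - g z) (?K * (?D * l) powr (1 - p) * ?I C)"
        using Suc.hyps(1)[OF d lev Dl] IC unfolding C good_part_def by blast
      have C0: "0 < measure gauss C" unfolding C by (rule cell_gauss_pos[OF lev])
      define m where "m = (LINT z:C|gauss. f z) / measure gauss C"
      have "norm (LINT z:C|gauss. f z) \<le> ?D * l * measure gauss C + (?D * l) powr (1 - p) * ?I C"
        by (rule norm_set_integral_le[OF fm p fp _ Dl]) simp
      also have "(?D * l) powr (1 - p) * ?I C \<le> (?D * l) powr (1 - p) * ((?D * l) powr p * measure gauss C)"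
        using IC by (intro mult_left_mono) auto
      also have "\<dots> = ?D * l * measure gauss C"
        using Dl by (simp add: mult.assoc[symmetric] powr_add[symmetric])
      finally have "norm (LINT z:C|gauss. f z) \<le> 2 * ?D * l * measure gauss C" by (simp add: mult_ac)
      then have m: "norm m \<le> 2 * ?D * l"
        using C0 by (simp add: m_def norm_divide divide_le_eq)
      have "atomic_bound (\<lambda>z. g z - indicat_real C z *\<^sub>R m)
         ((2 * ?D * (?D * l) + 2 * ?D * l) * (?E * measure gauss C))"
        unfolding C
      proof (rule cell_replace_by_mean[OF lev g(1) _ g(3) m])
        show "g z = 0" if "z \<notin> cell (Suc k) y" for z using that g(2) C by simp
        show "m * measure gauss (cell (Suc k) y) = (\<integral>z. g z \<partial>gauss)"
          using g(4) C0 by (simp add: m_def C)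
      qed
      from atomic_bound_add[OF g(5) this]
      have ab: "atomic_bound (\<lambda>z. indicat_real C z *\<^sub>R f z - indicat_real C z *\<^sub>R m)
        (?K * (?D * l) powr (1 - p) * ?I C + (2 * ?D * (?D * l) + 2 * ?D * l) * (?E * measure gauss C))"
        by simp
      have "(2 * ?D * (?D * l) + 2 * ?D * l) * (?E * measure gauss C) \<le> (4 * ?D\<^sup>2 * l) * (?E * measure gauss C)"
        using D1 Suc.prems(2) ball_ratio_const_nonneg[where 'n = 'n]
        by (intro mult_right_mono) (auto simp: power2_eq_square)
      also have "\<dots> = 4 * ?D\<^sup>2 * ?E * l powr (1 - p) * (l powr p * measure gauss C)"
        using Suc.prems(2) by (simp add: powr_diff field_simps)
      also have "\<dots> \<le> 4 * ?D\<^sup>2 * ?E * l powr (1 - p) * ?I C"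
        using False ball_ratio_const_nonneg[where 'n = 'n] by (intro mult_left_mono) auto
      finally have "?K * (?D * l) powr (1 - p) * ?I C + (2 * ?D * (?D * l) + 2 * ?D * l) * (?E * measure gauss C)
        \<le> ?K * (?D * l) powr (1 - p) * ?I C + 4 * ?D\<^sup>2 * ?E * l powr (1 - p) * ?I C" by simp
      also have "\<dots> = (?K * ?D powr (1 - p) + 4 * ?D\<^sup>2 * ?E) * l powr (1 - p) * ?I C"
        using D1 Suc.prems(2) by (simp add: powr_mult algebra_simps)
      also have "\<dots> = ?K * l powr (1 - p) * ?I C"
        by (simp only: cz_const(2)[OF p])
      finally have ab': "atomic_bound (\<lambda>z. indicat_real C z *\<^sub>R f z - indicat_real C z *\<^sub>R m)
        (?K * l powr (1 - p) * ?I C)" by (rule atomic_bound_mono[OF ab])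
      show ?thesis
        unfolding good_part_def
      proof (intro exI[of _ "\<lambda>z. indicat_real C z *\<^sub>R m"] conjI allI impI ab')
        show "norm (indicat_real C z *\<^sub>R m) \<le> 2 * ?D * l" for z
          using m order_trans[OF norm_ge_zero m] by (auto simp: indicator_def)
        show "(\<integral>z. indicat_real C z *\<^sub>R m \<partial>gauss) = (LINT z:C|gauss. f z)"
          using C0 by (simp add: m_def scaleR_conv_of_real)
      qed (auto simp: indicator_def)
    qed
  qed
  define F where "F = cell (Suc k) ` ?Q"
  have "\<forall>C\<in>F. \<exists>g. good_part p l f C g" using good_child by (simp add: F_def)
  then obtain g where good: "\<And>C. C \<in> F \<Longrightarrow> good_part p l f C (g C)" by metis
  have g: "g C \<in> borel_measurable borel" "y \<notin> C \<Longrightarrow> g C y = 0" "norm (g C y) \<le> 2 * ?D * l"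
    "(\<integral>y. g C y \<partial>gauss) = (LINT y:C|gauss. f y)"
    "atomic_bound (\<lambda>y. indicat_real C y *\<^sub>R f y - g C y) (?K * l powr (1 - p) * ?I C)" if "C \<in> F" for C y
    using good[OF that] by (auto simp: good_part_def)
  have fin: "finite F" unfolding F_def by (rule finite_children)
  have disj: "disjoint_family_on (\<lambda>C. C) F"
    unfolding F_def disjoint_family_on_def by (auto simp: cell_def)
  have un: "(\<Union>C\<in>F. C) = ?Q"
  proof -
    have "cell (Suc k) y \<subseteq> ?Q" if "y \<in> ?Q" for y
      using cell_mono[of k "Suc k" y] cell_eqI[OF that] by simp
    then show ?thesis unfolding F_def using in_cell_self by blast
  qed
  have Fm: "C \<in> sets borel" if "C \<in> F" for C using that by (auto simp: F_def)
  have split: "(LINT y:?Q|gauss. h y) = (\<Sum>C\<in>F. LINT y:C|gauss. h y)"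
    if "integrable gauss h" for h :: "real^'n \<Rightarrow> 'z :: {banach, second_countable_topology}"
    unfolding un[symmetric] using fin disj that Fm by (intro set_integral_finite_Union set_integrable_gauss) auto
  have ind: "indicat_real ?Q y = (\<Sum>C\<in>F. indicat_real C y)" for y
    unfolding un[symmetric] by (rule indicator_UN_disjoint[OF fin disj])
  show ?case
    unfolding good_part_def
  proof (intro exI[of _ "\<lambda>y. \<Sum>C\<in>F. g C y"] conjI allI impI)
    show "(\<lambda>y. \<Sum>C\<in>F. g C y) \<in> borel_measurable borel" using g(1) by (intro borel_measurable_sum)
    show "(\<Sum>C\<in>F. g C y) = 0" if "y \<notin> ?Q" for y
      using that g(2) un by (intro sum.neutral) blast
    show "norm (\<Sum>C\<in>F. g C y) \<le> 2 * ?D * l" for y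
    proof (cases "\<exists>C0\<in>F. y \<in> C0")
      case True
      then obtain C0 where C0: "C0 \<in> F" "y \<in> C0" by blast
      have "g C y = 0" if "C \<in> F - {C0}" for C
        using that C0 disj g(2)[of C y] by (auto simp: disjoint_family_on_def)
      then have "(\<Sum>C\<in>F. g C y) = (\<Sum>C\<in>{C0}. g C y)"
        using C0 fin by (intro sum.mono_neutral_right) auto
      then show ?thesis using g(3)[OF C0(1)] by simp
    next
      case False
      then have "(\<Sum>C\<in>F. g C y) = 0" using g(2) by (intro sum.neutral) blast
      then show ?thesis using D1 Suc.prems(2) by simp
    qed
    have gi: "integrable gauss (g C)" if "C \<in> F" for C
      using g(1,3)[OF that] by (intro gauss.integrable_const_bound[where B = "2 * ?D * l"]) (auto cong: measurable_cong_sets)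
    then have "(\<integral>y. (\<Sum>C\<in>F. g C y) \<partial>gauss) = (\<Sum>C\<in>F. \<integral>y. g C y \<partial>gauss)"
      by (intro Bochner_Integration.integral_sum)
    also have "\<dots> = (LINT y:?Q|gauss. f y)"
      using g(4) split[OF fi] by simp
    finally show "(\<integral>y. (\<Sum>C\<in>F. g C y) \<partial>gauss) = (LINT y:?Q|gauss. f y)" .
    have "atomic_bound (\<lambda>y. \<Sum>C\<in>F. indicat_real C y *\<^sub>R f y - g C y) (\<Sum>C\<in>F. ?K * l powr (1 - p) * ?I C)"
      using fin g(5) by (rule atomic_bound_sum)
    moreover have "(\<Sum>C\<in>F. ?K * l powr (1 - p) * ?I C) = ?K * l powr (1 - p) * ?I ?Q"
      unfolding split[OF fp] by (simp add: sum_distrib_left)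
    moreover have "(\<Sum>C\<in>F. indicat_real C y *\<^sub>R f y - g C y) = indicat_real ?Q y *\<^sub>R f y - (\<Sum>C\<in>F. g C y)" for y
      by (simp add: ind sum_subtractf scaleR_sum_left)
    ultimately show "atomic_bound (\<lambda>y. indicat_real ?Q y *\<^sub>R f y - (\<Sum>C\<in>F. g C y)) (?K * l powr (1 - p) * ?I ?Q)"
      by simp
  qed
qed

section \<open>Transport of mass to the origin\<close>

definition bump :: "real ^ 'n \<Rightarrow> real ^ 'n \<Rightarrow> complex" where
  "bump x y = indicat_real (core_ball x) y *\<^sub>R (1 / of_real (measure gauss (core_ball x)))"

lemma bump_measurable [measurable]: "bump x \<in> borel_measurable borel"
  unfolding bump_def[abs_def] by measurable

lemma bump_outside: "y \<notin> core_ball x \<Longrightarrow> bump x y = 0"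
  by (simp add: bump_def)

lemma norm_bump_le: "norm (bump x y) \<le> 1 / measure gauss (core_ball x)"
  by (auto simp: bump_def indicator_def norm_divide)

lemma bump_integrable: "integrable gauss (bump x)"
  by (rule gauss.integrable_const_bound[where B = "1 / measure gauss (core_ball x)"])
    (auto intro: norm_bump_le cong: measurable_cong_sets)

lemma bump_integral: "(\<integral>y. bump x y \<partial>gauss) = 1"
  using core_ball_gauss_pos[of x] by (simp add: bump_def scaleR_conv_of_real)

definition bump_const :: "'n::finite itself \<Rightarrow> real" where
  "bump_const _ = exp 6 * 16 ^ CARD('n)"

lemma bump_const_pos: "0 < bump_const TYPE('n::finite)"
  by (simp add: bump_const_def)

text \<open>
  Both bumps live in the admissible ball at \<open>x\<close> and have integral \<open>1\<close>, and their heights are at most a constant over the mass of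
  that ball.
\<close>

lemma bump_step:
  fixes x :: "real ^ 'n"
  assumes near: "norm (y - x) \<le> 1 / (4 * inv_radius x)"
  shows "atomic_bound (\<lambda>z. bump x z - bump y z) (2 * bump_const TYPE('n))"
proof (rule atomic_bound_mono[OF atomic_bound_ball[where B = "cball x (1 / inv_radius x)"]])
  let ?B = "cball x (1 / inv_radius x)" and ?A = "bump_const TYPE('n)"
  let ?M = "1 / measure gauss (core_ball x) + 1 / measure gauss (core_ball y)"
  show "?B \<in> admissible_balls" by (rule cball_admissible) auto
  note sx = core_ball_near[of x x, simplified] and sy = core_ball_near[OF near]
  show "bump x z - bump y z = 0" if "z \<notin> ?B" for z
    using that sx(1) sy(1) bump_outside[of z] by (metis diff_self subsetD)
  show "norm (bump x z - bump y z) \<le> ?M" for z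
    using norm_triangle_ineq4[of "bump x z" "bump y z"] norm_bump_le[of x z] norm_bump_le[of y z] by linarith
  show "(\<integral>z. bump x z - bump y z \<partial>gauss) = 0"
    by (simp add: bump_integrable bump_integral)
  have "measure gauss ?B / measure gauss (core_ball x) \<le> ?A" "measure gauss ?B / measure gauss (core_ball y) \<le> ?A"
    using sx(2) sy(2) core_ball_gauss_pos[of x] core_ball_gauss_pos[of y] 
    by (auto simp: bump_const_def divide_le_eq)
  then show "?M * measure gauss ?B \<le> 2 * ?A" by (simp add: algebra_simps)
qed simp

text \<open>
  Since \<open>|x|\<^sup>2 - (|x| - s)\<^sup>2 = s (2 |x| - s)\<close>, a step of length \<open>s = 1 / (4 max 1 |x|)\<close> gains about \<open>1/2\<close> far from the
  origin, and still \<open>1/16\<close> where \<open>|x|\<close> is just above \<open>1/4\<close>. Below \<open>1/4\<close> the origin is within one step.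
\<close>

lemma inward_step:
  fixes x :: "real ^ 'n"
  assumes "1 / 4 < norm x"
  obtains y where "norm (y - x) \<le> 1 / (4 * inv_radius x)" "(norm y)\<^sup>2 \<le> (norm x)\<^sup>2 - 1 / 16"
proof -
  define s where "s = 1 / (4 * inv_radius x)"
  define y where "y = ((norm x - s) / norm x) *\<^sub>R x"
  have x0: "0 < norm x" using assms by linarith
  have s: "0 < s" "s \<le> 1 / 4" by (auto simp: s_def)
  have y: "norm y = norm x - s" using x0 s assms by (simp add: y_def)
  have "(norm x)\<^sup>2 - (norm y)\<^sup>2 = s * (2 * norm x - s)"
    unfolding y by (simp add: power2_eq_square algebra_simps)
  also have "\<dots> \<ge> 1 / 16"
  proof (cases "norm x \<le> 1")
    case True
    then have "s = 1 / 4" by (simp add: s_def inv_radius_def)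
    then show ?thesis using assms by (simp only: \<open>s = 1 / 4\<close>) (simp add: field_simps)
  next
    case False
    then have "s * norm x = 1 / 4" using x0 by (simp add: s_def inv_radius_def)
    moreover have "s * s \<le> 1 / 4 * (1 / 4)" using s by (intro mult_mono) auto
    ultimately show ?thesis by (simp add: algebra_simps)
  qed
  finally have "(norm y)\<^sup>2 \<le> (norm x)\<^sup>2 - 1 / 16" by linarith
  moreover have "y - x = (- s / norm x) *\<^sub>R x"
    using x0 by (simp add: y_def algebra_simps diff_divide_distrib)
  then have "norm (y - x) \<le> s" using s x0 by simp
  ultimately show ?thesis using that by (simp add: s_def)
qed

lemma bump_chain:
  fixes x :: "real ^ 'n"
  shows "(norm x)\<^sup>2 \<le> real k / 16 \<Longrightarrow>
    atomic_bound (\<lambda>z. bump x z - bump 0 z) (2 * bump_const TYPE('n) * (real k + 1))"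
proof (induction k arbitrary: x)
  case 0
  then have "x = 0" by simp
  then show ?case
    using bump_const_pos[where 'n = 'n] by (simp add: atomic_bound_mono[OF atomic_bound_zero])
next
  case (Suc k)
  show ?case
  proof (cases "norm x \<le> 1 / 4")
    case True
    then have "norm (0 - x) \<le> 1 / (4 * inv_radius x)" by (simp add: inv_radius_def max_def)
    from bump_step[OF this] show ?thesis
      by (rule atomic_bound_mono) (use bump_const_pos[where 'n = 'n] in simp)
  next
    case False
    then obtain y where y: "norm (y - x) \<le> 1 / (4 * inv_radius x)" "(norm y)\<^sup>2 \<le> (norm x)\<^sup>2 - 1 / 16"
      using inward_step[of x] by auto
    have "atomic_bound (\<lambda>z. bump y z - bump 0 z) (2 * bump_const TYPE('n) * (real k + 1))"
      by (rule Suc.IH) (use y(2) Suc.prems in simp)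
    from atomic_bound_add[OF bump_step[OF y(1)] this] show ?thesis
      by (simp add: algebra_simps)
  qed
qed

lemma bump_transport:
  fixes x :: "real ^ 'n"
  shows "atomic_bound (\<lambda>z. bump x z - bump 0 z) (36 * bump_const TYPE('n) * (inv_radius x)\<^sup>2)"
proof -
  define k where "k = nat \<lceil>16 * (norm x)\<^sup>2\<rceil>"
  have k: "16 * (norm x)\<^sup>2 \<le> real k" "real k \<le> 16 * (norm x)\<^sup>2 + 1"
    unfolding k_def by (auto intro: of_nat_ceiling)
  have "(norm x)\<^sup>2 \<le> (inv_radius x)\<^sup>2" by (intro power_mono norm_le_inv_radius) auto
  moreover have "1 \<le> (inv_radius x)\<^sup>2" by (rule one_le_power) simp
  ultimately have "real k + 1 \<le> 18 * (inv_radius x)\<^sup>2" using k(2) by linarith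
  then have "2 * bump_const TYPE('n) * (real k + 1) \<le> 2 * bump_const TYPE('n) * (18 * (inv_radius x)\<^sup>2)"
    using bump_const_pos[where 'n = 'n] by (intro mult_left_mono) auto
  then show ?thesis
    using k(1) by (intro atomic_bound_mono[OF bump_chain[of x k]]) auto
qed

definition root_const :: "'n::finite itself \<Rightarrow> real" where
  "root_const _ = exp 6 * (unit_ball_vol (real CARD('n)) * (20 * real CARD('n)) ^ CARD('n))"

lemma root_const_nonneg: "0 \<le> root_const TYPE('n::finite)"
  unfolding root_const_def using unit_vol_pos[where 'n = 'n] by simp

text \<open>
  One summand for each of the three parts of the decomposition on a root cell: the Calderon-Zygmund atoms, the
  exchange of the bounded part for a bump, and the transport of the bump to the origin.
\<close>

definition piece_const :: "'n::finite itself \<Rightarrow> real \<Rightarrow> real" where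
  "piece_const _ p = cz_const TYPE('n) p + 2 * (doubling_const TYPE('n) + bump_const TYPE('n)) * root_const TYPE('n)
     + 144 * bump_const TYPE('n)"

lemma piece_const_nonneg: "1 < p \<Longrightarrow> 0 \<le> piece_const TYPE('n::finite) p"
  unfolding piece_const_def
  using cz_const(1)[of p, where 'n = 'n] doubling_const_gt_1[where 'n = 'n] bump_const_pos[where 'n = 'n] root_const_nonneg[where 'n = 'n]
  by (intro add_nonneg_nonneg mult_nonneg_nonneg) auto

text \<open>
  The three parts are \<open>f - g\<close>, \<open>g - z b\<^sub>x\<close> and \<open>z (b\<^sub>x - b\<^sub>0)\<close>, where \<open>g\<close> is the good part of \<open>f\<close> on the cell, \<open>z\<close> the
  integral of \<open>f\<close> over it and \<open>b\<^sub>x\<close> the bump at \<open>x\<close>. The bound is an integral over the cell, so that it can be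
  summed over all cells.
\<close>

lemma root_piece:
  fixes f :: "real ^ 'n \<Rightarrow> complex"
  assumes p: "1 < p" and f: "step N f" and fp: "integrable gauss (\<lambda>x. norm (f x) powr p)"
  shows "atomic_bound (\<lambda>y. indicat_real (root_cell x) y *\<^sub>R f y - (LINT y:root_cell x|gauss. f y) * bump 0 y)
     (piece_const TYPE('n) p * (LINT y:root_cell x|gauss. norm (f y) powr p + (1 + inv_radius y powr (2 * (p / (p - 1))))))"
proof -
  let ?Q = "root_cell x" and ?B = "cball x (1 / inv_radius x)"
  let ?D = "doubling_const TYPE('n)" and ?K = "cz_const TYPE('n) p" and ?A = "bump_const TYPE('n)" and ?R = "root_const TYPE('n)"
  define q where "q = 2 * (p / (p - 1))"
  define I where "I = (LINT y:?Q|gauss. norm (f y) powr p)"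
  define J where "J = (LINT y:?Q|gauss. inv_radius y powr q)"
  define v where "v = measure gauss ?Q"
  define z where "z = (LINT y:?Q|gauss. f y)"
  note fm [measurable] = step_measurable[OF f]
  note fi = integrable_of_powr[OF fm p fp]
  have q: "0 \<le> q" using p by (simp add: q_def)
  note mi = integrable_gauss_inv_radius_powr[OF q]
  have total: "(LINT y:?Q|gauss. norm (f y) powr p + (1 + inv_radius y powr q)) = I + (v + J)"
  proof -
    have 1: "set_integrable gauss ?Q (\<lambda>y. 1 :: real)" "set_integrable gauss ?Q (\<lambda>y. inv_radius y powr q)"
      "set_integrable gauss ?Q (\<lambda>y. norm (f y) powr p)"
      using fp mi by (auto intro!: set_integrable_gauss)
    have 2: "(LINT y:?Q|gauss. (1::real)) = v"
      by (simp add: v_def set_integral_const gauss.emeasure_eq_measure)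
    show ?thesis
      unfolding set_integral_add(2)[OF 1(3) set_integral_add(1)[OF 1(1,2)]] set_integral_add(2)[OF 1(1,2)] 2
      by (simp add: I_def J_def)
  qed
  have v: "0 < v" unfolding v_def root_cell_def by (rule cell_gauss_pos) simp
  have I: "0 \<le> I" and J: "0 \<le> J" unfolding I_def J_def set_lebesgue_integral_def by (simp_all add: integral_nonneg_AE)
  \<comment> \<open>The summand \<open>1\<close> keeps the height at least \<open>1\<close>. So \<open>l\<^sup>1\<^sup>-\<^sup>p \<le> 1\<close> bounds the cost of the atoms by \<open>I\<close>, and
    \<open>l \<le> l\<^sup>p\<close> bounds that of the bounded part by \<open>I + v\<close>.\<close>
  define l where "l = (I / v + 1) powr (1 / p)"
  have l1: "1 \<le> l" unfolding l_def using I v p by (intro ge_one_powr_ge_zero) auto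
  have lp: "l powr p * v = I + v" using I v p by (simp add: l_def powr_powr add_nonneg_pos field_simps)
  have "l powr (1 - p) \<le> l powr 0" using l1 p by (intro powr_mono) auto
  then have l1p: "l powr (1 - p) \<le> 1" using l1 by simp
  have lv: "l * v \<le> I + v"
  proof -
    have "l powr 1 \<le> l powr p" using l1 p by (intro powr_mono) auto
    then have "l * v \<le> l powr p * v" using l1 v by (intro mult_right_mono) auto
    then show ?thesis using lp by simp
  qed
  obtain g where g: "g \<in> borel_measurable borel" "\<And>y. y \<notin> ?Q \<Longrightarrow> g y = 0"
      "\<And>y. norm (g y) \<le> 2 * ?D * l" "(\<integral>y. g y \<partial>gauss) = z"
      "atomic_bound (\<lambda>y. indicat_real ?Q y *\<^sub>R f y - g y) (?K * l powr (1 - p) * I)"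
  proof -
    have le: "I \<le> l powr p * v" using lp v by simp
    show ?thesis
      using calderon_zygmund[OF p f fp, of x "root_level x" l] l1 le that
      unfolding I_def v_def z_def root_cell_def good_part_def by auto
  qed
  have part1: "atomic_bound (\<lambda>y. indicat_real ?Q y *\<^sub>R f y - g y) (?K * I)"
  proof (rule atomic_bound_mono[OF g(5)])
    show "?K * l powr (1 - p) * I \<le> ?K * I"
      using l1p I cz_const(1)[OF p, where 'n = 'n]
      by (intro mult_right_mono mult_left_le) auto
  qed
  have QB: "?Q \<subseteq> ?B" unfolding root_cell_def by (rule cell_subset_unit_ball) simp
  note core = core_ball_near[of x x, simplified]
  have c0: "0 < measure gauss (core_ball x)" by (rule core_ball_gauss_pos)
  have z_le: "norm z \<le> 2 * (l * v)"
  proof -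
    have "norm z \<le> l * v + l powr (1 - p) * I"
      unfolding z_def v_def I_def using l1 by (intro norm_set_integral_le fm p fp) auto
    also have "l powr (1 - p) * I \<le> l powr (1 - p) * (l powr p * v)"
      using lp v by (intro mult_left_mono) auto
    also have "\<dots> = l * v" using l1 by (simp add: mult.assoc[symmetric] powr_add[symmetric])
    finally show ?thesis by simp
  qed
  have z_core: "norm z / measure gauss (core_ball x) \<le> 2 * ?A * l"
  proof -
    have "v \<le> measure gauss ?B" unfolding v_def using QB by (intro gauss.finite_measure_mono) auto
    also have "\<dots> \<le> ?A * measure gauss (core_ball x)" using core(2) by (simp add: bump_const_def)
    finally have "2 * (l * v) \<le> 2 * (l * (?A * measure gauss (core_ball x)))"
      using l1 by (intro mult_left_mono) auto
    with z_le show ?thesis using c0 by (simp add: divide_le_eq mult_ac)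
  qed
  have part2: "atomic_bound (\<lambda>y. g y - z * bump x y) (2 * (?D + ?A) * ?R * (I + v))"
  proof (rule atomic_bound_mono[OF atomic_bound_ball[where B = ?B]])
    show "?B \<in> admissible_balls" by (rule cball_admissible) auto
    show "g y - z * bump x y = 0" if "y \<notin> ?B" for y
    proof -
      have "y \<notin> ?Q" "y \<notin> core_ball x" using that QB core(1) by blast+
      then show ?thesis by (simp add: g(2) bump_outside)
    qed
    show "norm (g y - z * bump x y) \<le> 2 * (?D + ?A) * l" for y
    proof -
      have "norm (z * bump x y) \<le> norm z * (1 / measure gauss (core_ball x))"
        unfolding norm_mult by (intro mult_left_mono norm_bump_le) auto
      then show ?thesis
        using norm_triangle_ineq4[of "g y" "z * bump x y"] g(3)[of y] z_core by (simp add: algebra_simps)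
    qed
    have "integrable gauss g"
      using g(1,3) by (intro gauss.integrable_const_bound[where B = "2 * ?D * l"]) (auto cong: measurable_cong_sets)
    then show "(\<integral>y. g y - z * bump x y \<partial>gauss) = 0"
      by (simp add: bump_integrable bump_integral g(4))
    have "measure gauss ?B \<le> ?R * v"
      using root_ball_ratio[of x] by (simp add: v_def root_const_def)
    then have "2 * (?D + ?A) * l * measure gauss ?B \<le> 2 * (?D + ?A) * l * (?R * v)"
      using l1 doubling_const_gt_1[where 'n = 'n] bump_const_pos[where 'n = 'n] by (intro mult_left_mono) auto
    also have "\<dots> = 2 * (?D + ?A) * ?R * (l * v)" by simp
    also have "\<dots> \<le> 2 * (?D + ?A) * ?R * (I + v)"
      using lv doubling_const_gt_1[where 'n = 'n] bump_const_pos[where 'n = 'n] root_const_nonneg[where 'n = 'n]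
      by (intro mult_left_mono) auto
    finally show "2 * (?D + ?A) * l * measure gauss ?B \<le> 2 * (?D + ?A) * ?R * (I + v)" .
  qed (use g(1) in measurable)
  have z_transport: "norm z * (inv_radius x)\<^sup>2 \<le> 4 * (I + J)"
  proof -
    have sq: "(inv_radius x)\<^sup>2 \<le> 4 * (inv_radius y)\<^sup>2" if "y \<in> ?Q" for y
    proof -
      have "norm (x - y) \<le> 1 / inv_radius x" using QB that by (auto simp: dist_norm)
      also have "\<dots> \<le> inv_radius y" by (rule order_trans[of _ 1]) auto
      finally have "inv_radius x \<le> 2 * inv_radius y" using inv_radius_lipschitz[of x y] by linarith
      then have "(inv_radius x)\<^sup>2 \<le> (2 * inv_radius y)\<^sup>2" by (intro power_mono) auto
      then show ?thesis by (simp add: power_mult_distrib)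
    qed
    have pw: "norm (f y) * (inv_radius x)\<^sup>2 \<le> 4 * (norm (f y) powr p + inv_radius y powr q)" if "y \<in> ?Q" for y
    proof -
      have "norm (f y) * (inv_radius x)\<^sup>2 \<le> norm (f y) * (4 * (inv_radius y)\<^sup>2)"
        using sq[OF that] by (intro mult_left_mono) auto
      also have "\<dots> = 4 * (norm (f y) * (inv_radius y)\<^sup>2)" by simp
      also have "norm (f y) * (inv_radius y)\<^sup>2 \<le> norm (f y) powr p + ((inv_radius y)\<^sup>2) powr (p / (p - 1))"
        using p by (intro mult_le_powr_add) auto
      also have "((inv_radius y)\<^sup>2) powr (p / (p - 1)) = inv_radius y powr q"
        by (simp add: q_def powr_powr flip: powr_numeral)
      finally show ?thesis by simp
    qed
    have "norm z * (inv_radius x)\<^sup>2 \<le> (LINT y:?Q|gauss. norm (f y)) * (inv_radius x)\<^sup>2"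
      unfolding z_def by (intro mult_right_mono set_integral_norm_bound set_integrable_gauss fi) auto
    also have "\<dots> = (LINT y:?Q|gauss. norm (f y) * (inv_radius x)\<^sup>2)" by simp
    also have "\<dots> \<le> (LINT y:?Q|gauss. 4 * (norm (f y) powr p + inv_radius y powr q))"
      using fi fp mi pw by (intro set_integral_mono set_integrable_gauss) auto
    also have "\<dots> = 4 * (LINT y:?Q|gauss. norm (f y) powr p + inv_radius y powr q)"
      by (rule set_integral_mult_right)
    also have "\<dots> = 4 * (I + J)"
      unfolding I_def J_def using fp mi by (subst set_integral_add) (auto intro: set_integrable_gauss)
    finally show ?thesis .
  qed
  have part3: "atomic_bound (\<lambda>y. z * (bump x y - bump 0 y)) (144 * ?A * (I + J))"
  proof (rule atomic_bound_mono[OF atomic_bound_scale[OF bump_transport]])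
    have "norm z * (36 * ?A * (inv_radius x)\<^sup>2) = 36 * ?A * (norm z * (inv_radius x)\<^sup>2)" by simp
    also have "\<dots> \<le> 36 * ?A * (4 * (I + J))"
      using z_transport bump_const_pos[where 'n = 'n] by (intro mult_left_mono) auto
    also have "\<dots> = 144 * ?A * (I + J)" by simp
    finally show "norm z * (36 * ?A * (inv_radius x)\<^sup>2) \<le> 144 * ?A * (I + J)" .
  qed
  have "atomic_bound (\<lambda>y. (indicat_real ?Q y *\<^sub>R f y - g y) + ((g y - z * bump x y) + z * (bump x y - bump 0 y)))
     (?K * I + (2 * (?D + ?A) * ?R * (I + v) + 144 * ?A * (I + J)))"
    by (intro atomic_bound_add part1 part2 part3)
  moreover have "?K * I + (2 * (?D + ?A) * ?R * (I + v) + 144 * ?A * (I + J)) \<le> piece_const TYPE('n) p * (I + (v + J))"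
  proof -
    have "?K * I \<le> ?K * (I + (v + J))"
      using v J cz_const(1)[OF p, where 'n = 'n] by (intro mult_left_mono) auto
    moreover have "2 * (?D + ?A) * ?R * (I + v) \<le> 2 * (?D + ?A) * ?R * (I + (v + J))"
      using J doubling_const_gt_1[where 'n = 'n] bump_const_pos[where 'n = 'n] root_const_nonneg[where 'n = 'n]
      by (intro mult_left_mono) auto
    moreover have "144 * ?A * (I + J) \<le> 144 * ?A * (I + (v + J))"
      using v bump_const_pos[where 'n = 'n] by (intro mult_left_mono) auto
    ultimately show ?thesis unfolding piece_const_def distrib_right[of _ _ "I + (v + J)"] by linarith
  qed
  ultimately have "atomic_bound (\<lambda>y. (indicat_real ?Q y *\<^sub>R f y - g y) + ((g y - z * bump x y) + z * (bump x y - bump 0 y)))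
     (piece_const TYPE('n) p * (I + (v + J)))" by (rule atomic_bound_mono)
  then show ?thesis
    unfolding q_def[symmetric] total z_def[symmetric] by (simp add: algebra_simps)
qed

section \<open>Decomposition of step functions\<close>

lemma set_integrals_sums:
  fixes f :: "real ^ 'n \<Rightarrow> 'b :: {banach, second_countable_topology}"
  assumes f: "integrable gauss f" and A: "\<And>i::nat. A i \<in> sets borel"
    and disj: "disjoint_family A" and un: "(\<Union>i. A i) = UNIV"
  shows "(\<lambda>i. LINT x:A i|gauss. f x) sums (\<integral>x. f x \<partial>gauss)"
proof -
  let ?B = "\<lambda>n. \<Union>i<n. A i"
  have "(\<lambda>n. LINT x:?B n|gauss. f x) \<longlonglongrightarrow> (LINT x:(\<Union>n. ?B n)|gauss. f x)"
    by (rule set_integral_cont_up) (use A f in \<open>auto simp: incseq_def intro!: set_integrable_gauss intro: less_le_trans\<close>)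
  also have "(\<Union>n. ?B n) = UNIV" using un by blast
  also have "(\<lambda>n. LINT x:?B n|gauss. f x) = (\<lambda>n. \<Sum>i<n. LINT x:A i|gauss. f x)"
    using disj A f by (intro ext set_integral_finite_Union)
      (auto simp: disjoint_family_on_def intro!: set_integrable_gauss)
  finally show ?thesis by (simp add: sums_def set_lebesgue_integral_def)
qed

text \<open>
  The enumeration is by codes of root cells; codes that are not taken give empty sets.
\<close>

lemma root_cell_partition:
  obtains A :: "nat \<Rightarrow> (real ^ 'n) set" where "\<And>i. A i \<in> sets borel" "disjoint_family A" "(\<Union>i. A i) = UNIV"
    "\<And>i. A i = {} \<or> (\<exists>x. A i = root_cell x)"
proof -
  let ?R = "range (root_cell :: real ^ 'n \<Rightarrow> _)"
  define A where "A i = {y :: real ^ 'n. to_nat_on ?R (root_cell y) = i}" for i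
  have cases: "A i = {} \<or> (\<exists>x. A i = root_cell x)" for i
  proof (cases "A i = {}")
    case False
    then obtain x where x: "to_nat_on ?R (root_cell x) = i" by (auto simp: A_def)
    have "y \<in> A i \<longleftrightarrow> root_cell y = root_cell x" for y
      using to_nat_on_inj[OF countable_root_cells, of "root_cell y" "root_cell x"] x by (auto simp: A_def)
    moreover have "root_cell y = root_cell x \<longleftrightarrow> y \<in> root_cell x" for y
      using root_cell_eqI[of y x] in_root_cell_self[of y] by metis
    ultimately have "A i = root_cell x" by blast
    then show ?thesis by blast
  qed simp
  show ?thesis
  proof (rule that[of A])
    show "A i \<in> sets borel" for i using cases[of i] by auto
    show "disjoint_family A" by (auto simp: disjoint_family_on_def A_def)
    show "(\<Union>i. A i) = UNIV" by (auto simp: A_def)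
  qed (rule cases)
qed

lemma step_minus_bump:
  fixes f :: "real ^ 'n \<Rightarrow> complex"
  assumes p: "1 < p" and f: "step N f" and fp: "integrable gauss (\<lambda>x. norm (f x) powr p)"
  shows "atomic_bound (\<lambda>y. f y - (\<integral>x. f x \<partial>gauss) * bump 0 y)
     (piece_const TYPE('n) p * (\<integral>y. norm (f y) powr p + (1 + inv_radius y powr (2 * (p / (p - 1)))) \<partial>gauss))"
proof -
  define G where "G y = norm (f y) powr p + (1 + inv_radius y powr (2 * (p / (p - 1))))" for y
  define C where "C = piece_const TYPE('n) p"
  note fm [measurable] = step_measurable[OF f]
  note fi = integrable_of_powr[OF fm p fp]
  have Gi: "integrable gauss G"
    unfolding G_def[abs_def]
    by (intro Bochner_Integration.integrable_add fp integrable_gauss_inv_radius_powr) (use p in auto)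
  obtain A :: "nat \<Rightarrow> (real ^ 'n) set" where A: "\<And>i. A i \<in> sets borel" "disjoint_family A" "(\<Union>i. A i) = UNIV"
    "\<And>i. A i = {} \<or> (\<exists>x. A i = root_cell x)"
    using root_cell_partition by blast
  have "atomic_bound (\<lambda>y. f y - (\<integral>x. f x \<partial>gauss) * bump 0 y) (\<Sum>i. C * (LINT y:A i|gauss. G y))"
  proof (rule atomic_bound_suminf)
    show "atomic_bound (\<lambda>y. indicat_real (A i) y *\<^sub>R f y - (LINT y:A i|gauss. f y) * bump 0 y)
        (C * (LINT y:A i|gauss. G y))" for i
    proof (cases "A i = {}")
      case True
      then show ?thesis by (simp add: atomic_bound_zero set_lebesgue_integral_def)
    next
      case False
      with A(4)[of i] obtain x where "A i = root_cell x" by blast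
      then show ?thesis using root_piece[OF p f fp, of x] by (simp add: G_def C_def)
    qed
    show "summable (\<lambda>i. C * (LINT y:A i|gauss. G y))"
      using set_integrals_sums[OF Gi A(1-3)] by (intro summable_mult) (simp add: sums_iff)
    show "(\<lambda>y. f y - (\<integral>x. f x \<partial>gauss) * bump 0 y) \<in> borel_measurable borel" by measurable
    have "(\<lambda>i. indicat_real (A i) y *\<^sub>R f y) sums f y" for y
    proof -
      obtain j where j: "y \<in> A j" using A(3) by blast
      have "(\<lambda>i. indicat_real (A i) y *\<^sub>R f y) = (\<lambda>i. if i = j then f y else 0)"
        using j A(2) by (auto simp: disjoint_family_on_def indicator_def fun_eq_iff)
      then show ?thesis using sums_single[of j "\<lambda>_. f y"] by simp
    qed
    then show "AE y in gauss. (\<lambda>i. indicat_real (A i) y *\<^sub>R f y - (LINT y:A i|gauss. f y) * bump 0 y)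
       sums (f y - (\<integral>x. f x \<partial>gauss) * bump 0 y)"
      using set_integrals_sums[OF fi A(1-3)] by (intro AE_I2 sums_diff sums_mult2)
  qed
  also have "(\<Sum>i. C * (LINT y:A i|gauss. G y)) = C * (\<integral>y. G y \<partial>gauss)"
    using set_integrals_sums[OF Gi A(1-3)] by (simp add: sums_iff suminf_mult)
  finally show ?thesis by (simp add: G_def C_def)
qed

lemma gauss_mass_pos: "0 < measure gauss (UNIV :: (real ^ 'n) set)"
  by (rule less_le_trans[OF core_ball_gauss_pos gauss.finite_measure_mono[of "core_ball 0"]]) auto

text \<open>
  For the constant function \<open>1\<close>, \<open>step_minus_bump\<close> bounds \<open>1 - \<gamma>(\<real>\<^sup>n) b\<^sub>0\<close>, and \<open>1\<close> is an atom. The constant atom is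
  indispensable here: sums of the other atoms have integral \<open>0\<close>.
\<close>

lemma bump_bounded: "\<exists>K. atomic_bound (bump (0 :: real ^ 'n)) K"
proof -
  let ?G = "measure gauss (UNIV :: (real ^ 'n) set)"
  have "step 0 (\<lambda>x::real^'n. 1)" by (simp add: step_def)
  from step_minus_bump[OF _ this, of 2] obtain K where
    K: "atomic_bound (\<lambda>y::real^'n. 1 - of_real ?G * bump 0 y) K" by (auto simp: scaleR_conv_of_real)
  have one: "atomic_bound (\<lambda>x::real^'n. 1) 1"
    using atomic_bound_atom[OF gaussian_atom_one, of 1] by simp
  have "atomic_bound (\<lambda>y::real^'n. 1 / of_real ?G * (1 + (- 1) * (1 - of_real ?G * bump 0 y)))
     (norm (1 / of_real ?G :: complex) * (1 + norm (- 1 :: complex) * K))"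
    by (intro atomic_bound_scale atomic_bound_add one K)
  moreover have "(\<lambda>y::real^'n. 1 / of_real ?G * (1 + (- 1) * (1 - of_real ?G * bump 0 y))) = bump 0"
    using gauss_mass_pos[where 'n = 'n] by (auto simp: fun_eq_iff)
  ultimately show ?thesis by metis
qed

lemma step_atomic_bound:
  assumes p: "1 < p"
  obtains C where "0 \<le> C" "\<And>N f s. step N (f :: real ^ 'n \<Rightarrow> complex) \<Longrightarrow> integrable gauss (\<lambda>x. norm (f x) powr p) \<Longrightarrow>
    0 < s \<Longrightarrow> (\<integral>x. norm (f x) powr p \<partial>gauss) \<le> s powr p \<Longrightarrow> atomic_bound f (C * s)"
proof -
  let ?G = "measure gauss (UNIV :: (real ^ 'n) set)"
  obtain K where K: "atomic_bound (bump (0 :: real ^ 'n)) K" using bump_bounded by blast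
  let ?q = "2 * (p / (p - 1))" and ?c = "piece_const TYPE('n) p"
  define m where "m = (\<integral>y. 1 + inv_radius (y::real^'n) powr ?q \<partial>gauss)"
  define C where "C = ?c * (1 + m) + (?G + 1) * K"
  have q: "0 \<le> ?q" using p by simp
  note mi = integrable_gauss_inv_radius_powr[OF q, where 'n = 'n]
  have c0: "0 \<le> ?c" by (rule piece_const_nonneg[OF p])
  have m0: "0 \<le> m" unfolding m_def by (rule integral_nonneg_AE) auto
  have K0: "0 \<le> K" by (rule atomic_bound_nonneg[OF K])
  have normalized: "atomic_bound f C" if f: "step N f" and fp: "integrable gauss (\<lambda>x. norm (f x) powr p)"
    and le: "(\<integral>x. norm (f x) powr p \<partial>gauss) \<le> 1" for N and f :: "real ^ 'n \<Rightarrow> complex"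
  proof -
    note fm = step_measurable[OF f]
    have "(\<integral>y. norm (f y) powr p + (1 + inv_radius y powr ?q) \<partial>gauss) = (\<integral>y. norm (f y) powr p \<partial>gauss) + m"
      unfolding m_def using fp mi by (intro Bochner_Integration.integral_add) auto
    also have "\<dots> \<le> 1 + m" using le by simp
    finally have 1: "atomic_bound (\<lambda>y. f y - (\<integral>x. f x \<partial>gauss) * bump 0 y) (?c * (1 + m))"
      using c0 by (intro atomic_bound_mono[OF step_minus_bump[OF p f fp]] mult_left_mono)
    have "norm (\<integral>x. f x \<partial>gauss) \<le> ?G + 1"
      using norm_set_integral_le[OF fm p fp _ zero_less_one, of UNIV] le by (simp add: set_lebesgue_integral_def)
    then have "norm (\<integral>x. f x \<partial>gauss) * K \<le> (?G + 1) * K"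
      using K0 by (rule mult_right_mono)
    then have 2: "atomic_bound (\<lambda>y::real^'n. (\<integral>x. f x \<partial>gauss) * bump 0 y) ((?G + 1) * K)"
      by (rule atomic_bound_mono[OF atomic_bound_scale[OF K]])
    from atomic_bound_add[OF 1 2] show ?thesis by (simp add: C_def)
  qed
  show ?thesis
  proof (rule that[of C])
    show "0 \<le> C" using c0 m0 K0 by (simp add: C_def)
    fix N and f :: "real ^ 'n \<Rightarrow> complex" and s :: real
    assume f: "step N f" "integrable gauss (\<lambda>x. norm (f x) powr p)"
      and s: "0 < s" "(\<integral>x. norm (f x) powr p \<partial>gauss) \<le> s powr p"
    have eq: "norm (1 / of_real s * f x) powr p = (1 / s) powr p * norm (f x) powr p" for x
      unfolding norm_mult using s(1) by (simp add: powr_divide norm_divide)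
    have "atomic_bound (\<lambda>x. 1 / of_real s * f x) C"
    proof (rule normalized)
      show "step N (\<lambda>x. 1 / of_real s * f x)" using f(1) by (auto simp: step_def)
      show "integrable gauss (\<lambda>x. norm (1 / of_real s * f x) powr p)" unfolding eq using f(2) by simp
      have "(\<integral>x. norm (1 / of_real s * f x) powr p \<partial>gauss) = (1 / s) powr p * (\<integral>x. norm (f x) powr p \<partial>gauss)"
        unfolding eq by simp
      also have "\<dots> \<le> (1 / s) powr p * s powr p" using s by (intro mult_left_mono) auto
      also have "\<dots> = 1" using s(1) by (simp add: powr_mult[symmetric])
      finally show "(\<integral>x. norm (1 / of_real s * f x) powr p \<partial>gauss) \<le> 1" .
    qed
    from atomic_bound_scale[OF this, of "of_real s"] show "atomic_bound f (C * s)"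
      using s(1) by (simp add: mult.commute)
  qed
qed

section \<open>Density of step functions\<close>

lemma norm_add_powr_le:
  fixes a b :: complex
  assumes "0 < p"
  shows "norm (a + b) powr p \<le> 2 powr p * (norm a powr p + norm b powr p)"
proof -
  have "norm (a + b) \<le> 2 * max (norm a) (norm b)"
    using norm_triangle_ineq[of a b] by linarith
  then have "norm (a + b) powr p \<le> (2 * max (norm a) (norm b)) powr p"
    using assms by (intro powr_mono2) auto
  also have "\<dots> = 2 powr p * max (norm a) (norm b) powr p"
    by (simp add: powr_mult)
  also have "max (norm a) (norm b) powr p \<le> norm a powr p + norm b powr p"
    by (simp add: max_def)
  finally show ?thesis by simp
qed

lemma step_combine:
  assumes "step N f" "step M g" "\<And>x y. f x = f y \<Longrightarrow> g x = g y \<Longrightarrow> h x = h y"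
  shows "step (max N M) h"
  using step_mono[OF assms(1), of "max N M"] step_mono[OF assms(2), of "max N M"] assms(3)
  unfolding step_def by (metis max.cobounded1 max.cobounded2)

lemma integrable_bounded_gauss:
  fixes f :: "real ^ 'n \<Rightarrow> 'b :: {banach, second_countable_topology}"
  assumes "f \<in> borel_measurable borel" "\<And>x. norm (f x) \<le> B"
  shows "integrable gauss f"
  using assms by (intro gauss.integrable_const_bound[where B = B]) (auto cong: measurable_cong_sets)

lemma gauss_le_lborel:
  assumes "S \<in> sets borel"
  shows "emeasure gauss S \<le> ennreal (pi powr (- real CARD('n) / 2)) * emeasure lborel (S :: (real ^ 'n) set)"
proof -
  have "emeasure gauss S = (\<integral>\<^sup>+x. ennreal (gauss_weight x) * indicator S x \<partial>lborel)"
    unfolding gauss_eq using assms by (subst emeasure_density) auto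
  also have "\<dots> \<le> (\<integral>\<^sup>+x. ennreal (pi powr (- real CARD('n) / 2)) * indicator S x \<partial>lborel)"
    by (intro nn_integral_mono mult_right_mono) (auto simp: gauss_weight_def intro!: ennreal_leI mult_left_le)
  also have "\<dots> = ennreal (pi powr (- real CARD('n) / 2)) * emeasure lborel S"
    using assms by (subst nn_integral_cmult) auto
  finally show ?thesis .
qed

text \<open>
  The cells of level \<open>k\<close> inside an open set exhaust it as \<open>k\<close> grows, because their diameters tend to \<open>0\<close>.
\<close>

lemma open_eq_UN_cells:
  fixes U :: "(real ^ 'n) set"
  assumes "open U"
  shows "(\<Union>k. {x. cell k x \<subseteq> U}) = U"
proof (intro set_eqI iffI)
  fix x assume "x \<in> U"
  then obtain e where e: "0 < e" "ball x e \<subseteq> U" using assms openE by blast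
  obtain k where "real CARD('n) / e < 2 ^ k" using real_arch_pow[of 2] by auto
  then have "real CARD('n) / 2 ^ k < e" using e(1) by (simp add: field_simps)
  then have "cell k x \<subseteq> ball x e" using cell_subset_cball[of k x] by auto
  then show "x \<in> (\<Union>k. {x. cell k x \<subseteq> U})" using e(2) by blast
qed (use in_cell_self in blast)

text \<open>
  Outer regularity encloses \<open>A\<close> in an open set of nearly the same measure, and the open set is the
  increasing limit of unions of cells.
\<close>

lemma indicator_approx:
  fixes A :: "(real ^ 'n) set"
  assumes A: "A \<in> sets borel" and e: "0 < e"
  obtains N S where "step N (\<lambda>x. indicat_real S x *\<^sub>R (1::complex))" "S \<in> sets borel"
    "measure gauss (A - S) + measure gauss (S - A) < (e :: real)"
proof -
  let ?g = "gauss :: (real ^ 'n) measure"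
  define w where "w = pi powr (- real CARD('n) / 2)"
  have w: "0 < w" by (simp add: w_def)
  obtain U :: "(real ^ 'n) set" where U: "open U" "A \<subseteq> U" "emeasure lborel (U - A) < ennreal (e / (2 * w))"
    using outer_regular_lborel[OF A, of "e / (2 * w)"] e w by auto
  define S where "S k = {x. cell k x \<subseteq> U}" for k
  have step: "step k (\<lambda>x. indicat_real (S k) x *\<^sub>R (1::complex))" for k
    by (auto simp: step_def S_def indicator_def cell_eqI)
  have Sm [measurable]: "S k \<in> sets borel" for k
  proof -
    have "(\<lambda>x. indicat_real (S k) x *\<^sub>R (1::complex)) -` {1} \<inter> space borel \<in> sets borel"
      by (rule measurable_sets[OF step_measurable[OF step]]) simp
    also have "(\<lambda>x. indicat_real (S k) x *\<^sub>R (1::complex)) -` {1} \<inter> space borel = S k"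
      by (auto simp: indicator_def of_bool_def split: if_splits)
    finally show ?thesis .
  qed
  have inc: "incseq S"
    unfolding S_def incseq_def using cell_mono by blast
  have SU: "(\<Union>k. S k) = U" unfolding S_def by (rule open_eq_UN_cells[OF U(1)])
  have "(\<lambda>k. measure ?g (S k)) \<longlonglongrightarrow> measure ?g (\<Union>k. S k)"
    by (rule gauss.finite_Lim_measure_incseq) (use inc in auto)
  then have "eventually (\<lambda>k. measure ?g U - e / 2 < measure ?g (S k)) sequentially"
    unfolding SU using e by (intro order_tendstoD(1)[of _ "measure ?g U"]) auto
  then obtain k where k: "measure ?g U - e / 2 < measure ?g (S k)"
    by (auto simp: eventually_sequentially)
  have Um [measurable]: "U \<in> sets borel" using U(1) by simp
  have SkU: "S k \<subseteq> U" using SU by blast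
  have "measure ?g (A - S k) \<le> measure ?g (U - S k)"
    using U(2) A by (intro gauss.finite_measure_mono) auto
  also have "\<dots> = measure ?g U - measure ?g (S k)"
    using SkU by (intro gauss.finite_measure_Diff) auto
  also have "\<dots> < e / 2" using k by linarith
  finally have 1: "measure ?g (A - S k) < e / 2" .
  have "emeasure ?g (S k - A) \<le> emeasure ?g (U - A)"
    using SkU A by (intro emeasure_mono) auto
  also have "\<dots> \<le> ennreal w * emeasure lborel (U - A)"
    unfolding w_def using A by (intro gauss_le_lborel) auto
  also have "\<dots> \<le> ennreal w * ennreal (e / (2 * w))"
    using less_imp_le[OF U(3)] by (rule mult_left_mono) simp
  also have "\<dots> = ennreal (e / 2)"
    using w e by (simp add: ennreal_mult[symmetric])
  finally have 2: "measure ?g (S k - A) \<le> e / 2"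
    using e by (simp add: gauss.emeasure_eq_measure)
  show ?thesis by (rule that[OF step[of k] Sm[of k]]) (use 1 2 in linarith)
qed

lemma step_dense_L1:
  fixes f :: "real ^ 'n \<Rightarrow> complex"
  assumes "integrable gauss f" "0 < e"
  shows "\<exists>N h. step N h \<and> integrable gauss h \<and> (\<integral>x. norm (f x - h x) \<partial>gauss) < e"
  using assms
proof (induction arbitrary: e rule: integrable_induct)
  case (base A c)
  let ?g = "gauss :: (real ^ 'n) measure"
  obtain N S where S: "step N (\<lambda>x. indicat_real S x *\<^sub>R (1::complex))" "S \<in> sets borel"
    "measure ?g (A - S) + measure ?g (S - A) < e / (norm c + 1)"
    using indicator_approx[of A "e / (norm c + 1)"] base by (auto simp: add_nonneg_pos)
  have Am: "A \<in> sets borel" using base by simp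
  have "norm (indicat_real A x *\<^sub>R c - indicat_real S x *\<^sub>R c) = norm c * (indicat_real (A - S) x + indicat_real (S - A) x)" for x
    by (auto simp: indicator_def)
  then have "(\<integral>x. norm (indicat_real A x *\<^sub>R c - indicat_real S x *\<^sub>R c) \<partial>?g)
     = norm c * (\<integral>x. indicat_real (A - S) x + indicat_real (S - A) x \<partial>?g)"
    by simp
  also have "(\<integral>x. indicat_real (A - S) x + indicat_real (S - A) x \<partial>?g) = measure ?g (A - S) + measure ?g (S - A)"
    using Am S(2) by (subst Bochner_Integration.integral_add) (auto simp: gauss.emeasure_eq_measure intro!: integrable_real_indicator)
  also have "norm c * \<dots> \<le> norm c * (e / (norm c + 1))"
    using S(3) by (intro mult_left_mono) auto
  also have "\<dots> < e" using base(3) by (simp add: divide_less_eq add_nonneg_pos distrib_left mult.commute)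
  finally have "(\<integral>x. norm (indicat_real A x *\<^sub>R c - indicat_real S x *\<^sub>R c) \<partial>?g) < e" .
  moreover have "step N (\<lambda>x. indicat_real S x *\<^sub>R c)"
    using S(1) by (auto simp: step_def indicator_def split: if_splits)
  moreover have "integrable ?g (\<lambda>x. indicat_real S x *\<^sub>R c)"
    using S(2) by (intro integrable_scaleR_left integrable_real_indicator) (auto simp: gauss.emeasure_eq_measure)
  ultimately show ?case by blast
next
  case (add f g)
  obtain N h where h: "step N h" "integrable gauss h" "(\<integral>x. norm (f x - h x) \<partial>gauss) < e / 2"
    using add.IH(1)[of "e / 2"] add.prems by auto
  obtain M k where k: "step M k" "integrable gauss k" "(\<integral>x. norm (g x - k x) \<partial>gauss) < e / 2"
    using add.IH(2)[of "e / 2"] add.prems by auto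
  have "(\<integral>x. norm (f x + g x - (h x + k x)) \<partial>gauss) \<le> (\<integral>x. norm (f x - h x) + norm (g x - k x) \<partial>gauss)"
    using add.hyps h(2) k(2) norm_diff_triangle_ineq
    by (intro integral_mono Bochner_Integration.integrable_add integrable_norm Bochner_Integration.integrable_diff) auto
  also have "\<dots> = (\<integral>x. norm (f x - h x) \<partial>gauss) + (\<integral>x. norm (g x - k x) \<partial>gauss)"
    using add.hyps h(2) k(2) by (intro Bochner_Integration.integral_add integrable_norm Bochner_Integration.integrable_diff)
  also have "\<dots> < e" using h(3) k(3) by simp
  finally have "(\<integral>x. norm (f x + g x - (h x + k x)) \<partial>gauss) < e" .
  moreover have "step (max N M) (\<lambda>x. h x + k x)" by (rule step_combine[OF h(1) k(1)]) auto
  moreover have "integrable gauss (\<lambda>x. h x + k x)" using h(2) k(2) by simp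
  ultimately show ?case by blast
next
  case (lim f s)
  have "(\<lambda>i. \<integral>x. norm (f x - s i x) \<partial>gauss) \<longlonglongrightarrow> (\<integral>x. 0 \<partial>(gauss :: (real ^ 'n) measure))"
  proof (rule integral_dominated_convergence)
    show "integrable gauss (\<lambda>x. 3 * norm (f x))" using lim.hyps(4) by simp
    show "(\<lambda>x. norm (f x - s i x)) \<in> borel_measurable gauss" for i
      using lim.hyps(1)[of i] lim.hyps(4) by auto
    show "AE x in gauss. (\<lambda>i. norm (f x - s i x)) \<longlonglongrightarrow> 0"
    proof (intro AE_I2 tendsto_norm_zero)
      fix x :: "real^'n"
      have "(\<lambda>i. f x - s i x) \<longlonglongrightarrow> f x - f x" by (intro tendsto_diff tendsto_const lim.hyps(2)) simp
      then show "(\<lambda>i. f x - s i x) \<longlonglongrightarrow> 0" by simp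
    qed
    show "AE x in gauss. norm (norm (f x - s i x)) \<le> 3 * norm (f x)" for i
    proof (intro AE_I2)
      fix x :: "real^'n"
      show "norm (norm (f x - s i x)) \<le> 3 * norm (f x)"
        using lim.hyps(3)[of x i] norm_triangle_ineq4[of "f x" "s i x"] by simp
    qed
  qed auto
  then have "eventually (\<lambda>i. (\<integral>x. norm (f x - s i x) \<partial>gauss) < e / 2) sequentially"
    using lim.prems by (intro order_tendstoD(2)[of _ 0]) auto
  then obtain i where i: "(\<integral>x. norm (f x - s i x) \<partial>gauss) < e / 2"
    by (auto simp: eventually_sequentially)
  obtain N h where h: "step N h" "integrable gauss h" "(\<integral>x. norm (s i x - h x) \<partial>gauss) < e / 2"
    using lim.IH[of "e / 2"  i] lim.prems by auto
  have "(\<integral>x. norm (f x - h x) \<partial>gauss) \<le> (\<integral>x. norm (f x - s i x) + norm (s i x - h x) \<partial>gauss)"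
    using lim.hyps(1)[of i] lim.hyps(4) h(2) norm_diff_triangle_le[OF order_refl order_refl]
    by (intro integral_mono Bochner_Integration.integrable_add integrable_norm Bochner_Integration.integrable_diff) auto
  also have "\<dots> = (\<integral>x. norm (f x - s i x) \<partial>gauss) + (\<integral>x. norm (s i x - h x) \<partial>gauss)"
    using lim.hyps(1)[of i] lim.hyps(4) h(2) by (intro Bochner_Integration.integral_add integrable_norm Bochner_Integration.integrable_diff)
  also have "\<dots> < e" using i h(3) by simp
  finally show ?case using h(1,2) by blast
qed

text \<open>
  Truncation reduces density in \<open>L\<^sup>p\<close> to density in \<open>L\<^sup>1\<close>: between functions bounded by multiples of \<open>M\<close> one has
  \<open>|u - v|\<^sup>p \<le> (3 M)\<^sup>p\<^sup>-\<^sup>1 |u - v|\<close>.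
\<close>

lemma step_dense_Lp:
  fixes f :: "real ^ 'n \<Rightarrow> complex"
  assumes [measurable]: "f \<in> borel_measurable borel" and p: "1 < p"
    and fp: "integrable gauss (\<lambda>x. norm (f x) powr p)" and e: "0 < e"
  shows "\<exists>N h. step N h \<and> integrable gauss (\<lambda>x. norm (h x) powr p) \<and>
    integrable gauss (\<lambda>x. norm (f x - h x) powr p) \<and> (\<integral>x. norm (f x - h x) powr p \<partial>gauss) < e"
proof -
  let ?c = "(2::real) powr p"
  have c: "0 < ?c" by simp
  define T where "T n x = (if norm (f x) \<le> real n then f x else 0)" for n :: nat and x
  have [measurable]: "T n \<in> borel_measurable borel" for n unfolding T_def[abs_def] by measurable
  have "(\<lambda>n. \<integral>x. norm (f x - T n x) powr p \<partial>gauss) \<longlonglongrightarrow> (\<integral>x. 0 \<partial>(gauss :: (real ^ 'n) measure))"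
  proof (rule integral_dominated_convergence[OF _ _ fp])
    show "(\<lambda>x. norm (f x - T n x) powr p) \<in> borel_measurable gauss" for n
      by (simp cong: measurable_cong_sets)
    show "AE x in gauss. (\<lambda>n. norm (f x - T n x) powr p) \<longlonglongrightarrow> 0"
    proof (intro AE_I2 tendsto_eventually)
      fix x :: "real^'n"
      obtain m :: nat where "norm (f x) \<le> real m" using real_arch_simple by blast
      then have "norm (f x - T n x) powr p = 0" if "n \<ge> m" for n
        using that by (simp add: T_def order_trans[of _ "real m"])
      then show "eventually (\<lambda>n. norm (f x - T n x) powr p = 0) sequentially"
        unfolding eventually_sequentially by blast
    qed
    show "AE x in gauss. norm (norm (f x - T n x) powr p) \<le> norm (f x) powr p" for n
      by (auto simp: T_def)
  qed auto
  then have "eventually (\<lambda>n. (\<integral>x. norm (f x - T n x) powr p \<partial>gauss) < e / (2 * ?c)) sequentially"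
    using e by (intro order_tendstoD(2)[of _ 0]) auto
  then obtain n0 where n0: "\<And>n. n \<ge> n0 \<Longrightarrow> (\<integral>x. norm (f x - T n x) powr p \<partial>gauss) < e / (2 * ?c)"
    by (auto simp: eventually_sequentially)
  define n where "n = Suc n0"
  define M where "M = real n"
  have M: "0 < M" by (simp add: M_def n_def)
  have Tp: "integrable gauss (\<lambda>x. norm (f x - T n x) powr p)"
    by (rule Bochner_Integration.integrable_bound[OF fp]) (auto simp: T_def cong: measurable_cong_sets)
  have TM: "norm (T n x) \<le> M" for x by (simp add: T_def M_def)
  have Ti: "integrable gauss (T n)" by (rule integrable_bounded_gauss) (use TM in auto)
  let ?d = "(3 * M) powr (p - 1)"
  have d: "0 < ?d" using M by simp
  obtain N h where h: "step N h" "integrable gauss h" "(\<integral>x. norm (T n x - h x) \<partial>gauss) < e / (2 * ?c * ?d)"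
    using step_dense_L1[OF Ti, of "e / (2 * ?c * ?d)"] e c d by auto
  \<comment> \<open>Where \<open>h\<close> exceeds \<open>2 M\<close> it is further than \<open>M\<close> from the truncation of \<open>f\<close>, so replacing it by \<open>0\<close> does not
    increase the distance.\<close>
  define k where "k x = (if norm (h x) \<le> 2 * M then h x else 0)" for x
  have kN: "step N k" using h(1) by (auto simp: step_def k_def)
  note [measurable] = step_measurable[OF kN] step_measurable[OF h(1)]
  have kM: "norm (k x) \<le> 2 * M" for x using M by (simp add: k_def)
  have bdd: "integrable gauss (\<lambda>x. norm (g x) powr p)" if "g \<in> borel_measurable borel" "\<And>x. norm (g x) \<le> B"
    for g :: "real^'n \<Rightarrow> complex" and B
    by (rule integrable_bounded_gauss[where B = "B powr p"]) (use that p in \<open>auto intro!: powr_mono2\<close>)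
  have kp: "integrable gauss (\<lambda>x. norm (k x) powr p)"
    by (rule bdd[OF _ kM]) simp
  have Tk: "norm (T n x - k x) \<le> 3 * M" for x
    using norm_triangle_ineq4[of "T n x" "k x"] TM[of x] kM[of x] by linarith
  have Tkp: "integrable gauss (\<lambda>x. norm (T n x - k x) powr p)"
    by (rule bdd[OF _ Tk]) simp
  have pw: "norm (T n x - k x) powr p \<le> ?d * norm (T n x - h x)" for x
  proof -
    have le: "norm (T n x - k x) \<le> norm (T n x - h x)"
      using TM[of x] norm_triangle_ineq3[of "h x" "T n x"] by (auto simp: k_def norm_minus_commute)
    have "norm (T n x - k x) powr p = norm (T n x - k x) powr (p - 1) * norm (T n x - k x)"
      by (cases "T n x - k x = 0") (auto simp: powr_diff)
    also have "\<dots> \<le> ?d * norm (T n x - h x)"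
      using le Tk[of x] p M by (intro mult_mono powr_mono2) auto
    finally show ?thesis .
  qed
  have "(\<integral>x. norm (T n x - k x) powr p \<partial>gauss) \<le> (\<integral>x. ?d * norm (T n x - h x) \<partial>gauss)"
    using Tkp Ti h(2) pw by (intro integral_mono) auto
  also have "\<dots> = ?d * (\<integral>x. norm (T n x - h x) \<partial>gauss)" by simp
  also have "\<dots> < ?d * (e / (2 * ?c * ?d))" using h(3) d by (intro mult_strict_left_mono)
  also have "\<dots> = e / (2 * ?c)" using d by (simp add: field_simps)
  finally have 2: "(\<integral>x. norm (T n x - k x) powr p \<partial>gauss) < e / (2 * ?c)" .
  have 1: "(\<integral>x. norm (f x - T n x) powr p \<partial>gauss) < e / (2 * ?c)" by (rule n0) (simp add: n_def)
  have sum: "norm (f x - k x) powr p \<le> ?c * (norm (f x - T n x) powr p + norm (T n x - k x) powr p)" for x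
    using norm_add_powr_le[of p "f x - T n x" "T n x - k x"] p by simp
  have int: "integrable gauss (\<lambda>x. ?c * (norm (f x - T n x) powr p + norm (T n x - k x) powr p))"
    using Tp Tkp by simp
  have fk: "integrable gauss (\<lambda>x. norm (f x - k x) powr p)"
    by (rule Bochner_Integration.integrable_bound[OF int])
      (use sum in \<open>auto cong: measurable_cong_sets intro: order_trans[OF _ abs_ge_self]\<close>)
  have "(\<integral>x. norm (f x - k x) powr p \<partial>gauss) \<le> (\<integral>x. ?c * (norm (f x - T n x) powr p + norm (T n x - k x) powr p) \<partial>gauss)"
    by (rule integral_mono[OF fk int sum])
  also have "\<dots> = ?c * ((\<integral>x. norm (f x - T n x) powr p \<partial>gauss) + (\<integral>x. norm (T n x - k x) powr p \<partial>gauss))"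
    using Tp Tkp by simp
  also have "\<dots> < ?c * (e / (2 * ?c) + e / (2 * ?c))"
    using 1 2 by (intro mult_strict_left_mono add_strict_mono) auto
  also have "\<dots> = e" using c by (simp add: field_simps)
  finally show ?thesis using kN kp fk by blast
qed

text \<open>
  Step functions \<open>h k\<close> that approach \<open>f\<close> at a geometric rate give \<open>f = h 0 + (h 1 - h 0) + (h 2 - h 1) + \<dots>\<close>, where the bounds for
  the terms form a convergent series.
\<close>

section \<open>Atomic decomposition of \<open>L\<^sup>p\<close> functions\<close>

lemma Lp_atomic_bound:
  assumes p: "1 < p"
  obtains C where "0 \<le> C" "\<And>f s. (f :: real ^ 'n \<Rightarrow> complex) \<in> borel_measurable borel \<Longrightarrow>
    integrable gauss (\<lambda>x. norm (f x) powr p) \<Longrightarrow> 0 < s \<Longrightarrow>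
    (\<integral>x. norm (f x) powr p \<partial>gauss) \<le> s powr p \<Longrightarrow> atomic_bound f (C * s)"
proof -
  obtain C where C: "0 \<le> C" "\<And>N f s. step N (f :: real ^ 'n \<Rightarrow> complex) \<Longrightarrow> integrable gauss (\<lambda>x. norm (f x) powr p) \<Longrightarrow>
    0 < s \<Longrightarrow> (\<integral>x. norm (f x) powr p \<partial>gauss) \<le> s powr p \<Longrightarrow> atomic_bound f (C * s)"
    using step_atomic_bound[OF p] by blast
  let ?c = "(2::real) powr p"
  have bound: "atomic_bound f (6 * C * s)" if f: "f \<in> borel_measurable borel"
    and fp: "integrable gauss (\<lambda>x. norm (f x) powr p)" and s: "0 < s"
    and le: "(\<integral>x. norm (f x) powr p \<partial>gauss) \<le> s powr p" for f :: "real ^ 'n \<Rightarrow> complex" and s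
  proof -
    define \<eta> where "\<eta> k = s * (1 / 2) ^ k" for k :: nat
    have \<eta>: "0 < \<eta> k" "\<eta> (Suc k) \<le> \<eta> k" for k using s by (auto simp: \<eta>_def)
    \<comment> \<open>With this accuracy \<open>\<integral> |h (k + 1) - h k|\<^sup>p \<le> (\<eta> k)\<^sup>p\<close>, as \<open>?c\<close> is the constant of the quasi-triangle inequality
      for \<open>p\<close>-th powers.\<close>
    define \<epsilon> where "\<epsilon> k = \<eta> k powr p / (2 * ?c)" for k
    have \<epsilon>: "0 < \<epsilon> k" "\<epsilon> (Suc k) \<le> \<epsilon> k" for k
      using \<eta>[of k] \<eta>(1)[of "Suc k"] p by (auto simp: \<epsilon>_def intro!: divide_right_mono powr_mono2)
    define D where "D k N h \<longleftrightarrow> step N h \<and> integrable gauss (\<lambda>x. norm (h x) powr p) \<and>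
      integrable gauss (\<lambda>x. norm (f x - h x) powr p) \<and> (\<integral>x. norm (f x - h x) powr p \<partial>gauss) < \<epsilon> k" for k N h
    have "\<forall>k. \<exists>N h. D k N h"
      unfolding D_def using step_dense_Lp[OF f p fp \<epsilon>(1)] by blast
    then obtain N h where D: "\<And>k. D k (N k) (h k)" by metis
    have h: "step (N k) (h k)" "integrable gauss (\<lambda>x. norm (h k x) powr p)"
      "integrable gauss (\<lambda>x. norm (f x - h k x) powr p)" "(\<integral>x. norm (f x - h k x) powr p \<partial>gauss) < \<epsilon> k" for k
      using D[of k] by (auto simp: D_def)
    note hm = step_measurable[OF h(1)]
    have add: "integrable gauss (\<lambda>x. norm (u x + v x) powr p) \<and>
        (\<integral>x. norm (u x + v x) powr p \<partial>gauss) \<le> ?c * ((\<integral>x. norm (u x) powr p \<partial>gauss) + (\<integral>x. norm (v x) powr p \<partial>gauss))"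
      if uv: "u \<in> borel_measurable borel" "v \<in> borel_measurable borel"
        and int: "integrable gauss (\<lambda>x. norm (u x) powr p)" "integrable gauss (\<lambda>x. norm (v x) powr p)"
      for u v :: "real ^ 'n \<Rightarrow> complex"
    proof -
      have pw: "norm (u x + v x) powr p \<le> ?c * (norm (u x) powr p + norm (v x) powr p)" for x
        using p by (intro norm_add_powr_le) auto
      have 1: "integrable gauss (\<lambda>x. ?c * (norm (u x) powr p + norm (v x) powr p))" using int by simp
      have 2: "integrable gauss (\<lambda>x. norm (u x + v x) powr p)"
        by (rule Bochner_Integration.integrable_bound[OF 1])
          (use pw uv in \<open>auto cong: measurable_cong_sets intro: order_trans[OF _ abs_ge_self]\<close>)
      have "(\<integral>x. norm (u x + v x) powr p \<partial>gauss) \<le> (\<integral>x. ?c * (norm (u x) powr p + norm (v x) powr p) \<partial>gauss)"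
        by (rule integral_mono[OF 2 1 pw])
      then show ?thesis using 2 int by simp
    qed
    define g where "g k = (case k of 0 \<Rightarrow> h 0 | Suc j \<Rightarrow> (\<lambda>x. h (Suc j) x - h j x))" for k
    define L where "L k = (case k of 0 \<Rightarrow> C * (4 * s) | Suc j \<Rightarrow> C * \<eta> j)" for k
    have L_sums: "L sums (6 * C * s)"
    proof -
      have "(\<lambda>j. L (Suc j)) sums (C * (s * 2))"
        unfolding L_def \<eta>_def nat.case by (intro sums_mult) (use geometric_sums[of "1/2::real"] in simp)
      then have "L sums (C * (s * 2) + L 0)" by (rule sums_Suc)
      moreover have "C * (s * 2) + L 0 = 6 * C * s" by (simp add: L_def)
      ultimately show ?thesis by simp
    qed
    have "atomic_bound f (\<Sum>k. L k)"
    proof (rule atomic_bound_suminf[where f = g])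
      show "atomic_bound (g k) (L k)" for k
      proof (cases k)
        case 0
        have int: "integrable gauss (\<lambda>x. norm (h 0 x - f x) powr p)"
          using h(3)[of 0] by (simp add: norm_minus_commute)
        have "(\<integral>x. norm (f x + (h 0 x - f x)) powr p \<partial>gauss) \<le>
            ?c * ((\<integral>x. norm (f x) powr p \<partial>gauss) + (\<integral>x. norm (h 0 x - f x) powr p \<partial>gauss))"
          using add[OF f _ fp int] f hm[of 0] by simp
        also have "\<dots> \<le> ?c * (s powr p + \<epsilon> 0)"
          using le h(4)[of 0] by (intro mult_left_mono add_mono) (auto simp: norm_minus_commute)
        also have "\<dots> \<le> ?c * (s powr p + s powr p)"
        proof -
          have "1 \<le> ?c" using p by (intro ge_one_powr_ge_zero) auto
          then have "\<epsilon> 0 \<le> s powr p" by (simp add: \<epsilon>_def \<eta>_def divide_le_eq mult_le_cancel_left1)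
          then show ?thesis by simp
        qed
        also have "\<dots> = ?c * 2 powr 1 * s powr p" by simp
        also have "\<dots> \<le> ?c * 2 powr p * s powr p"
          using p by (intro mult_right_mono mult_left_mono powr_mono) auto
        also have "\<dots> = (4 * s) powr p" using s by (simp add: powr_mult[symmetric])
        finally have "(\<integral>x. norm (h 0 x) powr p \<partial>gauss) \<le> (4 * s) powr p" by simp
        then show ?thesis using C(2)[OF h(1,2), of "4 * s" 0] s by (simp add: 0 g_def L_def)
      next
        case (Suc j)
        have int: "integrable gauss (\<lambda>x. norm (h (Suc j) x - f x) powr p)"
          using h(3)[of "Suc j"] by (simp add: norm_minus_commute)
        have *: "integrable gauss (\<lambda>x. norm ((h (Suc j) x - f x) + (f x - h j x)) powr p) \<and>
            (\<integral>x. norm ((h (Suc j) x - f x) + (f x - h j x)) powr p \<partial>gauss) \<le>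
            ?c * ((\<integral>x. norm (h (Suc j) x - f x) powr p \<partial>gauss) + (\<integral>x. norm (f x - h j x) powr p \<partial>gauss))"
          by (rule add[OF _ _ int h(3)]) (use f hm in auto)
        have "(\<integral>x. norm (h (Suc j) x - h j x) powr p \<partial>gauss) \<le> 
           ?c * ((\<integral>x. norm (h (Suc j) x - f x) powr p \<partial>gauss) + (\<integral>x. norm (f x - h j x) powr p \<partial>gauss))"
          using * by simp
        also have "\<dots> \<le> ?c * (\<epsilon> j + \<epsilon> j)"
          using h(4)[of "Suc j"] h(4)[of j] \<epsilon>(2)[of j]
          by (intro mult_left_mono add_mono) (auto simp: norm_minus_commute)
        also have "\<dots> = \<eta> j powr p" by (simp add: \<epsilon>_def)
        finally have le: "(\<integral>x. norm (h (Suc j) x - h j x) powr p \<partial>gauss) \<le> \<eta> j powr p" .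
        have "step (max (N (Suc j)) (N j)) (\<lambda>x. h (Suc j) x - h j x)"
          by (rule step_combine[OF h(1) h(1)]) simp
        then show ?thesis using C(2)[OF _ _ \<eta>(1) le] * by (simp add: Suc g_def L_def)
      qed
      show "summable L" using L_sums by (simp add: sums_iff)
      show "f \<in> borel_measurable borel" by (rule f)
      have fin: "(\<integral>\<^sup>+x. (\<Sum>k. ennreal (norm (f x - h k x) powr p)) \<partial>gauss) \<noteq> \<infinity>"
      proof -
        have "(\<integral>\<^sup>+x. (\<Sum>k. ennreal (norm (f x - h k x) powr p)) \<partial>gauss) = (\<Sum>k. \<integral>\<^sup>+x. ennreal (norm (f x - h k x) powr p) \<partial>gauss)"
          by (rule nn_integral_suminf) (use f hm in \<open>simp cong: measurable_cong_sets\<close>)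
        also have "\<dots> = (\<Sum>k. ennreal (\<integral>x. norm (f x - h k x) powr p \<partial>gauss))"
          using h(3) by (intro suminf_cong nn_integral_eq_integral) auto
        also have "\<dots> < \<infinity>"
        proof -
          have "summable \<epsilon>"
          proof -
            have "(1 / 2) powr p < (1::real)" using p powr_less_mono2[of p "1 / 2" 1] by simp
            then have "summable (\<lambda>k. s powr p / (2 * ?c) * ((1 / 2) powr p) ^ k)"
              by (intro summable_mult summable_geometric) simp
            also have "(\<lambda>k. s powr p / (2 * ?c) * ((1 / 2) powr p) ^ k) = \<epsilon>"
              using s by (auto simp: \<epsilon>_def \<eta>_def powr_mult fun_eq_iff powr_powr mult.commute simp flip: powr_realpow)
            finally show ?thesis .
          qed
          then have "summable (\<lambda>k. \<integral>x. norm (f x - h k x) powr p \<partial>gauss)"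
            by (rule summable_comparison_test'[where N = 0]) (use h(4) in \<open>auto simp: less_imp_le\<close>)
          then show ?thesis by (simp add: suminf_ennreal2)
        qed
        finally show ?thesis by simp
      qed
      have "AE x in gauss. (\<Sum>k. ennreal (norm (f x - h k x) powr p)) \<noteq> \<infinity>"
        by (rule nn_integral_noteq_infinite[OF _ fin]) (use f hm in \<open>simp cong: measurable_cong_sets\<close>)
      then show "AE x in gauss. (\<lambda>k. g k x) sums f x"
      proof eventually_elim
        case (elim x)
        then have "summable (\<lambda>k. norm (f x - h k x) powr p)" by (intro summable_suminf_not_top) auto
        then have "(\<lambda>k. norm (f x - h k x) powr p) \<longlonglongrightarrow> 0" by (rule summable_LIMSEQ_zero)
        then have "(\<lambda>k. (norm (f x - h k x) powr p) powr (1 / p)) \<longlonglongrightarrow> 0 powr (1 / p)"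
          by (rule tendsto_powr2) (use p in auto)
        then have "(\<lambda>k. norm (f x - h k x)) \<longlonglongrightarrow> 0" using p by (simp add: powr_powr)
        then have "(\<lambda>k. f x - h k x) \<longlonglongrightarrow> 0" by (rule tendsto_norm_zero_cancel)
        then have "(\<lambda>k. f x - (f x - h k x)) \<longlonglongrightarrow> f x - 0" by (intro tendsto_diff tendsto_const)
        then have lim: "(\<lambda>k. h k x) \<longlonglongrightarrow> f x" by simp
        have "(\<Sum>k<Suc n. g k x) = h n x" for n by (induction n) (auto simp: g_def)
        then have "(\<lambda>n. \<Sum>k<Suc n. g k x) \<longlonglongrightarrow> f x" using lim by simp
        then show ?case unfolding sums_def by (rule LIMSEQ_imp_Suc)
      qed
    qed
    then show ?thesis using L_sums by (simp add: sums_iff)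
  qed
  show ?thesis by (rule that[of "6 * C"]) (use C(1) bound in auto)
qed

lemma Lp_atomic_bound_norm:
  assumes p: "1 < p"
  obtains C where "0 \<le> C" "\<And>f. (f :: real ^ 'n \<Rightarrow> complex) \<in> borel_measurable borel \<Longrightarrow>
    integrable gauss (\<lambda>x. norm (f x) powr p) \<Longrightarrow>
    atomic_bound f (C * (\<integral>x. norm (f x) powr p \<partial>gauss) powr (1 / p))"
proof -
  obtain C where C: "0 \<le> C" "\<And>f s. (f :: real ^ 'n \<Rightarrow> complex) \<in> borel_measurable borel \<Longrightarrow>
    integrable gauss (\<lambda>x. norm (f x) powr p) \<Longrightarrow> 0 < s \<Longrightarrow>
    (\<integral>x. norm (f x) powr p \<partial>gauss) \<le> s powr p \<Longrightarrow> atomic_bound f (C * s)"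
    using Lp_atomic_bound[OF p] by blast
  show ?thesis
  proof (rule that[OF C(1)])
    fix f :: "real ^ 'n \<Rightarrow> complex"
    assume f: "f \<in> borel_measurable borel" "integrable gauss (\<lambda>x. norm (f x) powr p)"
    define I where "I = (\<integral>x. norm (f x) powr p \<partial>gauss)"
    have "0 \<le> I" unfolding I_def by (rule integral_nonneg_AE) simp
    show "atomic_bound f (C * I powr (1 / p))"
    proof (cases "I = 0")
      case True
      then have "AE x in gauss. norm (f x) powr p = 0"
        using integral_nonneg_eq_0_iff_AE[OF f(2)] by (simp add: I_def)
      then have "AE x in gauss. 0 = f x" by eventually_elim simp
      from atomic_bound_AE_cong[OF atomic_bound_zero this f(1)] show ?thesis using True by simp
    next
      case False
      then show ?thesis
        using \<open>0 \<le> I\<close> p by (intro C(2) f) (auto simp: powr_powr I_def)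
    qed
  qed
qed

section \<open>Duality with bounded mean oscillation\<close>

lemma cball_0_1_admissible: "cball 0 1 \<in> (admissible_balls :: (real ^ 'n) set set)"
  by (rule cball_admissible) (auto simp: inv_radius_def)

lemma mean_oscillation_nonneg: "0 \<le> mean_oscillation f B"
  unfolding mean_oscillation_def set_lebesgue_integral_def
  by (intro mult_nonneg_nonneg integral_nonneg_AE) auto

lemma Lp_norm_1: "Lp_norm gauss 1 f = (\<integral>x. norm (f x) \<partial>gauss)"
  by (simp add: Lp_norm_def powr_one')

lemma BMO_facts:
  fixes f :: "real ^ 'n \<Rightarrow> complex"
  assumes "f \<in> BMO"
  shows BMO_measurable: "f \<in> borel_measurable borel"
    and BMO_integrable: "integrable gauss f"
    and mean_oscillation_le_BMO_norm: "B \<in> admissible_balls \<Longrightarrow> mean_oscillation f B \<le> BMO_norm f"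
    and L1_norm_le_BMO_norm: "(\<integral>x. norm (f x) \<partial>gauss) \<le> BMO_norm f"
proof -
  show "f \<in> borel_measurable borel" "integrable gauss f"
    using assms by (auto simp: BMO_def Lp_def powr_one' integrable_norm_iff cong: measurable_cong_sets)
  have bdd: "bdd_above (mean_oscillation f ` admissible_balls)"
    using assms by (simp add: BMO_def)
  show "mean_oscillation f B \<le> BMO_norm f" if "B \<in> admissible_balls"
    using cSUP_upper[OF that bdd] by (simp add: BMO_norm_def Lp_norm_1 add_increasing)
  have "0 \<le> (SUP B \<in> admissible_balls. mean_oscillation f B)"
    by (rule cSUP_upper2[OF bdd cball_0_1_admissible mean_oscillation_nonneg])
  then show "(\<integral>x. norm (f x) \<partial>gauss) \<le> BMO_norm f"
    by (simp add: BMO_norm_def Lp_norm_1)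
qed

lemma BMO_norm_nonneg:
  assumes "f \<in> BMO"
  shows "0 \<le> BMO_norm f"
proof -
  have "0 \<le> (\<integral>x. norm (f x) \<partial>gauss)" by simp
  also have "\<dots> \<le> BMO_norm f" by (rule L1_norm_le_BMO_norm[OF assms])
  finally show ?thesis .
qed

text \<open>
  The truncation \<open>h\<close> makes the pairing with an \<open>L\<^sup>1\<close> function meaningful. It does not increase oscillation, since
  \<open>t \<mapsto> min |t| b\<close> is a contraction: with \<open>c\<close> the truncation of the mean of \<open>f\<close> over the ball, one has
  \<open>|h - c| \<le> |f - f\<^sub>B|\<close>.
\<close>

lemma atom_pairing:
  fixes f :: "real ^ 'n \<Rightarrow> complex" and h :: "real ^ 'n \<Rightarrow> real"
  assumes f: "f \<in> BMO" and a: "gaussian_atom a" and b: "0 \<le> b"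
    and h: "h = (\<lambda>x. min (norm (f x)) b)"
  shows "norm (\<integral>x. of_real (h x) * a x \<partial>gauss) \<le> BMO_norm f"
proof -
  note fm [measurable] = BMO_measurable[OF f] and fi = BMO_integrable[OF f]
  have hm [measurable]: "h \<in> borel_measurable borel" unfolding h by measurable
  have hb: "0 \<le> h x" "h x \<le> b" for x using b by (auto simp: h)
  have hi: "integrable gauss h"
    by (rule integrable_bounded_gauss[where B = b]) (use hb in auto)
  show ?thesis
  proof (cases "a = (\<lambda>_. 1)")
    case True
    have "norm (\<integral>x. complex_of_real (h x) * a x \<partial>gauss) = (\<integral>x. h x \<partial>gauss)"
      using hb by (simp add: True integral_nonneg_AE)
    also have "\<dots> \<le> (\<integral>x. norm (f x) \<partial>gauss)"
      using fi hi by (intro integral_mono) (auto simp: h)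
    also have "\<dots> \<le> BMO_norm f" by (rule L1_norm_le_BMO_norm[OF f])
    finally show ?thesis .
  next
    case False
    then obtain B where aL: "a \<in> Lp gauss \<infinity>" and B: "B \<in> admissible_balls"
      and supp: "AE x in gauss. x \<notin> B \<longrightarrow> a x = 0" and int0: "(\<integral>x. a x \<partial>gauss) = 0"
      and le: "Lp_norm gauss \<infinity> a \<le> 1 / measure gauss B"
      using a by (auto simp: gaussian_atom_def)
    note am [measurable] = gaussian_atom_measurable[OF a]
    note ai = gaussian_atom_integrable[OF a]
    have Bm [measurable]: "B \<in> sets borel" using B by (auto simp: admissible_balls_def)
    define c where "c = min (norm (gauss_mean B f)) b"
    have a_le: "AE x in gauss. norm (a x) \<le> 1 / measure gauss B"
      using Linfty_AE_le[OF aL] by eventually_elim (use le in linarith)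
    have hai: "integrable gauss (\<lambda>x. complex_of_real (h x) * a x)"
    proof (rule Bochner_Integration.integrable_bound)
      show "integrable gauss (\<lambda>x. b * norm (a x))" using ai by simp
      show "AE x in gauss. norm (complex_of_real (h x) * a x) \<le> norm (b * norm (a x))"
        using hb b by (auto simp: norm_mult intro!: mult_right_mono)
    qed (simp cong: measurable_cong_sets)
    have "(\<integral>x. complex_of_real (h x) * a x \<partial>gauss) = (\<integral>x. of_real (h x) * a x - of_real c * a x \<partial>gauss)"
      using hai ai int0 by simp
    also have "\<dots> = (\<integral>x. of_real (h x - c) * a x \<partial>gauss)" by (simp add: left_diff_distrib)
    also have "norm \<dots> \<le> (\<integral>x. norm (of_real (h x - c) * a x) \<partial>gauss)" by (rule integral_norm_bound)
    also have "\<dots> \<le> (\<integral>x. 1 / measure gauss B * (indicat_real B x * norm (f x - gauss_mean B f)) \<partial>gauss)"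
    proof (rule integral_mono_AE)
      have "(\<lambda>x. of_real (h x - c) * a x) = (\<lambda>x. complex_of_real (h x) * a x - of_real c * a x)"
        by (simp add: left_diff_distrib)
      then show "integrable gauss (\<lambda>x. norm (of_real (h x - c) * a x))"
        using hai ai by simp
      have "integrable gauss (\<lambda>x. indicat_real B x *\<^sub>R norm (f x - gauss_mean B f))"
        using fi by (intro integrable_mult_indicator) auto
      then show "integrable gauss (\<lambda>x. 1 / measure gauss B * (indicat_real B x * norm (f x - gauss_mean B f)))"
        by simp
      show "AE x in gauss. norm (of_real (h x - c) * a x) \<le> 1 / measure gauss B * (indicat_real B x * norm (f x - gauss_mean B f))"
        using supp a_le
      proof eventually_elim
        case (elim x)
        show ?case
        proof (cases "x \<in> B")
          case True
          have "\<bar>h x - c\<bar> \<le> \<bar>norm (f x) - norm (gauss_mean B f)\<bar>"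
            unfolding h c_def by linarith
          also have "\<dots> \<le> norm (f x - gauss_mean B f)" by (rule norm_triangle_ineq3)
          finally have "norm (of_real (h x - c) * a x) \<le> norm (f x - gauss_mean B f) * (1 / measure gauss B)"
            using elim(2) unfolding norm_mult norm_of_real by (intro mult_mono) auto
          then show ?thesis using True by (simp add: mult.commute)
        qed (use elim(1) in simp)
      qed
    qed
    also have "\<dots> = mean_oscillation f B"
      by (simp add: mean_oscillation_def set_lebesgue_integral_def)
    also have "\<dots> \<le> BMO_norm f" by (rule mean_oscillation_le_BMO_norm[OF f B])
    finally show ?thesis .
  qed
qed

text \<open>
  A bounded function may be integrated term by term against an atomic series, and each term is an \<open>atom_pairing\<close>.
\<close>

lemma truncation_pairing:
  fixes f :: "real ^ 'n \<Rightarrow> complex" and h :: "real ^ 'n \<Rightarrow> real"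
  assumes f: "f \<in> BMO" and g: "atomic_bound g K" and b: "0 \<le> b"
    and h: "h = (\<lambda>x. min (norm (f x)) b)"
  shows "norm (\<integral>x. of_real (h x) * g x \<partial>gauss) \<le> K * BMO_norm f"
proof -
  obtain c a where ca: "\<And>j. gaussian_atom (a j)" "summable (\<lambda>j. norm (c j))"
    "(\<Sum>j. norm (c j)) \<le> K" "AE x in gauss. (\<lambda>j. c j * a j x) sums g x"
    by (rule atomic_boundE[OF g]) blast
  note [measurable] = BMO_measurable[OF f]
  note [measurable] = gaussian_atom_measurable[OF ca(1)] atomic_bound_measurable[OF g]
  have hm [measurable]: "h \<in> borel_measurable borel" unfolding h by measurable
  have hb: "0 \<le> h x" "h x \<le> b" for x using b by (auto simp: h)
  have int: "integrable gauss (\<lambda>x. of_real (h x) * (c j * a j x))" for j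
  proof (rule Bochner_Integration.integrable_bound)
    show "integrable gauss (\<lambda>x. b * norm (c j * a j x))"
      using gaussian_atom_integrable[OF ca(1)[of j]] by (intro integrable_mult_right integrable_norm) auto
    show "AE x in gauss. norm (of_real (h x) * (c j * a j x)) \<le> norm (b * norm (c j * a j x))"
      using hb b by (auto simp: norm_mult intro!: mult_right_mono)
  qed (simp cong: measurable_cong_sets)
  have bound: "norm (of_real (h x) * (c j * a j x)) \<le> b * norm (c j * a j x)" for x j
    using hb unfolding norm_mult by (intro mult_right_mono) auto
  have S: "(\<lambda>j. \<integral>x. of_real (h x) * (c j * a j x) \<partial>gauss) sums (\<integral>x. (\<Sum>j. of_real (h x) * (c j * a j x)) \<partial>gauss)"
  proof (rule sums_integral[OF int])
    show "AE x in gauss. summable (\<lambda>j. norm (of_real (h x) * (c j * a j x)))"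
      using atomic_series_AE_summable[of a c, OF ca(1,2)]
    proof eventually_elim
      case (elim x)
      show ?case by (rule summable_comparison_test'[OF summable_mult[OF elim, of b]]) (use bound in auto)
    qed
    have "(\<integral>x. norm (of_real (h x) * (c j * a j x)) \<partial>gauss) \<le> b * (\<integral>x. norm (c j * a j x) \<partial>gauss)" for j
    proof -
      have "(\<integral>x. norm (of_real (h x) * (c j * a j x)) \<partial>gauss) \<le> (\<integral>x. b * norm (c j * a j x) \<partial>gauss)"
        using gaussian_atom_integrable[OF ca(1)[of j]] bound
        by (intro integral_mono integrable_norm int integrable_mult_right) auto
      then show ?thesis by simp
    qed
    then show "summable (\<lambda>j. \<integral>x. norm (of_real (h x) * (c j * a j x)) \<partial>gauss)"
      by (intro summable_comparison_test'[OF summable_mult[OF atomic_series_integral_summable[of a c, OF ca(1,2)], of b]]) auto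
  qed
  have "(\<integral>x. (\<Sum>j. of_real (h x) * (c j * a j x)) \<partial>gauss) = (\<integral>x. of_real (h x) * g x \<partial>gauss)"
  proof (rule integral_cong_AE)
    show "AE x in gauss. (\<Sum>j. of_real (h x) * (c j * a j x)) = of_real (h x) * g x"
      using ca(4) by eventually_elim (auto simp: sums_iff suminf_mult)
  qed (auto cong: measurable_cong_sets)
  with S have S: "(\<lambda>j. \<integral>x. of_real (h x) * (c j * a j x) \<partial>gauss) sums (\<integral>x. of_real (h x) * g x \<partial>gauss)" by simp
  have each: "norm (\<integral>x. of_real (h x) * (c j * a j x) \<partial>gauss) \<le> norm (c j) * BMO_norm f" for j
  proof -
    have "(\<integral>x. of_real (h x) * (c j * a j x) \<partial>gauss) = c j * (\<integral>x. of_real (h x) * a j x \<partial>gauss)"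
      by (simp add: mult.left_commute)
    then show ?thesis
      using atom_pairing[OF f ca(1)[of j] b h] by (simp add: norm_mult mult_left_mono)
  qed
  have sum: "summable (\<lambda>j. norm (c j) * BMO_norm f)" using ca(2) by (rule summable_mult2)
  have "norm (\<integral>x. of_real (h x) * g x \<partial>gauss) \<le> (\<Sum>j. norm (c j) * BMO_norm f)"
    using norm_suminf_le[OF each sum] S by (simp add: sums_iff)
  also have "\<dots> = (\<Sum>j. norm (c j)) * BMO_norm f" using ca(2) by (simp add: suminf_mult2)
  also have "\<dots> \<le> K * BMO_norm f" using ca(3) BMO_norm_nonneg[OF f] by (rule mult_right_mono)
  finally show ?thesis .
qed

text \<open>
  Test the pairing of \<open>h = min |f| n\<close> with \<open>g = h\<^sup>q\<^sup>-\<^sup>1\<close>, for which \<open>|g|\<^sup>p = h g = h\<^sup>q\<close>. The truncation makes \<open>\<integral> h\<^sup>q\<close>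
  finite, so that it can be divided out, and the bound does not depend on \<open>n\<close>.
\<close>

lemma BMO_Lq:
  fixes p q C :: real and f :: "real ^ 'n \<Rightarrow> complex"
  assumes p: "1 < p" and q: "q = p / (p - 1)"
    and C: "\<And>g. (g :: real ^ 'n \<Rightarrow> complex) \<in> borel_measurable borel \<Longrightarrow>
      integrable gauss (\<lambda>x. norm (g x) powr p) \<Longrightarrow>
      atomic_bound g (C * (\<integral>x. norm (g x) powr p \<partial>gauss) powr (1 / p))"
    and f: "f \<in> BMO"
  shows "integrable gauss (\<lambda>x. norm (f x) powr q)"
    and "(\<integral>x. norm (f x) powr q \<partial>gauss) powr (1 / q) \<le> C * BMO_norm f"
proof -
  have q1: "1 < q" using p by (simp add: q)
  have conj: "(q - 1) * p = q" using p by (simp add: q field_simps)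
  have conj': "1 / p + 1 / q = 1" using p by (simp add: q field_simps)
  note [measurable] = BMO_measurable[OF f]
  define h where "h n x = min (norm (f x)) (real n)" for n :: nat and x
  have [measurable]: "h n \<in> borel_measurable borel" for n unfolding h_def[abs_def] by measurable
  have hb: "0 \<le> h n x" "h n x \<le> real n" for n x by (auto simp: h_def)
  have hi: "integrable gauss (\<lambda>x. h n x powr q)" for n
    by (rule integrable_bounded_gauss[where B = "real n powr q"]) (use hb q1 in \<open>auto intro!: powr_mono2\<close>)
  define I where "I n = (\<integral>x. h n x powr q \<partial>gauss)" for n
  have I0: "0 \<le> I n" for n unfolding I_def by (rule integral_nonneg_AE) simp
  have In: "I n powr (1 / q) \<le> C * BMO_norm f" for n
  proof (cases "I n = 0")
    case True
    have "atomic_bound (\<lambda>x::real^'n. 1) (C * (\<integral>x. norm (1::complex) powr p \<partial>(gauss :: (real ^ 'n) measure)) powr (1 / p))"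
      by (rule C) auto
    then have "0 \<le> C * measure gauss (UNIV :: (real^'n) set) powr (1 / p)"
      using atomic_bound_nonneg by fastforce
    then have "0 \<le> C" using gauss_mass_pos[where 'n = 'n] by (simp add: zero_le_mult_iff)
    then show ?thesis using True BMO_norm_nonneg[OF f] by simp
  next
    case False
    then have I: "0 < I n" using I0[of n] by simp
    define g where "g x = complex_of_real (h n x powr (q - 1))" for x
    have ng: "norm (g x) powr p = h n x powr q" for x
      by (simp add: g_def powr_powr conj)
    have "atomic_bound g (C * I n powr (1 / p))"
      using C[of g] hi[of n] unfolding ng I_def by (simp add: g_def[abs_def])
    from truncation_pairing[OF f this, of "real n" "h n"]
    have le: "norm (\<integral>x. of_real (h n x) * g x \<partial>gauss) \<le> C * I n powr (1 / p) * BMO_norm f"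
      by (simp add: h_def[abs_def])
    have "h n x * h n x powr (q - 1) = h n x powr q" for x
      using hb(1)[of n x] by (cases "h n x = 0") (auto simp: powr_diff)
    then have "of_real (h n x) * g x = complex_of_real (h n x powr q)" for x
      by (simp add: g_def flip: of_real_mult)
    then have "(\<integral>x. of_real (h n x) * g x \<partial>gauss) = of_real (I n)"
      by (simp add: I_def)
    with le I have "I n powr (1 / p + 1 / q) \<le> C * I n powr (1 / p) * BMO_norm f"
      unfolding conj' by simp
    then have "I n powr (1 / p) * I n powr (1 / q) \<le> I n powr (1 / p) * (C * BMO_norm f)"
      unfolding powr_add by (simp add: mult_ac)
    then show ?thesis using I by simp
  qed
  have In': "I n \<le> (C * BMO_norm f) powr q" for n
  proof -
    have "I n = (I n powr (1 / q)) powr q" using I0[of n] q1 by (simp add: powr_powr)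
    also have "\<dots> \<le> (C * BMO_norm f) powr q" using In q1 by (intro powr_mono2) auto
    finally show ?thesis .
  qed
  have mono: "AE x in gauss. mono (\<lambda>n. h n x powr q)"
    using q1 by (intro AE_I2 monoI powr_mono2) (auto simp: h_def)
  have lim: "AE x in gauss. (\<lambda>n. h n x powr q) \<longlonglongrightarrow> norm (f x) powr q"
  proof (intro AE_I2 tendsto_eventually)
    fix x :: "real^'n"
    obtain m :: nat where "norm (f x) \<le> real m" using real_arch_simple by blast
    then have "h n x powr q = norm (f x) powr q" if "n \<ge> m" for n
      using that by (simp add: h_def min_absorb1 order_trans[of _ "real m"])
    then show "eventually (\<lambda>n. h n x powr q = norm (f x) powr q) sequentially"
      unfolding eventually_sequentially by blast
  qed
  have "incseq I"
    unfolding I_def incseq_def using q1 hi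
    by (intro allI impI integral_mono powr_mono2) (auto simp: h_def)
  then obtain l where l: "I \<longlonglongrightarrow> l"
    using incseq_convergent[of I] In' by blast
  have fint: "integrable gauss (\<lambda>x. norm (f x) powr q)" "(\<integral>x. norm (f x) powr q \<partial>gauss) = l"
    using integrable_monotone_convergence[OF hi mono lim] integral_monotone_convergence[OF hi mono lim] l
    unfolding I_def by (auto cong: measurable_cong_sets)
  show "integrable gauss (\<lambda>x. norm (f x) powr q)" by (rule fint)
  have "(\<lambda>n. I n powr (1 / q)) \<longlonglongrightarrow> l powr (1 / q)"
    using l I0 q1 by (intro tendsto_powr2) auto
  then show "(\<integral>x. norm (f x) powr q \<partial>gauss) powr (1 / q) \<le> C * BMO_norm f"
    unfolding fint(2) by (rule LIMSEQ_le_const2) (use In in blast)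
qed

section \<open>The inclusions\<close>

lemma continuously_included_atomic:
  assumes "\<And>f. f \<in> X \<Longrightarrow> atomic_bound f (C * normX f)"
  shows "continuously_included X normX H1 H1_norm"
  unfolding continuously_included_def
proof (intro conjI subsetI exI ballI)
  fix f assume "f \<in> X"
  from atomic_bound_imp_H1[OF assms[OF this]] show "f \<in> H1" "H1_norm f \<le> C * normX f" by auto
qed

lemma Lp_finite:
  assumes "p \<noteq> \<infinity>"
  shows "f \<in> Lp gauss p \<longleftrightarrow> f \<in> borel_measurable borel \<and> integrable gauss (\<lambda>x. norm (f x) powr enn2real p)"
    and "Lp_norm gauss p f = (\<integral>x. norm (f x) powr enn2real p \<partial>gauss) powr (1 / enn2real p)"
  using assms by (auto simp: Lp_def Lp_norm_def cong: measurable_cong_sets)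

theorem corollary4p3:
  fixes p :: ennreal
  assumes "1 < p"
  shows "continuously_included
           (Lp (gauss :: (real ^ 'n) measure) p) (Lp_norm gauss p) H1 H1_norm \<and>
         continuously_included
           BMO BMO_norm
           (Lp (gauss :: (real ^ 'n) measure) (conj_exponent p)) (Lp_norm gauss (conj_exponent p))"
proof (cases "p = \<infinity>")
  case True
  let ?G = "measure gauss (UNIV :: (real ^ 'n) set)"
  obtain C where C: "0 \<le> C" "\<And>f. (f :: real ^ 'n \<Rightarrow> complex) \<in> borel_measurable borel \<Longrightarrow>
    integrable gauss (\<lambda>x. norm (f x) powr 2) \<Longrightarrow>
    atomic_bound f (C * (\<integral>x. norm (f x) powr 2 \<partial>gauss) powr (1 / 2))"
    using Lp_atomic_bound_norm[of 2] by auto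
  have "continuously_included (Lp (gauss :: (real ^ 'n) measure) p) (Lp_norm gauss p) H1 H1_norm"
  proof (rule continuously_included_atomic)
    fix f :: "real ^ 'n \<Rightarrow> complex"
    assume "f \<in> Lp gauss p"
    then have f: "f \<in> Lp gauss \<infinity>" and [measurable]: "f \<in> borel_measurable borel"
      by (auto simp: True Lp_def cong: measurable_cong_sets)
    let ?E = "Lp_norm gauss \<infinity> f"
    have E0: "0 \<le> ?E" by (simp add: Lp_norm_def)
    have le: "AE x in gauss. norm (f x) powr 2 \<le> ?E powr 2"
      using Linfty_AE_le[OF f] by eventually_elim (rule powr_mono2, auto)
    have int: "integrable gauss (\<lambda>x. norm (f x) powr 2)"
      using le by (intro gauss.integrable_const_bound[where B = "?E powr 2"]) (auto cong: measurable_cong_sets)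
    have "(\<integral>x. norm (f x) powr 2 \<partial>gauss) \<le> (\<integral>x. ?E powr 2 \<partial>(gauss :: (real ^ 'n) measure))"
      using le int by (intro integral_mono_AE) auto
    then have "(\<integral>x. norm (f x) powr 2 \<partial>gauss) powr (1 / 2) \<le> (?G * ?E powr 2) powr (1 / 2)"
      by (intro powr_mono2 integral_nonneg_AE) auto
    also have "\<dots> = ?G powr (1 / 2) * ?E"
      using E0 by (simp add: powr_mult powr_powr)
    finally have "C * (\<integral>x. norm (f x) powr 2 \<partial>gauss) powr (1 / 2) \<le> C * ?G powr (1 / 2) * ?E"
      using C(1) by (simp add: mult_left_mono mult.assoc)
    then show "atomic_bound f (C * ?G powr (1 / 2) * Lp_norm gauss p f)"
      unfolding True by (rule atomic_bound_mono[OF C(2)[OF _ int], rotated]) simp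
  qed
  moreover have "continuously_included BMO BMO_norm
     (Lp (gauss :: (real ^ 'n) measure) (conj_exponent p)) (Lp_norm gauss (conj_exponent p))"
    unfolding continuously_included_def
  proof (intro conjI exI[of _ 1] ballI subsetI)
    fix f :: "real ^ 'n \<Rightarrow> complex" assume f: "f \<in> BMO"
    show "f \<in> Lp gauss (conj_exponent p)" using f by (simp add: True conj_exponent_def BMO_def)
    show "Lp_norm gauss (conj_exponent p) f \<le> 1 * BMO_norm f"
      using L1_norm_le_BMO_norm[OF f] by (simp add: True conj_exponent_def Lp_norm_1)
  qed
  ultimately show ?thesis ..
next
  case False
  define P where "P = enn2real p"
  have pP: "p = ennreal P" "0 \<le> P" using False by (simp_all add: P_def less_top)
  then have P: "1 < P" using assms by (metis ennreal_1 ennreal_less_iff zero_le_one)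
  define q where "q = P / (P - 1)"
  have "p - 1 = ennreal (P - 1)" using P by (simp add: pP ennreal_minus flip: ennreal_1)
  then have qeq: "conj_exponent p = ennreal q"
    using P False by (simp add: conj_exponent_def pP divide_ennreal q_def)
  have q0: "0 < q" using P by (simp add: q_def)
  obtain C where C: "0 \<le> C" "\<And>f. (f :: real ^ 'n \<Rightarrow> complex) \<in> borel_measurable borel \<Longrightarrow>
    integrable gauss (\<lambda>x. norm (f x) powr P) \<Longrightarrow>
    atomic_bound f (C * (\<integral>x. norm (f x) powr P \<partial>gauss) powr (1 / P))"
    using Lp_atomic_bound_norm[OF P] by blast
  have "continuously_included (Lp (gauss :: (real ^ 'n) measure) p) (Lp_norm gauss p) H1 H1_norm"
  proof (rule continuously_included_atomic)
    fix f :: "real ^ 'n \<Rightarrow> complex" assume "f \<in> Lp gauss p"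
    then show "atomic_bound f (C * Lp_norm gauss p f)"
      using C(2)[of f] by (simp add: Lp_finite[OF False] P_def)
  qed
  moreover have "continuously_included BMO BMO_norm
     (Lp (gauss :: (real ^ 'n) measure) (conj_exponent p)) (Lp_norm gauss (conj_exponent p))"
    unfolding continuously_included_def
  proof (intro conjI exI[of _ C] ballI subsetI)
    fix f :: "real ^ 'n \<Rightarrow> complex" assume f: "f \<in> BMO"
    note Lq = BMO_Lq[OF P q_def C(2) f]
    show "f \<in> Lp gauss (conj_exponent p)"
      using Lq(1) BMO_measurable[OF f] q0 by (simp add: qeq Lp_finite)
    show "Lp_norm gauss (conj_exponent p) f \<le> C * BMO_norm f"
      using Lq(2) q0 by (simp add: qeq Lp_finite)
  qed
  ultimately show ?thesis ..
qed

end
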